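(* Let $(H,g)$ be a finite type pivotal Hopf $G$-coalgebra over a field $\Bbbk$, and assume $(H,g)$ is unimodular. Then the symmetrised right (resp. left) $G$-integral for $(H,g)$ (associated with a non-zero right, resp. left, $G$-integral) is symmetric and non-degenerate; that is, for every $\alpha\in G$ the bilinear form $(x,y)\mapsto\widetilde\mu_\alpha(xy)$ (resp. $(x,y)\mapsto\widetilde\mu^l_\alpha(xy)$) on $H_\alpha$ is symmetric and non-degenerate.
   Context: $G$ is a multiplicative group, $\Bbbk$ a field. Hopf $G$-coalgebra: a family $H=(H_\alpha)_{\alpha\in G}$ of unital associative $\Bbbk$-algebras with algebra homomorphisms $\Delta_{\alpha,\beta}:H_{\alpha\beta}\to H_\alpha\otimes H_\beta$ and $\varepsilon:H_1\to\Bbbk$ and linear maps $S_\alpha:H_\alpha\to H_{\alpha^{-1}}$ such that $(\Delta_{\alpha,\beta}\otimes\mathrm{Id})\Delta_{\alpha\beta,\gamma}=(\mathrm{Id}\otimes\Delta_{\beta,\gamma})\Delta_{\alpha,\beta\gamma}$, $(\mathrm{Id}\otimes\varepsilon)\Delta_{\alpha,1}=\mathrm{Id}=(\varepsilon\otimes\mathrm{Id})\Delta_{1,\alpha}$, and $m_\alpha(S_{\alpha^{-1}}\otimes\mathrm{Id})\Delta_{\alpha^{-1},\alpha}=\varepsilon 1_\alpha=m_\alpha(\mathrm{Id}\otimes S_{\alpha^{-1}})\Delta_{\alpha,\alpha^{-1}}$. It is of finite type if every $H_\alpha$ is finite dimensional. It is unimodular if the Hopf algebra $H_1$ is unimodular,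 i.e. the spaces of left and right cointegrals of $H_1$ coincide. A pivot is a family $g=(g_\alpha)\in\prod_\alpha H_\alpha$ with $\Delta_{\alpha,\beta}(g_{\alpha\beta})=g_\alpha\otimes g_\beta$, $\varepsilon(g_1)=1$ and $S_{\alpha^{-1}}S_\alpha(x)=g_\alpha xg_\alpha^{-1}$ for $x\in H_\alpha$; $(H,g)$ is then a pivotal Hopf $G$-coalgebra. A right $G$-integral is a family $\mu=(\mu_\alpha)\in\prod_\alpha H_\alpha^*$ with $(\mu_\alpha\otimes\mathrm{Id}_{H_\beta})\Delta_{\alpha,\beta}(x)=\mu_{\alpha\beta}(x)1_\beta$ for all $\alpha,\beta\in G$, $x\in H_{\alpha\beta}$; a left $G$-integral is a family $\mu^l$ with $(\mathrm{Id}_{H_\alpha}\otimes\mu^l_\beta)\Delta_{\alpha,\beta}(x)=\mu^l_{\alpha\beta}(x)1_\alpha$. For finite type $H$ both spaces are one-dimensional. The symmetrised right $G$-integral associated with $\mu$ is $\widetilde\mu_\alpha(x)=\mu_\alpha(g_\alpha x)$; the symmetrised left $G$-integral associated with $\mu^l$ is $\widetilde\mu^l_\alpha(x)=\mu^l_\alpha(g_\alpha^{-1}x)$. *)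

theory Defs
  imports "HOL-Algebra.AbelCoset" "Jordan_Normal_Form.Missing_VectorSpace"
begin

section \<open>Tensor products of vector spaces and algebras\<close>

text \<open>
  Vector spaces are \<^locale>\<open>vectorspace\<close>s in the sense of the AFP entry VectorSpace: module records
  over a field record.  Where such a record carries no algebra structure, its \<open>mult\<close> and \<open>one\<close>
  fields are dummies.
\<close>

definition scalar_space :: "('k, 'n) ring_scheme \<Rightarrow> ('k, 'k) module" where
  "scalar_space K = \<lparr>carrier = carrier K, mult = mult K, one = one K, zero = zero K, add = add K,
     smult = mult K\<rparr>"

text \<open>The free vector space on \<open>X\<close>: finitely supported functions, vanishing outside \<open>X\<close>.\<close>

definition free_space :: "('k, 'n) ring_scheme \<Rightarrow> 'x set \<Rightarrow> ('k, 'x \<Rightarrow> 'k) module" where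
  "free_space K X = \<lparr>
     carrier = {f. (\<forall>x. f x \<in> carrier K) \<and> finite {x. f x \<noteq> \<zero>\<^bsub>K\<^esub>} \<and> {x. f x \<noteq> \<zero>\<^bsub>K\<^esub>} \<subseteq> X},
     mult = (\<lambda>f h x. \<zero>\<^bsub>K\<^esub>), one = (\<lambda>x. \<zero>\<^bsub>K\<^esub>),
     zero = (\<lambda>x. \<zero>\<^bsub>K\<^esub>), add = (\<lambda>f h x. f x \<oplus>\<^bsub>K\<^esub> h x), smult = (\<lambda>c f x. c \<otimes>\<^bsub>K\<^esub> f x)\<rparr>"

definition free_gen :: "('k, 'n) ring_scheme \<Rightarrow> 'x \<Rightarrow> 'x \<Rightarrow> 'k" where
  "free_gen K p = (\<lambda>q. if q = p then \<one>\<^bsub>K\<^esub> else \<zero>\<^bsub>K\<^esub>)"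

definition quotient_space :: "('k, 'v, 'm) module_scheme \<Rightarrow> 'v set \<Rightarrow> ('k, 'v set) module" where
  "quotient_space M N = \<lparr>carrier = a_rcosets\<^bsub>M\<^esub> N, mult = (\<lambda>X Y. N), one = N,
     zero = N, add = (\<lambda>X Y. X <+>\<^bsub>M\<^esub> Y), smult = (\<lambda>c X. \<Union>x\<in>X. N +>\<^bsub>M\<^esub> (c \<odot>\<^bsub>M\<^esub> x))\<rparr>"

definition tensor_relations ::
  "('k, 'n) ring_scheme \<Rightarrow> ('k, 'v, 'm) module_scheme \<Rightarrow> ('k, 'w, 'l) module_scheme \<Rightarrow>
    ('v \<times> 'w \<Rightarrow> 'k) set" where
  "tensor_relations K V W =
     (let F = free_space K (carrier V \<times> carrier W); d = (\<lambda>v w. free_gen K (v, w)) in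
       {d (v \<oplus>\<^bsub>V\<^esub> v') w \<ominus>\<^bsub>F\<^esub> (d v w \<oplus>\<^bsub>F\<^esub> d v' w) | v v' w.
          v \<in> carrier V \<and> v' \<in> carrier V \<and> w \<in> carrier W} \<union>
       {d v (w \<oplus>\<^bsub>W\<^esub> w') \<ominus>\<^bsub>F\<^esub> (d v w \<oplus>\<^bsub>F\<^esub> d v w') | v w w'.
          v \<in> carrier V \<and> w \<in> carrier W \<and> w' \<in> carrier W} \<union>
       {d (c \<odot>\<^bsub>V\<^esub> v) w \<ominus>\<^bsub>F\<^esub> c \<odot>\<^bsub>F\<^esub> d v w | c v w.
          c \<in> carrier K \<and> v \<in> carrier V \<and> w \<in> carrier W} \<union>
       {d v (c \<odot>\<^bsub>W\<^esub> w) \<ominus>\<^bsub>F\<^esub> c \<odot>\<^bsub>F\<^esub> d v w | c v w.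
          c \<in> carrier K \<and> v \<in> carrier V \<and> w \<in> carrier W})"

definition tensor_kernel ::
  "('k, 'n) ring_scheme \<Rightarrow> ('k, 'v, 'm) module_scheme \<Rightarrow> ('k, 'w, 'l) module_scheme \<Rightarrow>
    ('v \<times> 'w \<Rightarrow> 'k) set" where
  "tensor_kernel K V W =
     module.span K (free_space K (carrier V \<times> carrier W)) (tensor_relations K V W)"

definition tensor_space ::
  "('k, 'n) ring_scheme \<Rightarrow> ('k, 'v, 'm) module_scheme \<Rightarrow> ('k, 'w, 'l) module_scheme \<Rightarrow>
    ('k, ('v \<times> 'w \<Rightarrow> 'k) set) module" where
  "tensor_space K V W =
     quotient_space (free_space K (carrier V \<times> carrier W)) (tensor_kernel K V W)"

definition pure_tensor ::
  "('k, 'n) ring_scheme \<Rightarrow> ('k, 'v, 'm) module_scheme \<Rightarrow> ('k, 'w, 'l) module_scheme \<Rightarrow>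
    'v \<Rightarrow> 'w \<Rightarrow> ('v \<times> 'w \<Rightarrow> 'k) set" where
  "pure_tensor K V W v w =
     tensor_kernel K V W +>\<^bsub>free_space K (carrier V \<times> carrier W)\<^esub> free_gen K (v, w)"

text \<open>
  The linear map into \<open>M\<close> that a bilinear map \<open>B\<close> induces on a tensor product: the linear extension
  of \<open>B\<close> to the free space is constant on every coset, and \<^const>\<open>the_elem\<close> picks that value.
  All maps out of tensor products below are given in this way.
\<close>

definition tensor_lift ::
  "('k, 'n) ring_scheme \<Rightarrow> ('k, 'u, 'm) module_scheme \<Rightarrow> ('v \<Rightarrow> 'w \<Rightarrow> 'u) \<Rightarrow>
    ('v \<times> 'w \<Rightarrow> 'k) set \<Rightarrow> 'u" where
  "tensor_lift K M B t =
     the_elem ((\<lambda>f. \<Oplus>\<^bsub>M\<^esub>p\<in>{p. f p \<noteq> \<zero>\<^bsub>K\<^esub>}. f p \<odot>\<^bsub>M\<^esub> B (fst p) (snd p)) ` t)"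

text \<open>The map \<open>f \<otimes> h\<close> into the tensor product of \<open>V\<close> and \<open>W\<close>.\<close>

definition tensor_map ::
  "('k, 'n) ring_scheme \<Rightarrow> ('k, 'v, 'm) module_scheme \<Rightarrow> ('k, 'w, 'l) module_scheme \<Rightarrow>
    ('x \<Rightarrow> 'v) \<Rightarrow> ('y \<Rightarrow> 'w) \<Rightarrow> ('x \<times> 'y \<Rightarrow> 'k) set \<Rightarrow> ('v \<times> 'w \<Rightarrow> 'k) set" where
  "tensor_map K V W f h =
     tensor_lift K (tensor_space K V W) (\<lambda>x y. pure_tensor K V W (f x) (h y))"

text \<open>The canonical isomorphism from \<open>(U \<otimes> V) \<otimes> W\<close> to \<open>U \<otimes> (V \<otimes> W)\<close>.\<close>

definition tensor_assoc ::
  "('k, 'n) ring_scheme \<Rightarrow> ('k, 'u, 'j) module_scheme \<Rightarrow> ('k, 'v, 'm) module_scheme \<Rightarrow>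
    ('k, 'w, 'l) module_scheme \<Rightarrow> (('u \<times> 'v \<Rightarrow> 'k) set \<times> 'w \<Rightarrow> 'k) set \<Rightarrow>
    ('u \<times> ('v \<times> 'w \<Rightarrow> 'k) set \<Rightarrow> 'k) set" where
  "tensor_assoc K U V W =
     (let T = tensor_space K U (tensor_space K V W) in
       tensor_lift K T (\<lambda>t w.
         tensor_lift K T (\<lambda>u v. pure_tensor K U (tensor_space K V W) u (pure_tensor K V W v w)) t))"

text \<open>The canonical identifications of \<open>K \<otimes> V\<close> and \<open>V \<otimes> K\<close> with \<open>V\<close>.\<close>

definition left_unitor ::
  "('k, 'n) ring_scheme \<Rightarrow> ('k, 'v, 'm) module_scheme \<Rightarrow> ('k \<times> 'v \<Rightarrow> 'k) set \<Rightarrow> 'v" where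
  "left_unitor K V = tensor_lift K V (\<lambda>c v. c \<odot>\<^bsub>V\<^esub> v)"

definition right_unitor ::
  "('k, 'n) ring_scheme \<Rightarrow> ('k, 'v, 'm) module_scheme \<Rightarrow> ('v \<times> 'k \<Rightarrow> 'k) set \<Rightarrow> 'v" where
  "right_unitor K V = tensor_lift K V (\<lambda>v c. c \<odot>\<^bsub>V\<^esub> v)"

text \<open>
  Unital associative algebras; the library locale \<^locale>\<open>algebra\<close> only covers commutative ones.
  The zero algebra is allowed.
\<close>

locale unital_algebra = vectorspace K A + ring A for K and A +
  assumes smult_mult_left:
      "\<lbrakk>c \<in> carrier K; x \<in> carrier A; y \<in> carrier A\<rbrakk> \<Longrightarrow>
        (c \<odot>\<^bsub>A\<^esub> x) \<otimes>\<^bsub>A\<^esub> y = c \<odot>\<^bsub>A\<^esub> (x \<otimes>\<^bsub>A\<^esub> y)"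
    and smult_mult_right:
      "\<lbrakk>c \<in> carrier K; x \<in> carrier A; y \<in> carrier A\<rbrakk> \<Longrightarrow>
        x \<otimes>\<^bsub>A\<^esub> (c \<odot>\<^bsub>A\<^esub> y) = c \<odot>\<^bsub>A\<^esub> (x \<otimes>\<^bsub>A\<^esub> y)"

definition algebra_hom ::
  "('k, 'n) ring_scheme \<Rightarrow> ('k, 'a, 'm) module_scheme \<Rightarrow> ('k, 'b, 'l) module_scheme \<Rightarrow>
    ('a \<Rightarrow> 'b) set" where
  "algebra_hom K A B = ring_hom A B \<inter> module_hom K A B"

text \<open>The product is determined by \<open>(a \<otimes> b) (a' \<otimes> b') = a a' \<otimes> b b'\<close>.\<close>

definition tensor_algebra ::
  "('k, 'n) ring_scheme \<Rightarrow> ('k, 'a, 'm) module_scheme \<Rightarrow> ('k, 'b, 'l) module_scheme \<Rightarrow>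
    ('k, ('a \<times> 'b \<Rightarrow> 'k) set) module" where
  "tensor_algebra K A B =
     (let T = tensor_space K A B in
       T\<lparr>mult := (\<lambda>s t. tensor_lift K T (\<lambda>a b.
            tensor_lift K T (\<lambda>a' b'. pure_tensor K A B (a \<otimes>\<^bsub>A\<^esub> a') (b \<otimes>\<^bsub>B\<^esub> b')) t) s),
         one := pure_tensor K A B \<one>\<^bsub>A\<^esub> \<one>\<^bsub>B\<^esub>\<rparr>)"

definition mult_map ::
  "('k, 'n) ring_scheme \<Rightarrow> ('k, 'a, 'm) module_scheme \<Rightarrow> ('a \<times> 'a \<Rightarrow> 'k) set \<Rightarrow> 'a" where
  "mult_map K A = tensor_lift K A (\<lambda>x y. x \<otimes>\<^bsub>A\<^esub> y)"


section \<open>Hopf \<open>G\<close>-coalgebras\<close>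

text \<open>
  The algebras \<open>H \<alpha>\<close> live on possibly different carrier sets inside one common type \<open>'a\<close>; only
  indices in the carrier of \<open>G\<close> matter.
\<close>

locale hopf_group_coalgebra = group G + K: field K
  for G :: "('g, 'm) monoid_scheme" (structure) and K :: "('k, 'n) ring_scheme" +
  fixes H :: "'g \<Rightarrow> ('k, 'a) module"
    and \<Delta> :: "'g \<Rightarrow> 'g \<Rightarrow> 'a \<Rightarrow> ('a \<times> 'a \<Rightarrow> 'k) set"
    and \<epsilon> :: "'a \<Rightarrow> 'k"
    and S :: "'g \<Rightarrow> 'a \<Rightarrow> 'a"
  assumes algebras: "\<alpha> \<in> carrier G \<Longrightarrow> unital_algebra K (H \<alpha>)"
    and comult_hom: "\<lbrakk>\<alpha> \<in> carrier G; \<beta> \<in> carrier G\<rbrakk> \<Longrightarrow>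
      \<Delta> \<alpha> \<beta> \<in> algebra_hom K (H (\<alpha> \<otimes> \<beta>)) (tensor_algebra K (H \<alpha>) (H \<beta>))"
    and counit_hom: "\<epsilon> \<in> algebra_hom K (H \<one>) (scalar_space K)"
    and antipode_hom: "\<alpha> \<in> carrier G \<Longrightarrow> S \<alpha> \<in> module_hom K (H \<alpha>) (H (inv \<alpha>))"
    and coassoc: "\<lbrakk>\<alpha> \<in> carrier G; \<beta> \<in> carrier G; \<gamma> \<in> carrier G; x \<in> carrier (H (\<alpha> \<otimes> \<beta> \<otimes> \<gamma>))\<rbrakk> \<Longrightarrow>
      tensor_assoc K (H \<alpha>) (H \<beta>) (H \<gamma>)
        (tensor_map K (tensor_space K (H \<alpha>) (H \<beta>)) (H \<gamma>) (\<Delta> \<alpha> \<beta>) id (\<Delta> (\<alpha> \<otimes> \<beta>) \<gamma> x)) =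
      tensor_map K (H \<alpha>) (tensor_space K (H \<beta>) (H \<gamma>)) id (\<Delta> \<beta> \<gamma>) (\<Delta> \<alpha> (\<beta> \<otimes> \<gamma>) x)"
    and counit_right: "\<lbrakk>\<alpha> \<in> carrier G; x \<in> carrier (H \<alpha>)\<rbrakk> \<Longrightarrow>
      right_unitor K (H \<alpha>) (tensor_map K (H \<alpha>) (scalar_space K) id \<epsilon> (\<Delta> \<alpha> \<one> x)) = x"
    and counit_left: "\<lbrakk>\<alpha> \<in> carrier G; x \<in> carrier (H \<alpha>)\<rbrakk> \<Longrightarrow>
      left_unitor K (H \<alpha>) (tensor_map K (scalar_space K) (H \<alpha>) \<epsilon> id (\<Delta> \<one> \<alpha> x)) = x"
    and antipode_left: "\<lbrakk>\<alpha> \<in> carrier G; x \<in> carrier (H \<one>)\<rbrakk> \<Longrightarrow>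
      mult_map K (H \<alpha>) (tensor_map K (H \<alpha>) (H \<alpha>) (S (inv \<alpha>)) id (\<Delta> (inv \<alpha>) \<alpha> x)) =
      \<epsilon> x \<odot>\<^bsub>H \<alpha>\<^esub> \<one>\<^bsub>H \<alpha>\<^esub>"
    and antipode_right: "\<lbrakk>\<alpha> \<in> carrier G; x \<in> carrier (H \<one>)\<rbrakk> \<Longrightarrow>
      mult_map K (H \<alpha>) (tensor_map K (H \<alpha>) (H \<alpha>) id (S (inv \<alpha>)) (\<Delta> \<alpha> (inv \<alpha>) x)) =
      \<epsilon> x \<odot>\<^bsub>H \<alpha>\<^esub> \<one>\<^bsub>H \<alpha>\<^esub>"

text \<open>
  The first two pivot axioms make every \<open>g \<alpha>\<close> a unit of \<open>H \<alpha>\<close> with inverse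
  \<open>S (inv \<alpha>) (g (inv \<alpha>))\<close> (apply the antipode axioms to \<open>g \<one>\<close>), so the inverse below is genuine.
\<close>

locale pivotal_hopf_group_coalgebra = hopf_group_coalgebra G K H \<Delta> \<epsilon> S
  for G :: "('g, 'm) monoid_scheme" (structure) and K :: "('k, 'n) ring_scheme"
    and H :: "'g \<Rightarrow> ('k, 'a) module" and \<Delta> and \<epsilon> and S +
  fixes g :: "'g \<Rightarrow> 'a"
  assumes pivot_closed: "\<alpha> \<in> carrier G \<Longrightarrow> g \<alpha> \<in> carrier (H \<alpha>)"
    and pivot_comult: "\<lbrakk>\<alpha> \<in> carrier G; \<beta> \<in> carrier G\<rbrakk> \<Longrightarrow>
      \<Delta> \<alpha> \<beta> (g (\<alpha> \<otimes> \<beta>)) = pure_tensor K (H \<alpha>) (H \<beta>) (g \<alpha>) (g \<beta>)"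
    and pivot_counit: "\<epsilon> (g \<one>) = \<one>\<^bsub>K\<^esub>"
    and pivot_conj: "\<lbrakk>\<alpha> \<in> carrier G; x \<in> carrier (H \<alpha>)\<rbrakk> \<Longrightarrow>
      S (inv \<alpha>) (S \<alpha> x) = g \<alpha> \<otimes>\<^bsub>H \<alpha>\<^esub> x \<otimes>\<^bsub>H \<alpha>\<^esub> inv\<^bsub>H \<alpha>\<^esub> (g \<alpha>)"

definition finite_type ::
  "('g, 'm) monoid_scheme \<Rightarrow> ('k, 'n) ring_scheme \<Rightarrow> ('g \<Rightarrow> ('k, 'a) module) \<Rightarrow> bool" where
  "finite_type G K H \<longleftrightarrow> (\<forall>\<alpha>\<in>carrier G. vectorspace.fin_dim K (H \<alpha>))"

definition left_cointegrals :: "('k, 'a) module \<Rightarrow> ('a \<Rightarrow> 'k) \<Rightarrow> 'a set" where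
  "left_cointegrals A \<epsilon> =
     {c \<in> carrier A. \<forall>x\<in>carrier A. x \<otimes>\<^bsub>A\<^esub> c = \<epsilon> x \<odot>\<^bsub>A\<^esub> c}"

definition right_cointegrals :: "('k, 'a) module \<Rightarrow> ('a \<Rightarrow> 'k) \<Rightarrow> 'a set" where
  "right_cointegrals A \<epsilon> =
     {c \<in> carrier A. \<forall>x\<in>carrier A. c \<otimes>\<^bsub>A\<^esub> x = \<epsilon> x \<odot>\<^bsub>A\<^esub> c}"

definition unimodular ::
  "('g, 'm) monoid_scheme \<Rightarrow> ('g \<Rightarrow> ('k, 'a) module) \<Rightarrow> ('a \<Rightarrow> 'k) \<Rightarrow> bool" where
  "unimodular G H \<epsilon> \<longleftrightarrow>
     left_cointegrals (H \<one>\<^bsub>G\<^esub>) \<epsilon> = right_cointegrals (H \<one>\<^bsub>G\<^esub>) \<epsilon>"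

definition right_G_integral ::
  "('g, 'm) monoid_scheme \<Rightarrow> ('k, 'n) ring_scheme \<Rightarrow> ('g \<Rightarrow> ('k, 'a) module) \<Rightarrow>
    ('g \<Rightarrow> 'g \<Rightarrow> 'a \<Rightarrow> ('a \<times> 'a \<Rightarrow> 'k) set) \<Rightarrow> ('g \<Rightarrow> 'a \<Rightarrow> 'k) \<Rightarrow> bool" where
  "right_G_integral G K H \<Delta> \<mu> \<longleftrightarrow>
     (\<forall>\<alpha>\<in>carrier G. \<mu> \<alpha> \<in> module_hom K (H \<alpha>) (scalar_space K)) \<and>
     (\<forall>\<alpha>\<in>carrier G. \<forall>\<beta>\<in>carrier G. \<forall>x\<in>carrier (H (\<alpha> \<otimes>\<^bsub>G\<^esub> \<beta>)).
        left_unitor K (H \<beta>) (tensor_map K (scalar_space K) (H \<beta>) (\<mu> \<alpha>) id (\<Delta> \<alpha> \<beta> x)) =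
        \<mu> (\<alpha> \<otimes>\<^bsub>G\<^esub> \<beta>) x \<odot>\<^bsub>H \<beta>\<^esub> \<one>\<^bsub>H \<beta>\<^esub>)"

definition left_G_integral ::
  "('g, 'm) monoid_scheme \<Rightarrow> ('k, 'n) ring_scheme \<Rightarrow> ('g \<Rightarrow> ('k, 'a) module) \<Rightarrow>
    ('g \<Rightarrow> 'g \<Rightarrow> 'a \<Rightarrow> ('a \<times> 'a \<Rightarrow> 'k) set) \<Rightarrow> ('g \<Rightarrow> 'a \<Rightarrow> 'k) \<Rightarrow> bool" where
  "left_G_integral G K H \<Delta> \<mu> \<longleftrightarrow>
     (\<forall>\<alpha>\<in>carrier G. \<mu> \<alpha> \<in> module_hom K (H \<alpha>) (scalar_space K)) \<and>
     (\<forall>\<alpha>\<in>carrier G. \<forall>\<beta>\<in>carrier G. \<forall>x\<in>carrier (H (\<alpha> \<otimes>\<^bsub>G\<^esub> \<beta>)).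
        right_unitor K (H \<alpha>) (tensor_map K (H \<alpha>) (scalar_space K) id (\<mu> \<beta>) (\<Delta> \<alpha> \<beta> x)) =
        \<mu> (\<alpha> \<otimes>\<^bsub>G\<^esub> \<beta>) x \<odot>\<^bsub>H \<alpha>\<^esub> \<one>\<^bsub>H \<alpha>\<^esub>)"

text \<open>Non-zero as an element of the product of the dual spaces: some component is non-zero.\<close>

definition nonzero_family ::
  "('g, 'm) monoid_scheme \<Rightarrow> ('k, 'n) ring_scheme \<Rightarrow> ('g \<Rightarrow> ('k, 'a) module) \<Rightarrow>
    ('g \<Rightarrow> 'a \<Rightarrow> 'k) \<Rightarrow> bool" where
  "nonzero_family G K H \<mu> \<longleftrightarrow> (\<exists>\<alpha>\<in>carrier G. \<exists>x\<in>carrier (H \<alpha>). \<mu> \<alpha> x \<noteq> \<zero>\<^bsub>K\<^esub>)"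

definition symmetrised_right ::
  "('g \<Rightarrow> ('k, 'a) module) \<Rightarrow> ('g \<Rightarrow> 'a) \<Rightarrow> ('g \<Rightarrow> 'a \<Rightarrow> 'k) \<Rightarrow> 'g \<Rightarrow> 'a \<Rightarrow> 'k" where
  "symmetrised_right H g \<mu> \<alpha> x = \<mu> \<alpha> (g \<alpha> \<otimes>\<^bsub>H \<alpha>\<^esub> x)"

definition symmetrised_left ::
  "('g \<Rightarrow> ('k, 'a) module) \<Rightarrow> ('g \<Rightarrow> 'a) \<Rightarrow> ('g \<Rightarrow> 'a \<Rightarrow> 'k) \<Rightarrow> 'g \<Rightarrow> 'a \<Rightarrow> 'k" where
  "symmetrised_left H g \<mu> \<alpha> x = \<mu> \<alpha> (inv\<^bsub>H \<alpha>\<^esub> (g \<alpha>) \<otimes>\<^bsub>H \<alpha>\<^esub> x)"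

definition symmetric_form :: "('k, 'a, 'm) module_scheme \<Rightarrow> ('a \<Rightarrow> 'a \<Rightarrow> 'k) \<Rightarrow> bool" where
  "symmetric_form V b \<longleftrightarrow> (\<forall>x\<in>carrier V. \<forall>y\<in>carrier V. b x y = b y x)"

definition nondegenerate_form ::
  "('k, 'n) ring_scheme \<Rightarrow> ('k, 'a, 'm) module_scheme \<Rightarrow> ('a \<Rightarrow> 'a \<Rightarrow> 'k) \<Rightarrow> bool" where
  "nondegenerate_form K V b \<longleftrightarrow>
     (\<forall>x\<in>carrier V. (\<forall>y\<in>carrier V. b x y = \<zero>\<^bsub>K\<^esub>) \<longrightarrow> x = \<zero>\<^bsub>V\<^esub>) \<and>
     (\<forall>y\<in>carrier V. (\<forall>x\<in>carrier V. b x y = \<zero>\<^bsub>K\<^esub>) \<longrightarrow> y = \<zero>\<^bsub>V\<^esub>)"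

end

theory Submission
  imports Defs
begin

text \<open>
  Everything follows from two properties of a non-zero right \<open>G\<close>-integral \<open>\<mu>\<close> on a unimodular
  pivotal Hopf \<open>G\<close>-coalgebra of finite type, for all \<open>\<alpha>\<close> and \<open>x, y \<in> H\<^sub>\<alpha>\<close>: the twisted trace
  property \<open>\<mu>\<^sub>\<alpha>(S\<^sup>2(x) y) = \<mu>\<^sub>\<alpha>(y x)\<close>, and the fact that \<open>\<mu>\<^sub>\<alpha>(x _) = 0\<close> only for
  \<open>x = 0\<close> (lemma \<open>unimodular_integral\<close>).  The pivot \<open>g\<close> makes \<open>S\<^sup>2\<close> the conjugation by \<open>g\<close>,
  so that \<open>\<mu>\<^sub>\<alpha>(g x y) = \<mu>\<^sub>\<alpha>(S\<^sup>2(y) g x) = \<mu>\<^sub>\<alpha>(g y x)\<close>, and \<open>x \<mapsto> g x\<close> is bijective.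

  Both properties are read off from a two-sided cointegral \<open>\<Lambda> \<in> H\<^sub>1\<close> with \<open>\<mu>\<^sub>1(\<Lambda>) = 1\<close>.
  A left cointegral satisfies \<open>\<Lambda>\<^sub>1 \<otimes> h \<Lambda>\<^sub>2 = S(h) \<Lambda>\<^sub>1 \<otimes> \<Lambda>\<^sub>2\<close> and a right one
  \<open>\<Lambda>\<^sub>1 h \<otimes> \<Lambda>\<^sub>2 = \<Lambda>\<^sub>1 \<otimes> \<Lambda>\<^sub>2 S(h)\<close>; applying \<open>\<mu>\<close> to the first leg gives
    \<open>\<mu>(S(h) \<Lambda>\<^sub>1) \<Lambda>\<^sub>2 = h\<close> and \<open>\<mu>(\<Lambda>\<^sub>1 k) \<Lambda>\<^sub>2 = S(k)\<close>.
  The first formula shows that \<open>\<mu>(z _) = 0\<close> forces \<open>z = 0\<close>, because the antipode is surjective (its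
  square is a conjugation).  In finite dimension every functional is then of the form \<open>\<mu>(z _)\<close>;
  writing \<open>\<mu>(_ k) = \<mu>(z _)\<close> with \<open>z = S(h)\<close> and comparing the two formulas yields \<open>h = S(k)\<close>,
  that is, \<open>z = S\<^sup>2(k)\<close>.

  To find \<open>\<Lambda>\<close>, put \<open>\<lambda> = \<mu>\<^sub>1\<close>, which is non-zero when \<open>\<mu>\<close> is.  The kernel
  \<open>{x. \<lambda>(x _) = 0}\<close> is a right ideal and a right coideal of \<open>H\<^sub>1\<close>, hence zero
  (\<open>integral_kernel_trivial\<close>).  So the counit is \<open>\<lambda>(\<Lambda> _)\<close> for some \<open>\<Lambda>\<close>, and such a
  \<open>\<Lambda>\<close> is a right cointegral with \<open>\<lambda>(\<Lambda>) = 1\<close>; unimodularity makes it two-sided.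

  Left integrals need no separate argument.  Reversing the products of \<open>G\<close> and of all \<open>H\<^sub>\<alpha>\<close> and the
  comultiplications gives another Hopf group-coalgebra with the same antipode, whose right
  integrals are the left integrals of \<open>H\<close> (\<open>opposite_coalgebra\<close>).

  All computations are done in Sweedler notation: an element of a tensor product is represented by
  a list of pure tensors, and identities are tested against scalar-valued multilinear forms.  The
  universal property of the quotient that defines the tensor product justifies this, and
  functionals separate points because all spaces are finite-dimensional.
\<close>

section \<open>Sums over lists and linear maps\<close>

text \<open>
  Lists rather than sets index these sums, because the same pure tensor may occur several times in a
  decomposition of a tensor.
\<close>

definition lsum :: "('a, 'm) ring_scheme \<Rightarrow> ('x \<Rightarrow> 'a) \<Rightarrow> 'x list \<Rightarrow> 'a" where
  "lsum M f xs = foldr (\<lambda>x s. f x \<oplus>\<^bsub>M\<^esub> s) xs \<zero>\<^bsub>M\<^esub>"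

lemma lsum_Nil [simp]: "lsum M f [] = \<zero>\<^bsub>M\<^esub>"
  and lsum_Cons [simp]: "lsum M f (x # xs) = f x \<oplus>\<^bsub>M\<^esub> lsum M f xs"
  by (simp_all add: lsum_def)

lemma lsum_map: "lsum M f (map h xs) = lsum M (\<lambda>x. f (h x)) xs"
  by (induction xs) simp_all

lemma lsum_cong: "(\<And>x. x \<in> set xs \<Longrightarrow> f x = h x) \<Longrightarrow> lsum M f xs = lsum M h xs"
  by (induction xs) simp_all

context abelian_monoid
begin

lemma lsum_closed: "(\<And>x. x \<in> set xs \<Longrightarrow> f x \<in> carrier G) \<Longrightarrow> lsum G f xs \<in> carrier G"
  by (induction xs) simp_all

lemma lsum_zero: "lsum G (\<lambda>x. \<zero>) xs = \<zero>"
  by (induction xs) simp_all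

lemma lsum_add:
  "(\<And>x. x \<in> set xs \<Longrightarrow> f x \<in> carrier G) \<Longrightarrow> (\<And>x. x \<in> set xs \<Longrightarrow> h x \<in> carrier G) \<Longrightarrow>
   lsum G (\<lambda>x. f x \<oplus> h x) xs = lsum G f xs \<oplus> lsum G h xs"
  by (induction xs) (simp_all add: lsum_closed add.m_ac)

lemma lsum_swap:
  assumes "\<And>x y. x \<in> set xs \<Longrightarrow> y \<in> set ys \<Longrightarrow> f x y \<in> carrier G"
  shows "lsum G (\<lambda>x. lsum G (f x) ys) xs = lsum G (\<lambda>y. lsum G (\<lambda>x. f x y) xs) ys"
  using assms
proof (induction xs)
  case Nil
  then show ?case by (simp add: lsum_zero)
next
  case (Cons x xs)
  then show ?case by (simp add: lsum_add lsum_closed)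
qed

lemma lsum_eq_finsum:
  "distinct xs \<Longrightarrow> (\<And>x. x \<in> set xs \<Longrightarrow> f x \<in> carrier G) \<Longrightarrow> lsum G f xs = (\<Oplus>x\<in>set xs. f x)"
  by (induction xs) auto

end

lemma module_lsum_closed:
  assumes "module K M" "\<And>x. x \<in> set xs \<Longrightarrow> f x \<in> carrier M"
  shows "lsum M f xs \<in> carrier M"
proof -
  interpret module K M by fact
  show ?thesis using assms(2) by (rule M.lsum_closed)
qed

lemma module_hom_lsum:
  assumes "module K M" "module K N" "h \<in> module_hom K M N"
    and "\<And>x. x \<in> set xs \<Longrightarrow> f x \<in> carrier M"
  shows "h (lsum M f xs) = lsum N (\<lambda>x. h (f x)) xs"
proof -
  interpret h: mod_hom K M N h
    using assms by (simp add: mod_hom_def mod_hom_axioms_def)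
  from assms(4) show ?thesis
    by (induction xs) (simp_all add: module_lsum_closed[OF assms(1)])
qed

lemma module_homI:
  assumes "\<And>x. x \<in> carrier M \<Longrightarrow> h x \<in> carrier N"
    and "\<And>x y. x \<in> carrier M \<Longrightarrow> y \<in> carrier M \<Longrightarrow> h (x \<oplus>\<^bsub>M\<^esub> y) = h x \<oplus>\<^bsub>N\<^esub> h y"
    and "\<And>c x. c \<in> carrier K \<Longrightarrow> x \<in> carrier M \<Longrightarrow> h (c \<odot>\<^bsub>M\<^esub> x) = c \<odot>\<^bsub>N\<^esub> h x"
  shows "h \<in> module_hom K M N"
  using assms by (auto simp: module_hom_def)

lemma module_hom_in_carrier: "h \<in> module_hom K M N \<Longrightarrow> x \<in> carrier M \<Longrightarrow> h x \<in> carrier N"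
  by (auto simp: module_hom_def)

definition bilinear ::
  "('k, 'n) ring_scheme \<Rightarrow> ('k, 'v, 'm) module_scheme \<Rightarrow> ('k, 'w, 'l) module_scheme \<Rightarrow>
    ('k, 'u, 'j) module_scheme \<Rightarrow> ('v \<Rightarrow> 'w \<Rightarrow> 'u) \<Rightarrow> bool" where
  "bilinear K V W M B \<longleftrightarrow> (\<forall>v\<in>carrier V. B v \<in> module_hom K W M) \<and>
     (\<forall>w\<in>carrier W. (\<lambda>v. B v w) \<in> module_hom K V M)"

lemma bilinear_closed:
    "bilinear K V W M B \<Longrightarrow> v \<in> carrier V \<Longrightarrow> w \<in> carrier W \<Longrightarrow> B v w \<in> carrier M"
  and bilinear_add_left: "bilinear K V W M B \<Longrightarrow> v \<in> carrier V \<Longrightarrow> v' \<in> carrier V \<Longrightarrow> w \<in> carrier W \<Longrightarrow>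
    B (v \<oplus>\<^bsub>V\<^esub> v') w = B v w \<oplus>\<^bsub>M\<^esub> B v' w"
  and bilinear_add_right: "bilinear K V W M B \<Longrightarrow> v \<in> carrier V \<Longrightarrow> w \<in> carrier W \<Longrightarrow> w' \<in> carrier W \<Longrightarrow>
    B v (w \<oplus>\<^bsub>W\<^esub> w') = B v w \<oplus>\<^bsub>M\<^esub> B v w'"
  and bilinear_smult_left: "bilinear K V W M B \<Longrightarrow> c \<in> carrier K \<Longrightarrow> v \<in> carrier V \<Longrightarrow> w \<in> carrier W \<Longrightarrow>
    B (c \<odot>\<^bsub>V\<^esub> v) w = c \<odot>\<^bsub>M\<^esub> B v w"
  and bilinear_smult_right: "bilinear K V W M B \<Longrightarrow> c \<in> carrier K \<Longrightarrow> v \<in> carrier V \<Longrightarrow> w \<in> carrier W \<Longrightarrow>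
    B v (c \<odot>\<^bsub>W\<^esub> w) = c \<odot>\<^bsub>M\<^esub> B v w"
  by (auto simp: bilinear_def module_hom_def)

section \<open>Tensor products\<close>

lemma free_space_module:
  fixes K :: "('k, 'n) ring_scheme"
  assumes "field K" shows "module K (free_space K X)"
proof -
  interpret K: field K by fact
  have supp_add: "{x. f x \<oplus>\<^bsub>K\<^esub> h x \<noteq> \<zero>\<^bsub>K\<^esub>} \<subseteq> {x. f x \<noteq> \<zero>\<^bsub>K\<^esub>} \<union> {x. h x \<noteq> \<zero>\<^bsub>K\<^esub>}"
    for f h :: "'x \<Rightarrow> 'k"
    by auto
  have supp_smult: "c \<in> carrier K \<Longrightarrow> {x. c \<otimes>\<^bsub>K\<^esub> f x \<noteq> \<zero>\<^bsub>K\<^esub>} \<subseteq> {x. f x \<noteq> \<zero>\<^bsub>K\<^esub>}"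
    for c and f :: "'x \<Rightarrow> 'k"
    by auto
  show ?thesis
  proof (rule moduleI)
    show "cring K" by unfold_locales
    show "abelian_group (free_space K X)"
    proof (rule abelian_groupI)
      fix f h assume "f \<in> carrier (free_space K X)" "h \<in> carrier (free_space K X)"
      then show "f \<oplus>\<^bsub>free_space K X\<^esub> h \<in> carrier (free_space K X)"
        using finite_subset[OF supp_add[of f h]] order_trans[OF supp_add[of f h], of X]
        by (simp add: free_space_def)
    next
      fix f assume f: "f \<in> carrier (free_space K X)"
      then have "{x. \<ominus>\<^bsub>K\<^esub> f x \<noteq> \<zero>\<^bsub>K\<^esub>} \<subseteq> {x. f x \<noteq> \<zero>\<^bsub>K\<^esub>}" by auto
      with f have "(\<lambda>x. \<ominus>\<^bsub>K\<^esub> f x) \<in> carrier (free_space K X)"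
        using finite_subset order_trans by (simp add: free_space_def)
      then show "\<exists>y\<in>carrier (free_space K X). y \<oplus>\<^bsub>free_space K X\<^esub> f = \<zero>\<^bsub>free_space K X\<^esub>"
        by (rule bexI[rotated]) (use f in \<open>auto simp: free_space_def K.l_neg\<close>)
    qed (auto simp: free_space_def K.a_ac)
    fix c f assume "c \<in> carrier K" "f \<in> carrier (free_space K X)"
    then show "c \<odot>\<^bsub>free_space K X\<^esub> f \<in> carrier (free_space K X)"
      using finite_subset[OF supp_smult[of c f]] order_trans[OF supp_smult[of c f], of X]
      by (simp add: free_space_def)
  qed (auto simp: free_space_def K.l_distr K.r_distr K.m_assoc)
qed

lemma submodule_abelian_subgroup:
  assumes "module K M" "submodule K N M"
  shows "abelian_subgroup N M"
proof -
  interpret module K M by fact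
  interpret N: submodule K N M by fact
  have sub: "x \<in> N \<Longrightarrow> x \<in> carrier M" for x using N.subset by auto
  have "\<ominus>\<^bsub>M\<^esub> x \<in> N" if "x \<in> N" for x
    using N.smult_closed[of "\<ominus>\<^bsub>K\<^esub> \<one>\<^bsub>K\<^esub>" x] that by (simp add: smult_minus_1 sub)
  then have "subgroup N (add_monoid M)"
    using N.subset N.m_closed N.zero_closed
    by (intro subgroup.intro) (simp_all add: a_inv_def)
  then show ?thesis
    by (intro abelian_subgroupI3 additive_subgroupI M.abelian_group_axioms)
qed

lemma coset_eqI:
  assumes "module K M" "submodule K N M" "x \<in> carrier M" "y \<in> carrier M" "x \<ominus>\<^bsub>M\<^esub> y \<in> N"
  shows "N +>\<^bsub>M\<^esub> x = N +>\<^bsub>M\<^esub> y"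
proof -
  interpret N: abelian_subgroup N M by (rule submodule_abelian_subgroup) fact+
  have "x \<in> N +>\<^bsub>M\<^esub> y"
    using assms by (intro N.a_rcos_module_rev) (simp_all add: a_minus_def)
  from N.a_repr_independence'[OF this] show ?thesis using assms by simp
qed

lemma quotient_coset_smult:
  assumes "module K M" "submodule K N M" "c \<in> carrier K" "x \<in> carrier M"
  shows "c \<odot>\<^bsub>quotient_space M N\<^esub> (N +>\<^bsub>M\<^esub> x) = N +>\<^bsub>M\<^esub> (c \<odot>\<^bsub>M\<^esub> x)"
proof -
  interpret module K M by fact
  interpret S: submodule K N M by fact
  interpret N: abelian_subgroup N M by (rule submodule_abelian_subgroup) fact+
  have "N +>\<^bsub>M\<^esub> (c \<odot>\<^bsub>M\<^esub> y) = N +>\<^bsub>M\<^esub> (c \<odot>\<^bsub>M\<^esub> x)" if y: "y \<in> N +>\<^bsub>M\<^esub> x" for y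
  proof -
    from y obtain n where n: "n \<in> N" "y = n \<oplus>\<^bsub>M\<^esub> x" by (auto simp: a_r_coset_def')
    then have nc: "n \<in> carrier M" using S.subset by auto
    have "c \<odot>\<^bsub>M\<^esub> y \<ominus>\<^bsub>M\<^esub> c \<odot>\<^bsub>M\<^esub> x = c \<odot>\<^bsub>M\<^esub> n"
      using n nc assms(3,4) by (simp add: smult_r_distr a_minus_def M.a_assoc M.r_neg)
    then show ?thesis
      using n nc assms by (intro coset_eqI[OF assms(1,2)]) auto
  qed
  moreover have "x \<in> N +>\<^bsub>M\<^esub> x" using assms(4) by (rule N.a_rcos_self)
  ultimately have "(\<Union>y\<in>N +>\<^bsub>M\<^esub> x. N +>\<^bsub>M\<^esub> (c \<odot>\<^bsub>M\<^esub> y)) = N +>\<^bsub>M\<^esub> (c \<odot>\<^bsub>M\<^esub> x)" by blast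
  then show ?thesis by (simp add: quotient_space_def)
qed

lemma quotient_coset_add:
  assumes "module K M" "submodule K N M" "x \<in> carrier M" "y \<in> carrier M"
  shows "(N +>\<^bsub>M\<^esub> x) \<oplus>\<^bsub>quotient_space M N\<^esub> (N +>\<^bsub>M\<^esub> y) = N +>\<^bsub>M\<^esub> (x \<oplus>\<^bsub>M\<^esub> y)"
proof -
  interpret N: abelian_subgroup N M by (rule submodule_abelian_subgroup) fact+
  show ?thesis using N.a_rcos_sum[OF assms(3,4)] by (simp add: quotient_space_def)
qed

lemma quotient_carrier: "carrier (quotient_space M N) = (\<lambda>x. N +>\<^bsub>M\<^esub> x) ` carrier M"
  unfolding quotient_space_def A_RCOSETS_def' by (simp add: UNION_singleton_eq_range)

lemma quotient_space_module:
  assumes "module K M" "submodule K N M"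
  shows "module K (quotient_space M N)"
proof -
  interpret module K M by fact
  interpret N: abelian_subgroup N M by (rule submodule_abelian_subgroup) fact+
  note ops = quotient_coset_add[OF assms] quotient_coset_smult[OF assms]
  have zero: "\<zero>\<^bsub>quotient_space M N\<^esub> = N +>\<^bsub>M\<^esub> \<zero>\<^bsub>M\<^esub>"
    using N.a_rcos_const[of "\<zero>\<^bsub>M\<^esub>"] by (simp add: quotient_space_def)
  show ?thesis
  proof (rule moduleI)
    show "cring K" by (rule R.is_cring)
    show "abelian_group (quotient_space M N)"
    proof (rule abelian_groupI)
      fix X assume "X \<in> carrier (quotient_space M N)"
      then obtain x where x: "x \<in> carrier M" "X = N +>\<^bsub>M\<^esub> x" by (auto simp: quotient_carrier)
      then show "\<exists>Y\<in>carrier (quotient_space M N). Y \<oplus>\<^bsub>quotient_space M N\<^esub> X = \<zero>\<^bsub>quotient_space M N\<^esub>"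
        by (intro bexI[of _ "N +>\<^bsub>M\<^esub> (\<ominus>\<^bsub>M\<^esub> x)"]) (auto simp: ops zero quotient_carrier M.l_neg)
    qed (auto simp: quotient_carrier ops zero M.a_ac)
  qed (auto simp: quotient_carrier ops smult_l_distr smult_r_distr smult_assoc1)
qed

lemma quotient_map_hom:
  assumes "module K M" "submodule K N M"
  shows "(\<lambda>x. N +>\<^bsub>M\<^esub> x) \<in> module_hom K M (quotient_space M N)"
  by (rule module_homI)
    (auto simp: quotient_carrier quotient_coset_add[OF assms] quotient_coset_smult[OF assms])

text \<open>
  A linear map that vanishes on \<open>N\<close> is constant on each coset of \<open>N\<close>.  This is what makes
  \<^const>\<open>the_elem\<close> in the definition of \<^const>\<open>tensor_lift\<close> meaningful.
\<close>

lemma hom_image_coset: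
  assumes "module K M" "submodule K N M" "module K P" "h \<in> module_hom K M P"
    and "\<And>n. n \<in> N \<Longrightarrow> h n = \<zero>\<^bsub>P\<^esub>" and "x \<in> carrier M"
  shows "the_elem (h ` (N +>\<^bsub>M\<^esub> x)) = h x"
proof -
  interpret module K P by fact
  interpret S: submodule K N M by fact
  interpret N: abelian_subgroup N M by (rule submodule_abelian_subgroup) fact+
  have "h y = h x" if "y \<in> N +>\<^bsub>M\<^esub> x" for y
  proof -
    from that obtain n where n: "n \<in> N" "y = n \<oplus>\<^bsub>M\<^esub> x" by (auto simp: a_r_coset_def')
    then have "n \<in> carrier M" using S.subset by auto
    then show ?thesis
      using n assms(5)[of n] assms(6)
      by (simp add: module_hom_add[OF assms(4)] module_hom_in_carrier[OF assms(4)])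
  qed
  moreover have "x \<in> N +>\<^bsub>M\<^esub> x" using assms(6) by (rule N.a_rcos_self)
  ultimately have "h ` (N +>\<^bsub>M\<^esub> x) = {h x}" by blast
  then show ?thesis by simp
qed

text \<open>
  The linear extension of \<open>b\<close> to the free space; \<^const>\<open>tensor_lift\<close> takes the common value of this map
  on a coset.
\<close>

definition free_lift ::
  "('k, 'n) ring_scheme \<Rightarrow> ('k, 'u, 'm) module_scheme \<Rightarrow> ('x \<Rightarrow> 'u) \<Rightarrow> ('x \<Rightarrow> 'k) \<Rightarrow> 'u" where
  "free_lift K M b f = (\<Oplus>\<^bsub>M\<^esub>p\<in>{p. f p \<noteq> \<zero>\<^bsub>K\<^esub>}. f p \<odot>\<^bsub>M\<^esub> b p)"

lemma free_lift_superset: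
  assumes "module K M" "\<And>p. p \<in> A \<Longrightarrow> b p \<in> carrier M" "\<And>p. f p \<in> carrier K"
    and "finite A" "{p. f p \<noteq> \<zero>\<^bsub>K\<^esub>} \<subseteq> A"
  shows "free_lift K M b f = (\<Oplus>\<^bsub>M\<^esub>p\<in>A. f p \<odot>\<^bsub>M\<^esub> b p)"
proof -
  interpret module K M by fact
  show ?thesis
    unfolding free_lift_def
    using assms by (intro M.add.finprod_mono_neutral_cong_left) auto
qed

lemma free_lift_hom:
  assumes "field K" "module K M" "\<And>p. p \<in> X \<Longrightarrow> b p \<in> carrier M"
  shows "free_lift K M b \<in> module_hom K (free_space K X) M"
proof -
  interpret K: field K by fact
  interpret module K M by fact
  have bX: "b \<in> X \<rightarrow> carrier M" using assms(3) by auto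
  have F: "f x \<in> carrier K" "finite {x. f x \<noteq> \<zero>\<^bsub>K\<^esub>}" "{x. f x \<noteq> \<zero>\<^bsub>K\<^esub>} \<subseteq> X"
    if "f \<in> carrier (free_space K X)" for f x
    using that by (auto simp: free_space_def)
  show ?thesis
  proof (rule module_homI)
    fix f assume "f \<in> carrier (free_space K X)"
    then show "free_lift K M b f \<in> carrier M"
      using F[of f] assms(3) unfolding free_lift_def by (intro M.finsum_closed) auto
  next
    fix f h assume f: "f \<in> carrier (free_space K X)" and h: "h \<in> carrier (free_space K X)"
    let ?A = "{x. f x \<noteq> \<zero>\<^bsub>K\<^esub>} \<union> {x. h x \<noteq> \<zero>\<^bsub>K\<^esub>}"
    have A: "finite ?A" "?A \<subseteq> X" using F(2,3)[OF f] F(2,3)[OF h] by auto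
    have bA: "p \<in> ?A \<Longrightarrow> b p \<in> carrier M" for p using A(2) assms(3) by blast
    note sup = free_lift_superset[OF assms(2) bA _ A(1)]
    have "free_lift K M b (f \<oplus>\<^bsub>free_space K X\<^esub> h) = (\<Oplus>\<^bsub>M\<^esub>p\<in>?A. (f p \<oplus>\<^bsub>K\<^esub> h p) \<odot>\<^bsub>M\<^esub> b p)"
      using F(1)[OF f] F(1)[OF h] by (subst sup) (auto simp: free_space_def)
    also have "\<dots> = (\<Oplus>\<^bsub>M\<^esub>p\<in>?A. f p \<odot>\<^bsub>M\<^esub> b p \<oplus>\<^bsub>M\<^esub> h p \<odot>\<^bsub>M\<^esub> b p)"
      using bA F(1)[OF f] F(1)[OF h] by (intro M.finsum_cong') (auto simp: smult_l_distr)
    also have "\<dots> = (\<Oplus>\<^bsub>M\<^esub>p\<in>?A. f p \<odot>\<^bsub>M\<^esub> b p) \<oplus>\<^bsub>M\<^esub> (\<Oplus>\<^bsub>M\<^esub>p\<in>?A. h p \<odot>\<^bsub>M\<^esub> b p)"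
      using bA F(1)[OF f] F(1)[OF h] by (intro M.finsum_addf) auto
    also have "\<dots> = free_lift K M b f \<oplus>\<^bsub>M\<^esub> free_lift K M b h"
      using F(1)[OF f] F(1)[OF h] by (subst (1 2) sup) auto
    finally show "free_lift K M b (f \<oplus>\<^bsub>free_space K X\<^esub> h) = free_lift K M b f \<oplus>\<^bsub>M\<^esub> free_lift K M b h" .
  next
    fix c f assume c: "c \<in> carrier K" and f: "f \<in> carrier (free_space K X)"
    let ?A = "{x. f x \<noteq> \<zero>\<^bsub>K\<^esub>}"
    have bA: "p \<in> ?A \<Longrightarrow> b p \<in> carrier M" for p using F(3)[OF f] assms(3) by blast
    note sup = free_lift_superset[OF assms(2) bA _ F(2)[OF f]]
    have "free_lift K M b (c \<odot>\<^bsub>free_space K X\<^esub> f) = (\<Oplus>\<^bsub>M\<^esub>p\<in>?A. (c \<otimes>\<^bsub>K\<^esub> f p) \<odot>\<^bsub>M\<^esub> b p)"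
      using F(1)[OF f] c by (subst sup) (auto simp: free_space_def)
    also have "\<dots> = (\<Oplus>\<^bsub>M\<^esub>p\<in>?A. c \<odot>\<^bsub>M\<^esub> (f p \<odot>\<^bsub>M\<^esub> b p))"
      using bA F(1)[OF f] c by (intro M.finsum_cong') (auto simp: smult_assoc1)
    also have "\<dots> = c \<odot>\<^bsub>M\<^esub> free_lift K M b f"
      using bA F(1,2)[OF f] c unfolding free_lift_def
      by (intro finsum_smult_ldistr[symmetric]) auto
    finally show "free_lift K M b (c \<odot>\<^bsub>free_space K X\<^esub> f) = c \<odot>\<^bsub>M\<^esub> free_lift K M b f" .
  qed
qed

lemma free_gen_closed:
  assumes "field K" "p \<in> X" shows "free_gen K p \<in> carrier (free_space K X)"
proof -
  interpret K: field K by fact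
  have "{x. free_gen K p x \<noteq> \<zero>\<^bsub>K\<^esub>} = {p}" by (auto simp: free_gen_def)
  then show ?thesis using assms by (auto simp: free_space_def free_gen_def)
qed

lemma free_lift_gen:
  assumes "field K" "module K M" "b p \<in> carrier M"
  shows "free_lift K M b (free_gen K p) = b p"
proof -
  interpret K: field K by fact
  interpret module K M by fact
  have "{x. free_gen K p x \<noteq> \<zero>\<^bsub>K\<^esub>} = {p}" by (auto simp: free_gen_def)
  then show ?thesis using assms by (simp add: free_lift_def free_gen_def)
qed

lemma scalar_space_module:
  assumes "field K" shows "module K (scalar_space K)"
proof -
  interpret K: field K by fact
  show ?thesis
  proof (rule moduleI)
    show "cring K" by unfold_locales
    show "abelian_group (scalar_space K)"
      by (rule abelian_groupI) (auto simp: scalar_space_def K.a_ac intro!: bexI[of _ "\<ominus>\<^bsub>K\<^esub> _"] K.l_neg)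
  qed (auto simp: scalar_space_def K.l_distr K.r_distr K.m_assoc)
qed

locale tensor_product = V: vectorspace K V + W: vectorspace K W
  for K :: "('k, 'n) ring_scheme" and V :: "('k, 'v, 'm) module_scheme"
    and W :: "('k, 'w, 'l) module_scheme"
begin

abbreviation "F \<equiv> free_space K (carrier V \<times> carrier W)"
abbreviation "N \<equiv> tensor_kernel K V W"
abbreviation "T \<equiv> tensor_space K V W"
abbreviation "pure \<equiv> pure_tensor K V W"

lemma field_K: "field K"
  by unfold_locales

sublocale F: module K F
  by (rule free_space_module) (rule field_K)

lemma gen_closed: "v \<in> carrier V \<Longrightarrow> w \<in> carrier W \<Longrightarrow> free_gen K (v, w) \<in> carrier F"
  by (rule free_gen_closed[OF field_K]) simp

lemma relations_subset: "tensor_relations K V W \<subseteq> carrier F"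
  unfolding tensor_relations_def Let_def by (auto intro!: F.M.minus_closed F.M.a_closed F.smult_closed gen_closed)

lemma kernel_submodule: "submodule K N F"
  unfolding tensor_kernel_def using relations_subset by (rule F.span_is_submodule)

lemma relations_kernel: "r \<in> tensor_relations K V W \<Longrightarrow> r \<in> N"
  unfolding tensor_kernel_def using F.in_own_span[OF relations_subset] by auto

lemma tensor_space_module: "module K T"
  unfolding tensor_space_def by (rule quotient_space_module[OF F.module_axioms kernel_submodule])

lemma tensor_space_vectorspace: "vectorspace K T"
  using tensor_space_module field_K by (simp add: vectorspace_def)

sublocale T: vectorspace K T
  by (rule tensor_space_vectorspace)

lemma coset_hom: "(\<lambda>f. N +>\<^bsub>F\<^esub> f) \<in> module_hom K F T"
  unfolding tensor_space_def by (rule quotient_map_hom[OF F.module_axioms kernel_submodule])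

lemma pure_coset: "pure v w = N +>\<^bsub>F\<^esub> free_gen K (v, w)"
  by (simp add: pure_tensor_def)

lemma pure_closed: "v \<in> carrier V \<Longrightarrow> w \<in> carrier W \<Longrightarrow> pure v w \<in> carrier T"
  unfolding pure_coset by (rule module_hom_in_carrier[OF coset_hom gen_closed])

lemma pure_bilinear: "bilinear K V W T pure"
proof -
  note eq = coset_eqI[OF F.module_axioms kernel_submodule]
  note add = module_hom_add[OF coset_hom, symmetric] and smult = module_hom_smult[OF coset_hom, symmetric]
  have "pure (v \<oplus>\<^bsub>V\<^esub> v') w = pure v w \<oplus>\<^bsub>T\<^esub> pure v' w"
    if "v \<in> carrier V" "v' \<in> carrier V" "w \<in> carrier W" for v v' w
  proof -
    have "free_gen K (v \<oplus>\<^bsub>V\<^esub> v', w) \<ominus>\<^bsub>F\<^esub> (free_gen K (v, w) \<oplus>\<^bsub>F\<^esub> free_gen K (v', w)) \<in> N"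
      by (rule relations_kernel) (use that in \<open>unfold tensor_relations_def Let_def, blast\<close>)
    then show ?thesis
      using that by (simp add: pure_coset add gen_closed eq)
  qed
  moreover have "pure v (w \<oplus>\<^bsub>W\<^esub> w') = pure v w \<oplus>\<^bsub>T\<^esub> pure v w'"
    if "v \<in> carrier V" "w \<in> carrier W" "w' \<in> carrier W" for v w w'
  proof -
    have "free_gen K (v, w \<oplus>\<^bsub>W\<^esub> w') \<ominus>\<^bsub>F\<^esub> (free_gen K (v, w) \<oplus>\<^bsub>F\<^esub> free_gen K (v, w')) \<in> N"
      by (rule relations_kernel) (use that in \<open>unfold tensor_relations_def Let_def, blast\<close>)
    then show ?thesis
      using that by (simp add: pure_coset add gen_closed eq)
  qed
  moreover have "pure (c \<odot>\<^bsub>V\<^esub> v) w = c \<odot>\<^bsub>T\<^esub> pure v w"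
    if "c \<in> carrier K" "v \<in> carrier V" "w \<in> carrier W" for c v w
  proof -
    have "free_gen K (c \<odot>\<^bsub>V\<^esub> v, w) \<ominus>\<^bsub>F\<^esub> c \<odot>\<^bsub>F\<^esub> free_gen K (v, w) \<in> N"
      by (rule relations_kernel) (use that in \<open>unfold tensor_relations_def Let_def, blast\<close>)
    then show ?thesis
      using that by (simp add: pure_coset smult gen_closed eq)
  qed
  moreover have "pure v (c \<odot>\<^bsub>W\<^esub> w) = c \<odot>\<^bsub>T\<^esub> pure v w"
    if "c \<in> carrier K" "v \<in> carrier V" "w \<in> carrier W" for c v w
  proof -
    have "free_gen K (v, c \<odot>\<^bsub>W\<^esub> w) \<ominus>\<^bsub>F\<^esub> c \<odot>\<^bsub>F\<^esub> free_gen K (v, w) \<in> N"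
      by (rule relations_kernel) (use that in \<open>unfold tensor_relations_def Let_def, blast\<close>)
    then show ?thesis
      using that by (simp add: pure_coset smult gen_closed eq)
  qed
  ultimately show ?thesis
    unfolding bilinear_def by (auto intro!: module_homI pure_closed)
qed

text \<open>
  The coefficients of a representative in the free space are absorbed into the first tensor factor, so
  that a list of pairs without scalars suffices.
\<close>

lemma tensor_decomp:
  assumes "t \<in> carrier T"
  obtains D where "set D \<subseteq> carrier V \<times> carrier W" "t = lsum T (\<lambda>(v, w). pure v w) D"
proof -
  \<comment> \<open>Induction over a finite set that contains the support, removing one point of the support at a time.\<close>
  have *: "\<exists>D. set D \<subseteq> carrier V \<times> carrier W \<and> N +>\<^bsub>F\<^esub> f = lsum T (\<lambda>(v, w). pure v w) D"
    if "finite A" "f \<in> carrier F" "{p. f p \<noteq> \<zero>\<^bsub>K\<^esub>} \<subseteq> A" for A f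
    using that
  proof (induction A arbitrary: f)
    case empty
    then have "f = \<zero>\<^bsub>F\<^esub>" by (auto simp: free_space_def)
    moreover have "N +>\<^bsub>F\<^esub> \<zero>\<^bsub>F\<^esub> = \<zero>\<^bsub>T\<^esub>"
      using mod_hom.f0_is_0[of K F T "\<lambda>f. N +>\<^bsub>F\<^esub> f"] F.module_axioms tensor_space_module coset_hom
      by (simp add: mod_hom_def mod_hom_axioms_def)
    ultimately show ?case by (intro exI[of _ "[]"]) simp
  next
    case (insert p A)
    show ?case
    proof (cases "f p = \<zero>\<^bsub>K\<^esub>")
      case True
      then show ?thesis using insert by (intro insert.IH) auto
    next
      case False
      let ?f = "f(p := \<zero>\<^bsub>K\<^esub>)"
      obtain v w where p: "p = (v, w)" by (cases p)
      have vw: "v \<in> carrier V" "w \<in> carrier W" and fp: "f p \<in> carrier K"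
        using False insert.prems(1) p by (auto simp: free_space_def)
      have "{q. ?f q \<noteq> \<zero>\<^bsub>K\<^esub>} \<subseteq> {q. f q \<noteq> \<zero>\<^bsub>K\<^esub>}" by auto
      then have f: "?f \<in> carrier F"
        using insert.prems(1) finite_subset[of "{q. ?f q \<noteq> \<zero>\<^bsub>K\<^esub>}"]
        unfolding free_space_def by (auto split: if_splits)
      have "{q. ?f q \<noteq> \<zero>\<^bsub>K\<^esub>} \<subseteq> A"
        using insert.prems(2) by (auto split: if_splits)
      from insert.IH[OF f this] obtain D where D: "set D \<subseteq> carrier V \<times> carrier W"
        "N +>\<^bsub>F\<^esub> ?f = lsum T (\<lambda>(v, w). pure v w) D" by blast
      have "f = f p \<odot>\<^bsub>F\<^esub> free_gen K p \<oplus>\<^bsub>F\<^esub> ?f"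
        using fp insert.prems(1) by (auto simp: free_space_def free_gen_def fun_eq_iff)
      then have "N +>\<^bsub>F\<^esub> f = N +>\<^bsub>F\<^esub> (f p \<odot>\<^bsub>F\<^esub> free_gen K p \<oplus>\<^bsub>F\<^esub> ?f)" by simp
      also have "\<dots> = f p \<odot>\<^bsub>T\<^esub> pure v w \<oplus>\<^bsub>T\<^esub> (N +>\<^bsub>F\<^esub> ?f)"
        using f vw fp unfolding p pure_coset
        by (simp add: module_hom_add[OF coset_hom] module_hom_smult[OF coset_hom] gen_closed)
      also have "f p \<odot>\<^bsub>T\<^esub> pure v w = pure (f p \<odot>\<^bsub>V\<^esub> v) w"
        using bilinear_smult_left[OF pure_bilinear fp vw] by simp
      finally have "N +>\<^bsub>F\<^esub> f = lsum T (\<lambda>(v, w). pure v w) ((f p \<odot>\<^bsub>V\<^esub> v, w) # D)"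
        unfolding D(2) by simp
      moreover have "set ((f p \<odot>\<^bsub>V\<^esub> v, w) # D) \<subseteq> carrier V \<times> carrier W"
        using D(1) vw fp by simp
      ultimately show ?thesis by blast
    qed
  qed
  from assms obtain f where f: "f \<in> carrier F" "t = N +>\<^bsub>F\<^esub> f"
    unfolding tensor_space_def by (auto simp: quotient_carrier)
  then have "finite {p. f p \<noteq> \<zero>\<^bsub>K\<^esub>}" by (simp add: free_space_def)
  from *[OF this f(1)] f(2) that show ?thesis by auto
qed

context
  fixes M :: "('k, 'u, 'j) module_scheme" and B
  assumes M: "module K M" and B: "bilinear K V W M B"
begin

lemmas B_closed = bilinear_closed[OF B]

lemma lift_hom: "free_lift K M (\<lambda>p. B (fst p) (snd p)) \<in> module_hom K F M"
  by (rule free_lift_hom[OF field_K M]) (auto intro: B_closed)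

lemma lift_gen: "v \<in> carrier V \<Longrightarrow> w \<in> carrier W \<Longrightarrow>
    free_lift K M (\<lambda>p. B (fst p) (snd p)) (free_gen K (v, w)) = B v w"
  by (subst free_lift_gen[OF field_K M]) (simp_all add: B_closed)

text \<open>
  The relations that generate the kernel are the bilinearity laws, which the linear extension of a
  bilinear map turns into \<open>0 = 0\<close>.
\<close>

lemma lift_kernel:
  assumes "f \<in> N" shows "free_lift K M (\<lambda>p. B (fst p) (snd p)) f = \<zero>\<^bsub>M\<^esub>"
proof -
  let ?L = "free_lift K M (\<lambda>p. B (fst p) (snd p))"
  interpret L: mod_hom K F M ?L
    using lift_hom F.module_axioms M by (simp add: mod_hom_def mod_hom_axioms_def)
  have "tensor_relations K V W \<subseteq> L.ker"
    unfolding tensor_relations_def Let_def L.ker_def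
    by (auto intro!: F.M.minus_closed F.M.a_closed F.smult_closed gen_closed
        simp: gen_closed lift_gen B_closed a_minus_def[of M] L.N.M.r_neg
          bilinear_add_left[OF B] bilinear_add_right[OF B] bilinear_smult_left[OF B] bilinear_smult_right[OF B])
  then have "N \<subseteq> L.ker"
    unfolding tensor_kernel_def using L.ker_is_submodule by (rule F.span_is_subset)
  then show ?thesis using assms by (auto simp: L.ker_def)
qed

lemma tensor_lift_coset:
  assumes "f \<in> carrier F"
  shows "tensor_lift K M B (N +>\<^bsub>F\<^esub> f) = free_lift K M (\<lambda>p. B (fst p) (snd p)) f"
proof -
  have "tensor_lift K M B = (\<lambda>t. the_elem (free_lift K M (\<lambda>p. B (fst p) (snd p)) ` t))"
    by (simp add: tensor_lift_def free_lift_def fun_eq_iff)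
  then show ?thesis
    using hom_image_coset[OF F.module_axioms kernel_submodule M lift_hom lift_kernel assms] by simp
qed

lemma tensor_lift_hom: "tensor_lift K M B \<in> module_hom K T M"
proof (rule module_homI)
  note add = module_hom_add[OF coset_hom] and smult = module_hom_smult[OF coset_hom]
  have carr: "carrier T = (\<lambda>f. N +>\<^bsub>F\<^esub> f) ` carrier F"
    by (simp add: tensor_space_def quotient_carrier)
  show "tensor_lift K M B t \<in> carrier M" if "t \<in> carrier T" for t
    using that unfolding carr by (auto simp: tensor_lift_coset module_hom_in_carrier[OF lift_hom])
  show "tensor_lift K M B (t \<oplus>\<^bsub>T\<^esub> s) = tensor_lift K M B t \<oplus>\<^bsub>M\<^esub> tensor_lift K M B s"
    if "t \<in> carrier T" "s \<in> carrier T" for t s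
    using that unfolding carr
    by (auto simp: tensor_lift_coset add[symmetric] module_hom_add[OF lift_hom])
  show "tensor_lift K M B (c \<odot>\<^bsub>T\<^esub> t) = c \<odot>\<^bsub>M\<^esub> tensor_lift K M B t"
    if "c \<in> carrier K" "t \<in> carrier T" for c t
    using that unfolding carr
    by (auto simp: tensor_lift_coset smult[symmetric] module_hom_smult[OF lift_hom])
qed

lemma tensor_lift_pure:
  "v \<in> carrier V \<Longrightarrow> w \<in> carrier W \<Longrightarrow> tensor_lift K M B (pure v w) = B v w"
  unfolding pure_coset by (simp add: tensor_lift_coset gen_closed lift_gen)

lemma tensor_lift_lsum:
  assumes "\<And>x. x \<in> set xs \<Longrightarrow> v x \<in> carrier V" "\<And>x. x \<in> set xs \<Longrightarrow> w x \<in> carrier W"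
  shows "tensor_lift K M B (lsum T (\<lambda>x. pure (v x) (w x)) xs) = lsum M (\<lambda>x. B (v x) (w x)) xs"
  by (subst module_hom_lsum[OF tensor_space_module M tensor_lift_hom])
    (auto intro!: lsum_cong pure_closed tensor_lift_pure assms)

end

end

lemma scalar_space_vectorspace: "field K \<Longrightarrow> vectorspace K (scalar_space K)"
  by (simp add: vectorspace_def scalar_space_module)

lemma module_hom_comp:
  "h \<in> module_hom K M N \<Longrightarrow> f \<in> module_hom K N P \<Longrightarrow> (\<lambda>x. f (h x)) \<in> module_hom K M P"
  by (auto simp: module_hom_def Pi_iff)

lemma module_hom_id: "id \<in> module_hom K M M"
  by (auto simp: module_hom_def)

lemma module_hom_lsum_param:
  assumes "module K M" "module K N" "\<And>i. i \<in> set xs \<Longrightarrow> h i \<in> module_hom K M N"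
  shows "(\<lambda>x. lsum N (\<lambda>i. h i x) xs) \<in> module_hom K M N"
  using assms(3)
proof (induction xs)
  case Nil
  interpret N: module K N by fact
  show ?case by (rule module_homI) auto
next
  case (Cons i xs)
  interpret N: module K N by fact
  have i: "h i \<in> module_hom K M N" and xs: "(\<lambda>x. lsum N (\<lambda>i. h i x) xs) \<in> module_hom K M N"
    using Cons by auto
  note closed = module_hom_in_carrier[OF i] module_hom_in_carrier[OF xs]
  show ?case
    by (rule module_homI)
      (simp_all add: closed module_hom_add[OF i] module_hom_add[OF xs] module_hom_smult[OF i]
        module_hom_smult[OF xs] N.M.add.m_ac N.smult_r_distr)
qed

lemma module_hom_cong:
  assumes "h \<in> module_hom K M N" "module K M" "\<And>x. x \<in> carrier M \<Longrightarrow> h x = f x"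
  shows "f \<in> module_hom K M N"
proof -
  interpret M: module K M by fact
  show ?thesis
    using assms(1,3) by (intro module_homI) (simp_all add: assms(3)[symmetric] module_hom_in_carrier
      module_hom_add module_hom_smult)
qed

lemma bilinear_comp:
  assumes "bilinear K V W M B" "f \<in> module_hom K V' V" "h \<in> module_hom K W' W"
  shows "bilinear K V' W' M (\<lambda>v w. B (f v) (h w))"
  unfolding bilinear_def
proof (intro conjI ballI)
  show "(\<lambda>w. B (f v) (h w)) \<in> module_hom K W' M" if "v \<in> carrier V'" for v
    using module_hom_comp[OF assms(3), of "B (f v)" M] module_hom_in_carrier[OF assms(2) that] assms(1)
    by (simp add: bilinear_def)
  show "(\<lambda>v. B (f v) (h w)) \<in> module_hom K V' M" if "w \<in> carrier W'" for w
    using module_hom_comp[OF assms(2), of "\<lambda>v. B v (h w)" M] module_hom_in_carrier[OF assms(3) that] assms(1)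
    by (simp add: bilinear_def)
qed

context tensor_product
begin

text \<open>
  Lifting a bilinear map that depends linearly on a parameter gives a map that is bilinear in the
  parameter and the tensor; this handles maps out of iterated tensor products.
\<close>

lemma tensor_lift_param:
  assumes M: "module K M" and P: "module K P"
    and "\<And>p. p \<in> carrier P \<Longrightarrow> bilinear K V W M (B p)"
    and "\<And>v w. v \<in> carrier V \<Longrightarrow> w \<in> carrier W \<Longrightarrow> (\<lambda>p. B p v w) \<in> module_hom K P M"
  shows "bilinear K P T M (\<lambda>p t. tensor_lift K M (B p) t)"
  unfolding bilinear_def
proof (intro conjI ballI)
  show "tensor_lift K M (B p) \<in> module_hom K T M" if "p \<in> carrier P" for p
    by (rule tensor_lift_hom[OF M assms(3)[OF that]])
  fix t assume "t \<in> carrier T"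
  then obtain L where L: "set L \<subseteq> carrier V \<times> carrier W" "t = lsum T (\<lambda>(v, w). pure v w) L"
    by (rule tensor_decomp)
  have "(\<lambda>p. lsum M (\<lambda>i. B p (fst i) (snd i)) L) \<in> module_hom K P M"
    using L(1) by (intro module_hom_lsum_param[OF P M] assms(4)) auto
  then show "(\<lambda>p. tensor_lift K M (B p) t) \<in> module_hom K P M"
  proof (rule module_hom_cong[OF _ P])
    fix p assume "p \<in> carrier P"
    then show "lsum M (\<lambda>i. B p (fst i) (snd i)) L = tensor_lift K M (B p) t"
      using L(1) unfolding L(2) case_prod_unfold
      by (subst tensor_lift_lsum[OF M assms(3)]) auto
  qed
qed

end

lemma smult_bilinear:
  assumes "module K V" shows "bilinear K V (scalar_space K) V (\<lambda>v c. c \<odot>\<^bsub>V\<^esub> v)"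
proof -
  interpret module K V by fact
  show ?thesis
    unfolding bilinear_def
    by (intro conjI ballI module_homI)
      (simp_all add: scalar_space_def smult_l_distr smult_r_distr smult_assoc1[symmetric] R.m_comm)
qed

lemma mult_bilinear:
  assumes "unital_algebra K A" shows "bilinear K A A A (\<lambda>x y. x \<otimes>\<^bsub>A\<^esub> y)"
proof -
  interpret unital_algebra K A by fact
  show ?thesis
    unfolding bilinear_def
    by (intro conjI ballI module_homI)
      (simp_all add: l_distr r_distr smult_mult_left smult_mult_right)
qed

section \<open>Finite-dimensional vector spaces\<close>

context vectorspace
begin

lemma basis_unique:
  assumes "finite E" "basis E" "a \<in> E \<rightarrow> carrier K" "b \<in> E \<rightarrow> carrier K" "lincomb a E = lincomb b E" "e \<in> E"
  shows "a e = b e"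
proof -
  have E: "E \<subseteq> carrier V" using assms(2) by (simp add: basis_def)
  have ab: "restrict a E \<in> E \<rightarrow>\<^sub>E carrier K" "restrict b E \<in> E \<rightarrow>\<^sub>E carrier K"
    using assms(3,4) by auto
  have "lincomb (restrict a E) E = lincomb a E" "lincomb (restrict b E) E = lincomb b E"
    using assms(3,4) E by (auto intro!: lincomb_cong)
  moreover have "lincomb a E \<in> carrier V" using E assms(3) by simp
  ultimately have "restrict a E = restrict b E"
    using basis_criterion[OF assms(1) E] assms(2,5) ab by metis
  then show ?thesis using assms(6) by (metis restrict_apply')
qed

lemma basis_lincomb_ex:
  assumes "finite E" "basis E" "v \<in> carrier V"
  obtains a where "a \<in> E \<rightarrow> carrier K" "lincomb a E = v"
  using assms finite_in_span[of E v] by (auto simp: basis_def)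

lemma hom_lincomb:
  assumes "h \<in> module_hom K V (scalar_space K)" "finite E" "E \<subseteq> carrier V" "a \<in> E \<rightarrow> carrier K"
  shows "h (lincomb a E) = (\<Oplus>\<^bsub>K\<^esub>e\<in>E. a e \<otimes>\<^bsub>K\<^esub> h e)"
proof -
  interpret h: mod_hom K V "scalar_space K" h
    using assms(1) scalar_space_module[OF field_axioms]
    by (simp add: mod_hom_def mod_hom_axioms_def module.module_axioms)
  have "h (lincomb a E) = (\<Oplus>\<^bsub>scalar_space K\<^esub>e\<in>E. h (a e \<odot>\<^bsub>V\<^esub> e))"
    unfolding lincomb_def using assms(3,4) by (intro h.hom_sum) auto
  also have "\<dots> = (\<Oplus>\<^bsub>scalar_space K\<^esub>e\<in>E. a e \<odot>\<^bsub>scalar_space K\<^esub> h e)"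
    using assms(3,4) by (intro h.N.M.finsum_cong') (auto simp: Pi_iff subset_iff intro!: h.f_smult)
  finally show ?thesis by (simp add: scalar_space_def finsum_def finprod_def)
qed

text \<open>
  The image of a basis is linearly independent and has as many elements as the basis, so it is again a
  basis.
\<close>

lemma inj_endo_surj:
  assumes "fin_dim" "linear_map K V V T" "inj_on T (carrier V)"
  shows "T ` carrier V = carrier V"
proof -
  interpret T: linear_map K V V T by fact
  obtain E where E: "finite E" "basis E" using finite_basis_exists[OF assms(1)] by blast
  then have EV: "E \<subseteq> carrier V" by (simp add: basis_def)
  then have TE: "T ` E \<subseteq> carrier V" by auto
  have injE: "inj_on T E" using assms(3) EV by (rule inj_on_subset)
  have image: "lincomb a (T ` E) = T (lincomb (a \<circ> T) E)" if "a \<in> T ` E \<rightarrow> carrier K" for a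
    using T.lincomb_linear_image[OF assms(3) EV that E(1)] .
  have "lin_indpt (T ` E)"
  proof (rule finite_lin_indpt2)
    fix a assume a: "a \<in> T ` E \<rightarrow> carrier K" "lincomb a (T ` E) = \<zero>\<^bsub>V\<^esub>"
    then have aT: "a \<circ> T \<in> E \<rightarrow> carrier K" by auto
    have "T (lincomb (a \<circ> T) E) = T \<zero>\<^bsub>V\<^esub>" using a image by simp
    then have "lincomb (a \<circ> T) E = \<zero>\<^bsub>V\<^esub>"
      using inj_onD[OF assms(3), of "lincomb (a \<circ> T) E" "\<zero>\<^bsub>V\<^esub>"] lincomb_closed[OF EV aT] by simp
    also have "\<dots> = lincomb (\<lambda>_. \<zero>\<^bsub>K\<^esub>) E" using lincomb_zero[OF EV] by auto
    finally show "\<forall>v\<in>T ` E. a v = \<zero>\<^bsub>K\<^esub>"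
      using basis_unique[OF E aT, of "\<lambda>_. \<zero>\<^bsub>K\<^esub>"] by auto
  qed (use E TE in auto)
  then have "basis (T ` E)"
    using dim_li_is_basis[OF assms(1) _ TE] dim_basis[OF E] E(1) card_image[OF injE] by simp
  have "v \<in> T ` carrier V" if v: "v \<in> carrier V" for v
  proof -
    obtain a where a: "a \<in> T ` E \<rightarrow> carrier K" "lincomb a (T ` E) = v"
      using basis_lincomb_ex[OF _ \<open>basis (T ` E)\<close> v] E(1) by blast
    have "lincomb (a \<circ> T) E \<in> carrier V" using a EV by (intro lincomb_closed) auto
    then show ?thesis using image[OF a(1)] a(2) by auto
  qed
  then show ?thesis by auto
qed

text \<open>
  A basis together with its dual basis, as a list of pairs.
\<close>

lemma coordinate_system:
  assumes "fin_dim"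
  obtains P where "\<And>e \<phi>. (e, \<phi>) \<in> set P \<Longrightarrow> e \<in> carrier V \<and> \<phi> \<in> module_hom K V (scalar_space K)"
    "\<And>v. v \<in> carrier V \<Longrightarrow> v = lsum V (\<lambda>(e, \<phi>). \<phi> v \<odot>\<^bsub>V\<^esub> e) P"
proof -
  obtain E where E: "finite E" "basis E" using finite_basis_exists[OF assms] by blast
  then have EV: "E \<subseteq> carrier V" by (simp add: basis_def)
  obtain es where es: "set es = E" "distinct es" using finite_distinct_list[OF E(1)] by blast
  have "\<exists>c. \<forall>v\<in>carrier V. c v \<in> E \<rightarrow> carrier K \<and> lincomb (c v) E = v"
    using basis_lincomb_ex[OF E] by (intro bchoice) metis
  then obtain c where c: "\<And>v. v \<in> carrier V \<Longrightarrow> c v \<in> E \<rightarrow> carrier K"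
    "\<And>v. v \<in> carrier V \<Longrightarrow> lincomb (c v) E = v" by blast
  have hom: "(\<lambda>v. c v e) \<in> module_hom K V (scalar_space K)" if "e \<in> E" for e
  proof (rule module_homI)
    fix x y assume xy: "x \<in> carrier V" "y \<in> carrier V"
    have "lincomb (\<lambda>e. c x e \<oplus>\<^bsub>K\<^esub> c y e) E = lincomb (c x) E \<oplus>\<^bsub>V\<^esub> lincomb (c y) E"
      using E EV c xy by (intro lincomb_sum) auto
    then have "lincomb (c (x \<oplus>\<^bsub>V\<^esub> y)) E = lincomb (\<lambda>e. c x e \<oplus>\<^bsub>K\<^esub> c y e) E"
      using c xy by simp
    then have "c (x \<oplus>\<^bsub>V\<^esub> y) e = c x e \<oplus>\<^bsub>K\<^esub> c y e"
      using c(1)[of x] c(1)[of y] c(1)[of "x \<oplus>\<^bsub>V\<^esub> y"] xy that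
      by (intro basis_unique[OF E, of _ "\<lambda>e. c x e \<oplus>\<^bsub>K\<^esub> c y e"]) auto
    then show "c (x \<oplus>\<^bsub>V\<^esub> y) e = c x e \<oplus>\<^bsub>scalar_space K\<^esub> c y e" by (simp add: scalar_space_def)
  next
    fix r x assume rx: "r \<in> carrier K" "x \<in> carrier V"
    have "lincomb (\<lambda>e. r \<otimes>\<^bsub>K\<^esub> c x e) E = r \<odot>\<^bsub>V\<^esub> lincomb (c x) E"
      using E EV c rx by (intro lincomb_smult) auto
    then have "lincomb (c (r \<odot>\<^bsub>V\<^esub> x)) E = lincomb (\<lambda>e. r \<otimes>\<^bsub>K\<^esub> c x e) E"
      using c rx by simp
    then have "c (r \<odot>\<^bsub>V\<^esub> x) e = r \<otimes>\<^bsub>K\<^esub> c x e"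
      using c(1)[of x] c(1)[of "r \<odot>\<^bsub>V\<^esub> x"] rx that
      by (intro basis_unique[OF E, of _ "\<lambda>e. r \<otimes>\<^bsub>K\<^esub> c x e"]) auto
    then show "c (r \<odot>\<^bsub>V\<^esub> x) e = r \<odot>\<^bsub>scalar_space K\<^esub> c x e" by (simp add: scalar_space_def)
  qed (use c that in \<open>auto simp: scalar_space_def\<close>)
  show ?thesis
  proof (rule that[of "map (\<lambda>e. (e, \<lambda>v. c v e)) es"])
    fix v assume v: "v \<in> carrier V"
    have "lsum V (\<lambda>e. c v e \<odot>\<^bsub>V\<^esub> e) es = (\<Oplus>\<^bsub>V\<^esub>e\<in>set es. c v e \<odot>\<^bsub>V\<^esub> e)"
      using es EV c(1)[OF v] by (intro module.M.lsum_eq_finsum) auto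
    then show "v = lsum V (\<lambda>(e, \<phi>). \<phi> v \<odot>\<^bsub>V\<^esub> e) (map (\<lambda>e. (e, \<lambda>v. c v e)) es)"
      using c(2)[OF v] es by (simp add: lsum_map lincomb_def)
  qed (use es EV hom in auto)
qed

lemma functional_eq_zero:
  assumes "fin_dim" "v \<in> carrier V" "\<And>\<phi>. \<phi> \<in> module_hom K V (scalar_space K) \<Longrightarrow> \<phi> v = \<zero>\<^bsub>K\<^esub>"
  shows "v = \<zero>\<^bsub>V\<^esub>"
proof -
  obtain P where P: "\<And>e \<phi>. (e, \<phi>) \<in> set P \<Longrightarrow> e \<in> carrier V \<and> \<phi> \<in> module_hom K V (scalar_space K)"
    "\<And>v. v \<in> carrier V \<Longrightarrow> v = lsum V (\<lambda>(e, \<phi>). \<phi> v \<odot>\<^bsub>V\<^esub> e) P"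
    using coordinate_system[OF assms(1)] by blast
  have "v = lsum V (\<lambda>(e, \<phi>). \<phi> v \<odot>\<^bsub>V\<^esub> e) P" using P(2) assms(2) .
  also have "\<dots> = lsum V (\<lambda>_. \<zero>\<^bsub>V\<^esub>) P" by (intro lsum_cong) (auto dest!: P(1) simp: assms(3))
  also have "\<dots> = \<zero>\<^bsub>V\<^esub>" by (rule module.M.lsum_zero)
  finally show ?thesis .
qed

text \<open>
  With a basis \<open>E\<close>, the endomorphism \<open>x \<mapsto> \<Sum>e\<in>E. b x e \<cdot> e\<close> is injective by non-degeneracy, hence
  surjective; a preimage of \<open>\<Sum>e\<in>E. F e \<cdot> e\<close> represents \<open>F\<close>.
\<close>

lemma functional_represented:
  assumes fd: "fin_dim" and b: "bilinear K V V (scalar_space K) b"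
    and nondeg: "\<And>x. x \<in> carrier V \<Longrightarrow> (\<And>y. y \<in> carrier V \<Longrightarrow> b x y = \<zero>\<^bsub>K\<^esub>) \<Longrightarrow> x = \<zero>\<^bsub>V\<^esub>"
    and F: "F \<in> module_hom K V (scalar_space K)"
  shows "\<exists>z\<in>carrier V. \<forall>y\<in>carrier V. b z y = F y"
proof -
  obtain E where E: "finite E" "basis E" using finite_basis_exists[OF fd] by blast
  then have EV: "E \<subseteq> carrier V" by (simp add: basis_def)
  let ?T = "\<lambda>x. lincomb (b x) E"
  have bK: "b x y \<in> carrier K" if "x \<in> carrier V" "y \<in> carrier V" for x y
    using bilinear_closed[OF b that] by (simp add: scalar_space_def)
  have bE: "b x \<in> E \<rightarrow> carrier K" if "x \<in> carrier V" for x using bK that EV by auto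
  have ext: "h (lincomb a E) = h' (lincomb a E)"
    if "h \<in> module_hom K V (scalar_space K)" "h' \<in> module_hom K V (scalar_space K)"
      "a \<in> E \<rightarrow> carrier K" "\<And>e. e \<in> E \<Longrightarrow> h e = h' e" for h h' a
  proof -
    have "h' e \<in> carrier K" if "e \<in> E" for e
      using module_hom_in_carrier[OF \<open>h' \<in> _\<close>] that EV by (auto simp: scalar_space_def)
    moreover have "abelian_monoid K" by unfold_locales
    ultimately have "(\<Oplus>\<^bsub>K\<^esub>e\<in>E. a e \<otimes>\<^bsub>K\<^esub> h e) = (\<Oplus>\<^bsub>K\<^esub>e\<in>E. a e \<otimes>\<^bsub>K\<^esub> h' e)"
      using that(3,4) by (intro abelian_monoid.finsum_cong'[of K]) (auto simp: Pi_def)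
    then show ?thesis
      using hom_lincomb[OF that(1) E(1) EV that(3)] hom_lincomb[OF that(2) E(1) EV that(3)] by simp
  qed
  have agree: "h y = h' y" if "h \<in> module_hom K V (scalar_space K)" "h' \<in> module_hom K V (scalar_space K)"
      "\<And>e. e \<in> E \<Longrightarrow> h e = h' e" "y \<in> carrier V" for h h' y
    using basis_lincomb_ex[OF E that(4)] ext[OF that(1,2)] that(3) by metis
  have hb: "b x \<in> module_hom K V (scalar_space K)" if "x \<in> carrier V" for x
    using b that by (simp add: bilinear_def)
  have zero_hom: "(\<lambda>_. \<zero>\<^bsub>K\<^esub>) \<in> module_hom K V (scalar_space K)"
    by (rule module_homI) (auto simp: scalar_space_def)
  have T: "?T \<in> module_hom K V V"
  proof (rule module_homI)
    fix x y assume xy: "x \<in> carrier V" "y \<in> carrier V"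
    have "?T (x \<oplus>\<^bsub>V\<^esub> y) = lincomb (\<lambda>e. b x e \<oplus>\<^bsub>K\<^esub> b y e) E"
      using bilinear_add_left[OF b] xy bK EV
      by (intro lincomb_cong) (auto simp: scalar_space_def)
    then show "?T (x \<oplus>\<^bsub>V\<^esub> y) = ?T x \<oplus>\<^bsub>V\<^esub> ?T y"
      using lincomb_sum[OF E(1) EV bE[OF xy(1)] bE[OF xy(2)]] by simp
  next
    fix r x assume rx: "r \<in> carrier K" "x \<in> carrier V"
    have "?T (r \<odot>\<^bsub>V\<^esub> x) = lincomb (\<lambda>e. r \<otimes>\<^bsub>K\<^esub> b x e) E"
      using bilinear_smult_left[OF b] rx bK EV
      by (intro lincomb_cong) (auto simp: scalar_space_def)
    then show "?T (r \<odot>\<^bsub>V\<^esub> x) = r \<odot>\<^bsub>V\<^esub> ?T x"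
      using lincomb_smult[OF EV bE[OF rx(2)] rx(1)] by simp
  qed (use bE EV in auto)
  interpret T: linear_map K V V ?T
    using T by (simp add: linear_map_def mod_hom_def mod_hom_axioms_def vectorspace_axioms module.module_axioms)
  have "T.ker = {\<zero>\<^bsub>V\<^esub>}"
  proof -
    have "x = \<zero>\<^bsub>V\<^esub>" if x: "x \<in> carrier V" "?T x = \<zero>\<^bsub>V\<^esub>" for x
    proof (rule nondeg[OF x(1)])
      fix y assume y: "y \<in> carrier V"
      have "lincomb (\<lambda>_. \<zero>\<^bsub>K\<^esub>) E = \<zero>\<^bsub>V\<^esub>" using lincomb_zero[OF EV] by auto
      then have "b x e = \<zero>\<^bsub>K\<^esub>" if "e \<in> E" for e
        using x(2) bE[OF x(1)] that by (intro basis_unique[OF E, of _ "\<lambda>_. \<zero>\<^bsub>K\<^esub>"]) auto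
      then show "b x y = \<zero>\<^bsub>K\<^esub>" by (intro agree[OF hb[OF x(1)] zero_hom _ y])
    qed
    then show ?thesis by (auto simp: T.ker_def)
  qed
  then have inj: "inj_on ?T (carrier V)" using T.Ke0_imp_inj by simp
  have FE: "F \<in> E \<rightarrow> carrier K"
    using module_hom_in_carrier[OF F] EV by (auto simp: scalar_space_def)
  then have "lincomb F E \<in> ?T ` carrier V"
    using inj_endo_surj[OF fd T.linear_map_axioms inj] EV by simp
  then obtain z where z: "z \<in> carrier V" "?T z = lincomb F E" by auto
  have "b z e = F e" if "e \<in> E" for e
    using basis_unique[OF E bE[OF z(1)] FE z(2) that] .
  then have "b z y = F y" if "y \<in> carrier V" for y
    using agree[OF hb[OF z(1)] F _ that] by blast
  then show ?thesis using z(1) by blast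
qed

end

section \<open>Hopf group-coalgebras in Sweedler notation\<close>

lemma scalar_space_simps [simp]:
  "carrier (scalar_space K) = carrier K" "add (scalar_space K) = add K"
  "smult (scalar_space K) = mult K" "zero (scalar_space K) = zero K"
  by (simp_all add: scalar_space_def)

lemma lsum_scalar_space: "lsum (scalar_space K) = lsum K"
  by (simp add: lsum_def scalar_space_def fun_eq_iff)

definition trilinear ::
  "('k, 'n) ring_scheme \<Rightarrow> ('k, 'u, 'j) module_scheme \<Rightarrow> ('k, 'v, 'm) module_scheme \<Rightarrow>
    ('k, 'w, 'l) module_scheme \<Rightarrow> ('u \<Rightarrow> 'v \<Rightarrow> 'w \<Rightarrow> 'k) \<Rightarrow> bool" where
  "trilinear K U V W f \<longleftrightarrow> (\<forall>u\<in>carrier U. bilinear K V W (scalar_space K) (f u)) \<and>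
     (\<forall>v\<in>carrier V. \<forall>w\<in>carrier W. (\<lambda>u. f u v w) \<in> module_hom K U (scalar_space K))"

text \<open>
  If \<open>L\<close> lists the terms of a tensor, this is the value of the bilinear form \<open>B\<close> on that tensor: for the
  terms of a coproduct, \<open>B(x\<^sub>1, x\<^sub>2)\<close> in Sweedler notation.
\<close>

definition sweedler :: "('k, 'n) ring_scheme \<Rightarrow> ('v \<times> 'w) list \<Rightarrow> ('v \<Rightarrow> 'w \<Rightarrow> 'k) \<Rightarrow> 'k" where
  "sweedler K L B = lsum K (\<lambda>(a, b). B a b) L"

lemma sweedler_cong:
  "(\<And>a b. (a, b) \<in> set L \<Longrightarrow> B a b = C a b) \<Longrightarrow> sweedler K L B = sweedler K L C"
  unfolding sweedler_def by (rule lsum_cong) auto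

lemma (in field) sweedler_closed:
  "(\<And>a b. (a, b) \<in> set L \<Longrightarrow> B a b \<in> carrier R) \<Longrightarrow> sweedler R L B \<in> carrier R"
  unfolding sweedler_def by (rule lsum_closed) auto

lemma (in field) sweedler_add:
  "(\<And>a b. (a, b) \<in> set L \<Longrightarrow> B a b \<in> carrier R) \<Longrightarrow> (\<And>a b. (a, b) \<in> set L \<Longrightarrow> C a b \<in> carrier R) \<Longrightarrow>
   sweedler R L (\<lambda>a b. B a b \<oplus> C a b) = sweedler R L B \<oplus> sweedler R L C"
  unfolding sweedler_def by (subst lsum_add[symmetric]) (auto intro!: lsum_cong)

lemma (in field) sweedler_scale:
  assumes "c \<in> carrier R"
  shows "(\<And>a b. (a, b) \<in> set L \<Longrightarrow> B a b \<in> carrier R) \<Longrightarrow>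
    sweedler R L (\<lambda>a b. c \<otimes> B a b) = c \<otimes> sweedler R L B"
proof (induction L)
  case (Cons p L)
  then have "sweedler R L B \<in> carrier R" by (intro sweedler_closed) auto
  with Cons assms show ?case by (cases p) (simp add: sweedler_def r_distr)
qed (simp add: sweedler_def assms)

lemma (in field) sweedler_lsum:
  assumes "\<And>a b i. (a, b) \<in> set L \<Longrightarrow> i \<in> set xs \<Longrightarrow> B i a b \<in> carrier R"
  shows "sweedler R L (\<lambda>a b. lsum R (\<lambda>i. B i a b) xs) = lsum R (\<lambda>i. sweedler R L (B i)) xs"
  unfolding sweedler_def
  by (subst lsum_swap[symmetric]) (use assms in \<open>auto intro!: lsum_cong\<close>)

lemma (in field) sweedler_swap:
  assumes "\<And>a b c d. (a, b) \<in> set L \<Longrightarrow> (c, d) \<in> set M \<Longrightarrow> B a b c d \<in> carrier R"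
  shows "sweedler R L (\<lambda>a b. sweedler R M (\<lambda>c d. B a b c d)) =
    sweedler R M (\<lambda>c d. sweedler R L (\<lambda>a b. B a b c d))"
  using sweedler_lsum[of L M "\<lambda>(c, d) a b. B a b c d"] assms
  by (simp add: sweedler_def case_prod_unfold)

lemma (in field) sweedler_zero: "(\<And>a b. (a, b) \<in> set L \<Longrightarrow> B a b = \<zero>) \<Longrightarrow> sweedler R L B = \<zero>"
  unfolding sweedler_def by (induction L) auto

text \<open>
  The axioms of a Hopf \<open>G\<close>-coalgebra of finite type, for a comultiplication that is given by a list
  \<open>D \<alpha> \<beta> x\<close> of terms and is only seen through scalar-valued multilinear forms.  The tensor product
  does not occur, so reversing all products and coproducts, which merely swaps the pairs in the lists,
  visibly leads to another instance.  The surjectivity of the antipode stands for the presence of a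
  pivot, which makes the square of the antipode a conjugation.
\<close>

locale sweedler_coalgebra = group G + K: field K
  for G :: "('g, 'm) monoid_scheme" (structure) and K :: "('k, 'n) ring_scheme" +
  fixes H :: "'g \<Rightarrow> ('k, 'a) module"
    and D :: "'g \<Rightarrow> 'g \<Rightarrow> 'a \<Rightarrow> ('a \<times> 'a) list"
    and \<epsilon> :: "'a \<Rightarrow> 'k"
    and S :: "'g \<Rightarrow> 'a \<Rightarrow> 'a"
  assumes algebras: "\<alpha> \<in> carrier G \<Longrightarrow> unital_algebra K (H \<alpha>)"
    and finite_dimensional: "\<alpha> \<in> carrier G \<Longrightarrow> vectorspace.fin_dim K (H \<alpha>)"
    and comult_closed: "\<lbrakk>\<alpha> \<in> carrier G; \<beta> \<in> carrier G; x \<in> carrier (H (\<alpha> \<otimes> \<beta>))\<rbrakk> \<Longrightarrow>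
      set (D \<alpha> \<beta> x) \<subseteq> carrier (H \<alpha>) \<times> carrier (H \<beta>)"
    and comult_linear: "\<lbrakk>\<alpha> \<in> carrier G; \<beta> \<in> carrier G;
        bilinear K (H \<alpha>) (H \<beta>) (scalar_space K) B\<rbrakk> \<Longrightarrow>
      (\<lambda>x. sweedler K (D \<alpha> \<beta> x) B) \<in> module_hom K (H (\<alpha> \<otimes> \<beta>)) (scalar_space K)"
    and comult_mult: "\<lbrakk>\<alpha> \<in> carrier G; \<beta> \<in> carrier G; x \<in> carrier (H (\<alpha> \<otimes> \<beta>));
        y \<in> carrier (H (\<alpha> \<otimes> \<beta>)); bilinear K (H \<alpha>) (H \<beta>) (scalar_space K) B\<rbrakk> \<Longrightarrow>
      sweedler K (D \<alpha> \<beta> (x \<otimes>\<^bsub>H (\<alpha> \<otimes> \<beta>)\<^esub> y)) B =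
      sweedler K (D \<alpha> \<beta> x) (\<lambda>a b. sweedler K (D \<alpha> \<beta> y)
        (\<lambda>c d. B (a \<otimes>\<^bsub>H \<alpha>\<^esub> c) (b \<otimes>\<^bsub>H \<beta>\<^esub> d)))"
    and coassoc: "\<lbrakk>\<alpha> \<in> carrier G; \<beta> \<in> carrier G; \<gamma> \<in> carrier G; x \<in> carrier (H (\<alpha> \<otimes> \<beta> \<otimes> \<gamma>));
        trilinear K (H \<alpha>) (H \<beta>) (H \<gamma>) T\<rbrakk> \<Longrightarrow>
      sweedler K (D (\<alpha> \<otimes> \<beta>) \<gamma> x) (\<lambda>u c. sweedler K (D \<alpha> \<beta> u) (\<lambda>a b. T a b c)) =
      sweedler K (D \<alpha> (\<beta> \<otimes> \<gamma>) x) (\<lambda>a v. sweedler K (D \<beta> \<gamma> v) (\<lambda>b c. T a b c))"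
    and counit_linear: "\<epsilon> \<in> module_hom K (H \<one>) (scalar_space K)"
    and counit_mult: "\<lbrakk>x \<in> carrier (H \<one>); y \<in> carrier (H \<one>)\<rbrakk> \<Longrightarrow>
      \<epsilon> (x \<otimes>\<^bsub>H \<one>\<^esub> y) = \<epsilon> x \<otimes>\<^bsub>K\<^esub> \<epsilon> y"
    and counit_one: "\<epsilon> \<one>\<^bsub>H \<one>\<^esub> = \<one>\<^bsub>K\<^esub>"
    and counit_right: "\<lbrakk>\<alpha> \<in> carrier G; x \<in> carrier (H \<alpha>); f \<in> module_hom K (H \<alpha>) (scalar_space K)\<rbrakk> \<Longrightarrow>
      sweedler K (D \<alpha> \<one> x) (\<lambda>a b. f a \<otimes>\<^bsub>K\<^esub> \<epsilon> b) = f x"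
    and counit_left: "\<lbrakk>\<alpha> \<in> carrier G; x \<in> carrier (H \<alpha>); f \<in> module_hom K (H \<alpha>) (scalar_space K)\<rbrakk> \<Longrightarrow>
      sweedler K (D \<one> \<alpha> x) (\<lambda>a b. \<epsilon> a \<otimes>\<^bsub>K\<^esub> f b) = f x"
    and antipode_linear: "\<alpha> \<in> carrier G \<Longrightarrow> S \<alpha> \<in> module_hom K (H \<alpha>) (H (inv \<alpha>))"
    and antipode_surj: "\<lbrakk>\<alpha> \<in> carrier G; y \<in> carrier (H (inv \<alpha>))\<rbrakk> \<Longrightarrow> \<exists>x\<in>carrier (H \<alpha>). S \<alpha> x = y"
    and antipode_left: "\<lbrakk>\<alpha> \<in> carrier G; x \<in> carrier (H \<one>); f \<in> module_hom K (H \<alpha>) (scalar_space K)\<rbrakk> \<Longrightarrow>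
      sweedler K (D (inv \<alpha>) \<alpha> x) (\<lambda>a b. f (S (inv \<alpha>) a \<otimes>\<^bsub>H \<alpha>\<^esub> b)) = \<epsilon> x \<otimes>\<^bsub>K\<^esub> f \<one>\<^bsub>H \<alpha>\<^esub>"
    and antipode_right: "\<lbrakk>\<alpha> \<in> carrier G; x \<in> carrier (H \<one>); f \<in> module_hom K (H \<alpha>) (scalar_space K)\<rbrakk> \<Longrightarrow>
      sweedler K (D \<alpha> (inv \<alpha>) x) (\<lambda>a b. f (a \<otimes>\<^bsub>H \<alpha>\<^esub> S (inv \<alpha>) b)) = \<epsilon> x \<otimes>\<^bsub>K\<^esub> f \<one>\<^bsub>H \<alpha>\<^esub>"
begin

abbreviation functional :: "'g \<Rightarrow> ('a \<Rightarrow> 'k) \<Rightarrow> bool" where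
  "functional \<alpha> f \<equiv> f \<in> module_hom K (H \<alpha>) (scalar_space K)"

abbreviation linear_to :: "'g \<Rightarrow> 'g \<Rightarrow> ('a \<Rightarrow> 'a) \<Rightarrow> bool" where
  "linear_to \<alpha> \<beta> h \<equiv> h \<in> module_hom K (H \<alpha>) (H \<beta>)"

lemma H_ring: "\<alpha> \<in> carrier G \<Longrightarrow> ring (H \<alpha>)"
  and H_module: "\<alpha> \<in> carrier G \<Longrightarrow> module K (H \<alpha>)"
  and H_vectorspace: "\<alpha> \<in> carrier G \<Longrightarrow> vectorspace K (H \<alpha>)"
  using algebras by (simp_all add: unital_algebra_def vectorspace_def)

lemma H_mult_closed: "\<lbrakk>\<alpha> \<in> carrier G; x \<in> carrier (H \<alpha>); y \<in> carrier (H \<alpha>)\<rbrakk> \<Longrightarrow>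
    x \<otimes>\<^bsub>H \<alpha>\<^esub> y \<in> carrier (H \<alpha>)"
  and H_one_closed: "\<alpha> \<in> carrier G \<Longrightarrow> \<one>\<^bsub>H \<alpha>\<^esub> \<in> carrier (H \<alpha>)"
  and H_mult_assoc: "\<lbrakk>\<alpha> \<in> carrier G; x \<in> carrier (H \<alpha>); y \<in> carrier (H \<alpha>); z \<in> carrier (H \<alpha>)\<rbrakk> \<Longrightarrow>
    x \<otimes>\<^bsub>H \<alpha>\<^esub> y \<otimes>\<^bsub>H \<alpha>\<^esub> z = x \<otimes>\<^bsub>H \<alpha>\<^esub> (y \<otimes>\<^bsub>H \<alpha>\<^esub> z)"
  and H_one_left: "\<lbrakk>\<alpha> \<in> carrier G; x \<in> carrier (H \<alpha>)\<rbrakk> \<Longrightarrow> \<one>\<^bsub>H \<alpha>\<^esub> \<otimes>\<^bsub>H \<alpha>\<^esub> x = x"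
  and H_one_right: "\<lbrakk>\<alpha> \<in> carrier G; x \<in> carrier (H \<alpha>)\<rbrakk> \<Longrightarrow> x \<otimes>\<^bsub>H \<alpha>\<^esub> \<one>\<^bsub>H \<alpha>\<^esub> = x"
  using H_ring[of \<alpha>] monoid.m_closed[of "H \<alpha>"] monoid.one_closed[of "H \<alpha>"] monoid.m_assoc[of "H \<alpha>"]
    monoid.l_one[of "H \<alpha>"] monoid.r_one[of "H \<alpha>"] ring.is_monoid[of "H \<alpha>"] by auto

lemmas H_simps = H_mult_closed H_one_closed H_mult_assoc H_one_left H_one_right

lemma comult_mem:
  assumes "(a, b) \<in> set (D \<alpha> \<beta> x)" "\<alpha> \<in> carrier G" "\<beta> \<in> carrier G" "x \<in> carrier (H (\<alpha> \<otimes> \<beta>))"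
  shows "a \<in> carrier (H \<alpha>)" "b \<in> carrier (H \<beta>)"
  using comult_closed[OF assms(2-4)] assms(1) by auto

lemma functional_closed: "functional \<alpha> f \<Longrightarrow> x \<in> carrier (H \<alpha>) \<Longrightarrow> f x \<in> carrier K"
  by (auto dest: module_hom_in_carrier)

lemma antipode_closed: "\<alpha> \<in> carrier G \<Longrightarrow> x \<in> carrier (H \<alpha>) \<Longrightarrow> S \<alpha> x \<in> carrier (H (inv \<alpha>))"
  by (rule module_hom_in_carrier[OF antipode_linear])

lemma functional_comp: "functional \<beta> f \<Longrightarrow> linear_to \<alpha> \<beta> h \<Longrightarrow> functional \<alpha> (\<lambda>x. f (h x))"
  by (auto simp: module_hom_def Pi_iff)

lemma functional_scale_left: "c \<in> carrier K \<Longrightarrow> functional \<alpha> f \<Longrightarrow> functional \<alpha> (\<lambda>x. c \<otimes>\<^bsub>K\<^esub> f x)"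
  by (auto simp: module_hom_def Pi_iff K.r_distr K.m_lcomm)

lemma functional_scale_right: "c \<in> carrier K \<Longrightarrow> functional \<alpha> f \<Longrightarrow> functional \<alpha> (\<lambda>x. f x \<otimes>\<^bsub>K\<^esub> c)"
  by (auto simp: module_hom_def Pi_iff K.l_distr K.m_assoc)

lemma linear_id: "linear_to \<alpha> \<alpha> (\<lambda>x. x)"
  by (auto simp: module_hom_def)

lemma linear_mult_left:
  "\<alpha> \<in> carrier G \<Longrightarrow> y \<in> carrier (H \<alpha>) \<Longrightarrow> linear_to \<beta> \<alpha> h \<Longrightarrow> linear_to \<beta> \<alpha> (\<lambda>x. y \<otimes>\<^bsub>H \<alpha>\<^esub> h x)"
  using unital_algebra.smult_mult_right[OF algebras] ring.ring_simprules(23)[OF H_ring]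
  by (auto simp: module_hom_def H_mult_closed Pi_iff)

lemma linear_mult_right:
  "\<alpha> \<in> carrier G \<Longrightarrow> y \<in> carrier (H \<alpha>) \<Longrightarrow> linear_to \<beta> \<alpha> h \<Longrightarrow> linear_to \<beta> \<alpha> (\<lambda>x. h x \<otimes>\<^bsub>H \<alpha>\<^esub> y)"
  using unital_algebra.smult_mult_left[OF algebras] ring.ring_simprules(13)[OF H_ring]
  by (auto simp: module_hom_def H_mult_closed Pi_iff)

lemma linear_antipode:
  "\<alpha> \<in> carrier G \<Longrightarrow> linear_to \<beta> \<alpha> h \<Longrightarrow> linear_to \<beta> (inv \<alpha>) (\<lambda>x. S \<alpha> (h x))"
  using antipode_linear[of \<alpha>] by (auto simp: module_hom_def Pi_iff)

lemma functional_sweedler_arg: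
  assumes "\<alpha> \<in> carrier G" "\<beta> \<in> carrier G" "bilinear K (H \<alpha>) (H \<beta>) (scalar_space K) B"
    "linear_to \<gamma> (\<alpha> \<otimes> \<beta>) h"
  shows "functional \<gamma> (\<lambda>x. sweedler K (D \<alpha> \<beta> (h x)) B)"
  by (rule functional_comp[OF comult_linear[OF assms(1-3)] assms(4)])

lemma functional_sweedler_param:
  assumes "\<And>a b. (a, b) \<in> set L \<Longrightarrow> functional \<gamma> (\<lambda>x. B x a b)"
  shows "functional \<gamma> (\<lambda>x. sweedler K L (B x))"
proof (rule module_homI)
  have B: "B x a b \<in> carrier K" if "(a, b) \<in> set L" "x \<in> carrier (H \<gamma>)" for a b x
    using functional_closed[OF assms[OF that(1)] that(2)] .
  show "sweedler K L (B x) \<in> carrier (scalar_space K)" if "x \<in> carrier (H \<gamma>)" for x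
    using B that by (simp add: K.sweedler_closed)
  show "sweedler K L (B (x \<oplus>\<^bsub>H \<gamma>\<^esub> y)) = sweedler K L (B x) \<oplus>\<^bsub>scalar_space K\<^esub> sweedler K L (B y)"
    if "x \<in> carrier (H \<gamma>)" "y \<in> carrier (H \<gamma>)" for x y
    using B that by (simp add: K.sweedler_add[symmetric])
      (auto intro!: sweedler_cong dest!: assms dest: module_hom_add)
  show "sweedler K L (B (c \<odot>\<^bsub>H \<gamma>\<^esub> x)) = c \<odot>\<^bsub>scalar_space K\<^esub> sweedler K L (B x)"
    if "c \<in> carrier K" "x \<in> carrier (H \<gamma>)" for c x
    using B that by (simp add: K.sweedler_scale[symmetric])
      (auto intro!: sweedler_cong dest!: assms dest: module_hom_smult)
qed

lemma bilinearI:
  assumes "\<And>a. a \<in> carrier (H \<alpha>) \<Longrightarrow> functional \<beta> (\<lambda>b. B a b)"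
    "\<And>b. b \<in> carrier (H \<beta>) \<Longrightarrow> functional \<alpha> (\<lambda>a. B a b)"
  shows "bilinear K (H \<alpha>) (H \<beta>) (scalar_space K) B"
  using assms by (simp add: bilinear_def)

lemma trilinearI:
  assumes "\<And>a b. a \<in> carrier (H \<alpha>) \<Longrightarrow> b \<in> carrier (H \<beta>) \<Longrightarrow> functional \<gamma> (\<lambda>c. T a b c)"
    "\<And>a c. a \<in> carrier (H \<alpha>) \<Longrightarrow> c \<in> carrier (H \<gamma>) \<Longrightarrow> functional \<beta> (\<lambda>b. T a b c)"
    "\<And>b c. b \<in> carrier (H \<beta>) \<Longrightarrow> c \<in> carrier (H \<gamma>) \<Longrightarrow> functional \<alpha> (\<lambda>a. T a b c)"
  shows "trilinear K (H \<alpha>) (H \<beta>) (H \<gamma>) T"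
  using assms by (simp add: trilinear_def bilinear_def)

lemmas linear_intros = functional_scale_left functional_scale_right
  linear_mult_left linear_mult_right linear_antipode linear_id

end

section \<open>Integrals and cointegrals\<close>

context sweedler_coalgebra
begin

definition right_integral :: "('g \<Rightarrow> 'a \<Rightarrow> 'k) \<Rightarrow> bool" where
  "right_integral \<mu> \<longleftrightarrow> (\<forall>\<alpha>\<in>carrier G. functional \<alpha> (\<mu> \<alpha>)) \<and>
     (\<forall>\<alpha>\<in>carrier G. \<forall>\<beta>\<in>carrier G. \<forall>x\<in>carrier (H (\<alpha> \<otimes> \<beta>)). \<forall>q. functional \<beta> q \<longrightarrow>
       sweedler K (D \<alpha> \<beta> x) (\<lambda>a b. \<mu> \<alpha> a \<otimes>\<^bsub>K\<^esub> q b) = \<mu> (\<alpha> \<otimes> \<beta>) x \<otimes>\<^bsub>K\<^esub> q \<one>\<^bsub>H \<beta>\<^esub>)"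

lemma right_integral_functional: "right_integral \<mu> \<Longrightarrow> \<alpha> \<in> carrier G \<Longrightarrow> functional \<alpha> (\<mu> \<alpha>)"
  by (simp add: right_integral_def)

lemma right_integralD:
  "\<lbrakk>right_integral \<mu>; \<alpha> \<in> carrier G; \<beta> \<in> carrier G; x \<in> carrier (H (\<alpha> \<otimes> \<beta>)); functional \<beta> q\<rbrakk> \<Longrightarrow>
    sweedler K (D \<alpha> \<beta> x) (\<lambda>a b. \<mu> \<alpha> a \<otimes>\<^bsub>K\<^esub> q b) = \<mu> (\<alpha> \<otimes> \<beta>) x \<otimes>\<^bsub>K\<^esub> q \<one>\<^bsub>H \<beta>\<^esub>"
  by (simp add: right_integral_def)

text \<open>
  Let \<open>\<lambda> = \<mu>\<^sub>1\<close>.  Since \<open>\<lambda>\<close> is an integral, \<open>\<lambda>(x y\<^sub>1) S(y\<^sub>2)\<close> equals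
  \<open>\<lambda>(x\<^sub>1 y\<^sub>1) x\<^sub>2 y\<^sub>2 S(y\<^sub>3)\<close>; the last two factors collapse to the counit, which leaves
  \<open>\<lambda>(x\<^sub>1 y) x\<^sub>2\<close>.  The functional \<open>f\<close> tests this identity in \<open>H\<^sub>1\<close>.
\<close>

lemma integral_translate:
  assumes mu: "right_integral \<mu>" and x: "x \<in> carrier (H \<one>)" and y: "y \<in> carrier (H \<one>)" and f: "functional \<one> f"
  shows "sweedler K (D \<one> \<one> x) (\<lambda>a b. \<mu> \<one> (a \<otimes>\<^bsub>H \<one>\<^esub> y) \<otimes>\<^bsub>K\<^esub> f b) =
    sweedler K (D \<one> \<one> y) (\<lambda>c d. \<mu> \<one> (x \<otimes>\<^bsub>H \<one>\<^esub> c) \<otimes>\<^bsub>K\<^esub> f (S \<one> d))"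
proof -
  let ?m = "\<lambda>x y. x \<otimes>\<^bsub>H \<one>\<^esub> y" and ?D = "D \<one> \<one>"
  note lam = right_integral_functional[OF mu one_closed]
  note comp = functional_comp[OF lam] functional_comp[OF f]
  have mem: "a \<in> carrier (H \<one>)" "b \<in> carrier (H \<one>)" if "(a, b) \<in> set (?D z)" "z \<in> carrier (H \<one>)" for a b z
    using comult_mem[OF that(1)] that(2) by auto
  have S: "S \<one> z \<in> carrier (H \<one>)" if "z \<in> carrier (H \<one>)" for z
    using antipode_closed[OF one_closed that] by simp
  note intros = linear_intros comp linear_antipode[of \<one>, simplified]
  note closed = functional_closed[OF lam] functional_closed[OF f] S H_mult_closed x y
    functional_closed[OF counit_linear] H_one_closed
  \<comment> \<open>The integral property at \<open>x y\<^sub>1\<close>, read from right to left, creates the factors \<open>x\<^sub>2 y\<^sub>2\<close>.\<close>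
  have "sweedler K (?D y) (\<lambda>c d. \<mu> \<one> (?m x c) \<otimes>\<^bsub>K\<^esub> f (S \<one> d)) =
      sweedler K (?D y) (\<lambda>c d. sweedler K (?D (?m x c)) (\<lambda>u v. \<mu> \<one> u \<otimes>\<^bsub>K\<^esub> f (?m v (S \<one> d))))"
  proof (rule sweedler_cong)
    fix c d assume "(c, d) \<in> set (?D y)"
    then have cd: "c \<in> carrier (H \<one>)" "d \<in> carrier (H \<one>)" using mem y by auto
    have "functional \<one> (\<lambda>v. f (?m v (S \<one> d)))"
      by (intro intros S cd one_closed)
    from right_integralD[OF mu one_closed one_closed _ this, of "?m x c"]
    show "\<mu> \<one> (?m x c) \<otimes>\<^bsub>K\<^esub> f (S \<one> d) = sweedler K (?D (?m x c)) (\<lambda>u v. \<mu> \<one> u \<otimes>\<^bsub>K\<^esub> f (?m v (S \<one> d)))"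
      using cd x by (simp add: H_simps S)
  qed
  also have "\<dots> = sweedler K (?D y) (\<lambda>c d. sweedler K (?D x) (\<lambda>a b. sweedler K (?D c)
      (\<lambda>p q. \<mu> \<one> (?m a p) \<otimes>\<^bsub>K\<^esub> f (?m (?m b q) (S \<one> d)))))"
  proof (rule sweedler_cong)
    fix c d assume "(c, d) \<in> set (?D y)"
    then have cd: "c \<in> carrier (H \<one>)" "d \<in> carrier (H \<one>)" using mem y by auto
    have "bilinear K (H \<one>) (H \<one>) (scalar_space K) (\<lambda>u v. \<mu> \<one> u \<otimes>\<^bsub>K\<^esub> f (?m v (S \<one> d)))"
      by (intro bilinearI intros S cd one_closed closed lam)
    from comult_mult[OF one_closed one_closed _ _ this, of x c]
    show "sweedler K (?D (?m x c)) (\<lambda>u v. \<mu> \<one> u \<otimes>\<^bsub>K\<^esub> f (?m v (S \<one> d))) =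
        sweedler K (?D x) (\<lambda>a b. sweedler K (?D c) (\<lambda>p q. \<mu> \<one> (?m a p) \<otimes>\<^bsub>K\<^esub> f (?m (?m b q) (S \<one> d))))"
      using cd x by simp
  qed
  also have "\<dots> = sweedler K (?D x) (\<lambda>a b. sweedler K (?D y) (\<lambda>c d. sweedler K (?D c)
      (\<lambda>p q. \<mu> \<one> (?m a p) \<otimes>\<^bsub>K\<^esub> f (?m (?m b q) (S \<one> d)))))"
  proof (rule K.sweedler_swap, rule K.sweedler_closed)
    fix a b c d p q
    assume *: "(a, b) \<in> set (?D x)" "(c, d) \<in> set (?D y)" "(p, q) \<in> set (?D c)"
    note mem[OF *(1) x] mem[OF *(2) y] mem[OF *(3) mem(1)[OF *(2) y]]
    then show "\<mu> \<one> (?m a p) \<otimes>\<^bsub>K\<^esub> f (?m (?m b q) (S \<one> d)) \<in> carrier K"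
      by (simp add: closed)
  qed
  also have "\<dots> = sweedler K (?D x) (\<lambda>a b. \<mu> \<one> (?m a y) \<otimes>\<^bsub>K\<^esub> f b)"
  proof (rule sweedler_cong)
    fix a b assume "(a, b) \<in> set (?D x)"
    then have ab: "a \<in> carrier (H \<one>)" "b \<in> carrier (H \<one>)" using mem x by auto
    have "trilinear K (H \<one>) (H \<one>) (H \<one>) (\<lambda>p q d. \<mu> \<one> (?m a p) \<otimes>\<^bsub>K\<^esub> f (?m (?m b q) (S \<one> d)))"
      by (intro trilinearI intros closed ab one_closed)
    \<comment> \<open>Regroup the coproduct of \<open>y\<close> so that \<open>y\<^sub>2\<close> meets \<open>S(y\<^sub>3)\<close>.\<close>
    from coassoc[OF one_closed one_closed one_closed _ this, of y]
    have "sweedler K (?D y) (\<lambda>c d. sweedler K (?D c) (\<lambda>p q. \<mu> \<one> (?m a p) \<otimes>\<^bsub>K\<^esub> f (?m (?m b q) (S \<one> d)))) =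
      sweedler K (?D y) (\<lambda>p v. sweedler K (?D v) (\<lambda>q d. \<mu> \<one> (?m a p) \<otimes>\<^bsub>K\<^esub> f (?m (?m b q) (S \<one> d))))"
      using y by simp
    also have "\<dots> = sweedler K (?D y) (\<lambda>p v. (\<mu> \<one> (?m a p) \<otimes>\<^bsub>K\<^esub> f b) \<otimes>\<^bsub>K\<^esub> \<epsilon> v)"
    proof (rule sweedler_cong)
      fix p v assume "(p, v) \<in> set (?D y)"
      then have pv: "p \<in> carrier (H \<one>)" "v \<in> carrier (H \<one>)" using mem y by auto
      have "functional \<one> (\<lambda>z. \<mu> \<one> (?m a p) \<otimes>\<^bsub>K\<^esub> f (?m b z))"
        by (intro intros closed ab pv one_closed)
      from antipode_right[OF one_closed pv(2) this]
      have "sweedler K (?D v) (\<lambda>q d. \<mu> \<one> (?m a p) \<otimes>\<^bsub>K\<^esub> f (?m b (?m q (S \<one> d)))) =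
          \<epsilon> v \<otimes>\<^bsub>K\<^esub> (\<mu> \<one> (?m a p) \<otimes>\<^bsub>K\<^esub> f b)"
        using ab by (simp add: H_simps)
      moreover have "sweedler K (?D v) (\<lambda>q d. \<mu> \<one> (?m a p) \<otimes>\<^bsub>K\<^esub> f (?m (?m b q) (S \<one> d))) =
          sweedler K (?D v) (\<lambda>q d. \<mu> \<one> (?m a p) \<otimes>\<^bsub>K\<^esub> f (?m b (?m q (S \<one> d))))"
        by (rule sweedler_cong) (use ab pv(2) in \<open>simp add: H_simps S mem\<close>)
      ultimately show "sweedler K (?D v) (\<lambda>q d. \<mu> \<one> (?m a p) \<otimes>\<^bsub>K\<^esub> f (?m (?m b q) (S \<one> d))) =
          (\<mu> \<one> (?m a p) \<otimes>\<^bsub>K\<^esub> f b) \<otimes>\<^bsub>K\<^esub> \<epsilon> v"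
        using ab pv by (simp add: K.m_comm closed)
    qed
    also have "\<dots> = \<mu> \<one> (?m a y) \<otimes>\<^bsub>K\<^esub> f b"
      by (rule counit_right[OF one_closed y]) (intro intros closed ab one_closed)
    finally show "sweedler K (?D y) (\<lambda>c d. sweedler K (?D c) (\<lambda>p q. \<mu> \<one> (?m a p) \<otimes>\<^bsub>K\<^esub> f (?m (?m b q) (S \<one> d)))) =
      \<mu> \<one> (?m a y) \<otimes>\<^bsub>K\<^esub> f b" .
  qed
  finally show ?thesis by simp
qed

lemma comult_one_mem:
  assumes "(a, b) \<in> set (D \<one> \<one> x)" "x \<in> carrier (H \<one>)"
  shows "a \<in> carrier (H \<one>)" "b \<in> carrier (H \<one>)"
  using comult_mem[OF assms(1)] assms(2) by auto

text \<open>
  If \<open>\<mu>\<^sub>1 = 0\<close>, then \<open>\<mu>\<^sub>\<alpha>(x) 1 = \<mu>\<^sub>1(x\<^sub>1) x\<^sub>2 = 0\<close>; so either \<open>\<mu>\<^sub>\<alpha>(x) = 0\<close>, or \<open>1 = 0\<close> in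
  \<open>H\<^sub>\<alpha>\<close> and the algebra is zero.
\<close>

lemma integral_one_nonzero:
  assumes mu: "right_integral \<mu>" and \<alpha>: "\<alpha> \<in> carrier G" and x: "x \<in> carrier (H \<alpha>)" "\<mu> \<alpha> x \<noteq> \<zero>\<^bsub>K\<^esub>"
  shows "\<exists>y\<in>carrier (H \<one>). \<mu> \<one> y \<noteq> \<zero>\<^bsub>K\<^esub>"
proof (rule ccontr)
  assume "\<not> ?thesis"
  then have zero: "\<mu> \<one> y = \<zero>\<^bsub>K\<^esub>" if "y \<in> carrier (H \<one>)" for y using that by blast
  interpret V: vectorspace K "H \<alpha>" using H_vectorspace[OF \<alpha>] .
  have "q \<one>\<^bsub>H \<alpha>\<^esub> = \<zero>\<^bsub>K\<^esub>" if q: "functional \<alpha> q" for q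
  proof -
    have "\<mu> \<alpha> x \<otimes>\<^bsub>K\<^esub> q \<one>\<^bsub>H \<alpha>\<^esub> = sweedler K (D \<one> \<alpha> x) (\<lambda>a b. \<mu> \<one> a \<otimes>\<^bsub>K\<^esub> q b)"
      using right_integralD[OF mu one_closed \<alpha> _ q, of x] x \<alpha> by simp
    also have "\<dots> = \<zero>\<^bsub>K\<^esub>"
      using comult_mem[of _ _ \<one> \<alpha> x] \<alpha> x functional_closed[OF q]
      by (intro K.sweedler_zero) (simp add: zero)
    finally show ?thesis
      using x functional_closed[OF right_integral_functional[OF mu \<alpha>] x(1)]
        functional_closed[OF q H_one_closed[OF \<alpha>]] by (simp add: K.integral_iff)
  qed
  then have "\<one>\<^bsub>H \<alpha>\<^esub> = \<zero>\<^bsub>H \<alpha>\<^esub>"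
    by (rule V.functional_eq_zero[OF finite_dimensional[OF \<alpha>] H_one_closed[OF \<alpha>]])
  then have "x = \<zero>\<^bsub>H \<alpha>\<^esub>"
    using ring.ring_simprules(24)[OF H_ring[OF \<alpha>] x(1)] H_one_left[OF \<alpha> x(1)] by simp
  moreover have "\<mu> \<alpha> \<zero>\<^bsub>H \<alpha>\<^esub> = \<zero>\<^bsub>K\<^esub>"
  proof -
    have "\<mu> \<alpha> (\<zero>\<^bsub>K\<^esub> \<odot>\<^bsub>H \<alpha>\<^esub> \<zero>\<^bsub>H \<alpha>\<^esub>) = \<zero>\<^bsub>K\<^esub> \<otimes>\<^bsub>K\<^esub> \<mu> \<alpha> \<zero>\<^bsub>H \<alpha>\<^esub>"
      by (subst module_hom_smult[OF right_integral_functional[OF mu \<alpha>]]) auto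
    then show ?thesis
      using functional_closed[OF right_integral_functional[OF mu \<alpha>] V.M.zero_closed] by simp
  qed
  ultimately show False using x(2) by simp
qed

lemma functional_expand:
  assumes "\<alpha> \<in> carrier G" "functional \<alpha> f" "v \<in> carrier (H \<alpha>)"
    and "\<And>e \<phi>. (e, \<phi>) \<in> set P \<Longrightarrow> e \<in> carrier (H \<alpha>) \<and> functional \<alpha> \<phi>"
    and "v = lsum (H \<alpha>) (\<lambda>(e, \<phi>). \<phi> v \<odot>\<^bsub>H \<alpha>\<^esub> e) P"
  shows "f v = lsum K (\<lambda>p. snd p v \<otimes>\<^bsub>K\<^esub> f (fst p)) P"
proof -
  interpret V: vectorspace K "H \<alpha>" using H_vectorspace[OF assms(1)] .
  have mem: "fst p \<in> carrier (H \<alpha>) \<and> snd p v \<in> carrier K" if "p \<in> set P" for p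
    using assms(4)[of "fst p" "snd p"] that functional_closed[OF _ assms(3)] by auto
  have "f v = f (lsum (H \<alpha>) (\<lambda>p. snd p v \<odot>\<^bsub>H \<alpha>\<^esub> fst p) P)"
    using assms(5) by (simp add: case_prod_unfold)
  also have "\<dots> = lsum (scalar_space K) (\<lambda>p. f (snd p v \<odot>\<^bsub>H \<alpha>\<^esub> fst p)) P"
    using mem by (intro module_hom_lsum[OF H_module[OF assms(1)] scalar_space_module[OF K.field_axioms] assms(2)]) auto
  also have "\<dots> = lsum K (\<lambda>p. snd p v \<otimes>\<^bsub>K\<^esub> f (fst p)) P"
    unfolding lsum_scalar_space
    by (rule lsum_cong) (use mem module_hom_smult[OF assms(2)] in auto)
  finally show ?thesis .
qed

text \<open>
  Let \<open>\<lambda> = \<mu>\<^sub>1\<close>.  By the translation formula, \<open>\<lambda>(x _) = 0\<close> implies \<open>\<lambda>(x\<^sub>1 w) x\<^sub>2 = 0\<close> for every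
  \<open>w\<close>.  In \<open>\<lambda>(x\<^sub>1 S(x\<^sub>2) y) x\<^sub>3 = \<lambda>(y) x\<close> the factor \<open>S(x\<^sub>2) y\<close> can be expanded in a basis, which
  turns the left-hand side into a combination of such vanishing terms.  Hence \<open>\<lambda>(y) x = 0\<close> for
  all \<open>y\<close>, and \<open>\<lambda> \<noteq> 0\<close>.
\<close>

lemma integral_kernel_trivial:
  assumes mu: "right_integral \<mu>" and nz: "\<exists>y\<in>carrier (H \<one>). \<mu> \<one> y \<noteq> \<zero>\<^bsub>K\<^esub>"
    and x: "x \<in> carrier (H \<one>)" and ker: "\<And>y. y \<in> carrier (H \<one>) \<Longrightarrow> \<mu> \<one> (x \<otimes>\<^bsub>H \<one>\<^esub> y) = \<zero>\<^bsub>K\<^esub>"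
  shows "x = \<zero>\<^bsub>H \<one>\<^esub>"
proof -
  let ?m = "\<lambda>x y. x \<otimes>\<^bsub>H \<one>\<^esub> y" and ?D = "D \<one> \<one>"
  interpret V: vectorspace K "H \<one>" using H_vectorspace[OF one_closed] .
  note lam = right_integral_functional[OF mu one_closed]
  note mem = comult_one_mem
  have S: "S \<one> z \<in> carrier (H \<one>)" if "z \<in> carrier (H \<one>)" for z
    using antipode_closed[OF one_closed that] by simp
  obtain P where P: "\<And>e \<phi>. (e, \<phi>) \<in> set P \<Longrightarrow> e \<in> carrier (H \<one>) \<and> functional \<one> \<phi>"
    "\<And>v. v \<in> carrier (H \<one>) \<Longrightarrow> v = lsum (H \<one>) (\<lambda>(e, \<phi>). \<phi> v \<odot>\<^bsub>H \<one>\<^esub> e) P"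
    using V.coordinate_system[OF finite_dimensional[OF one_closed]] by blast
  have vanish: "sweedler K (?D x) (\<lambda>a b. \<mu> \<one> (?m a w) \<otimes>\<^bsub>K\<^esub> q b) = \<zero>\<^bsub>K\<^esub>"
    if w: "w \<in> carrier (H \<one>)" and q: "functional \<one> q" for w q
  proof -
    have "sweedler K (?D w) (\<lambda>c d. \<mu> \<one> (?m x c) \<otimes>\<^bsub>K\<^esub> q (S \<one> d)) = \<zero>\<^bsub>K\<^esub>"
      by (rule K.sweedler_zero) (use mem[OF _ w] functional_closed[OF q] S ker in auto)
    then show ?thesis using integral_translate[OF mu x w q] by simp
  qed
  obtain y where y: "y \<in> carrier (H \<one>)" "\<mu> \<one> y \<noteq> \<zero>\<^bsub>K\<^esub>" using nz by blast
  have "f x = \<zero>\<^bsub>K\<^esub>" if f: "functional \<one> f" for f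
  proof -
    note comp = functional_comp[OF lam] functional_comp[OF f]
    note intros = linear_intros comp linear_antipode[of \<one>, simplified]
    note closed = functional_closed[OF lam] functional_closed[OF f] S H_mult_closed x y(1)
      functional_closed[OF counit_linear] H_one_closed
    let ?q = "\<lambda>\<phi> v. sweedler K (?D v) (\<lambda>b c. \<phi> (?m (S \<one> b) y) \<otimes>\<^bsub>K\<^esub> f c)"
    have q: "functional \<one> (?q \<phi>)" if \<phi>: "functional \<one> \<phi>" for \<phi>
    proof -
      have "bilinear K (H \<one>) (H \<one>) (scalar_space K) (\<lambda>b c. \<phi> (?m (S \<one> b) y) \<otimes>\<^bsub>K\<^esub> f c)"
        by (intro bilinearI intros functional_comp[OF \<phi>] closed functional_closed[OF \<phi>] one_closed f)
      from functional_sweedler_arg[OF one_closed one_closed this, where \<gamma> = \<one> and h = "\<lambda>x. x"] show ?thesis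
        by (simp add: linear_id)
    qed
    \<comment> \<open>Evaluate \<open>\<lambda>(x\<^sub>1 S(x\<^sub>2) y) f(x\<^sub>3)\<close> with both bracketings of the iterated coproduct: one collapses by the
      antipode axiom, the other vanishes after expanding \<open>S(x\<^sub>2) y\<close> in the basis.\<close>
    have "trilinear K (H \<one>) (H \<one>) (H \<one>) (\<lambda>a b c. \<mu> \<one> (?m a (?m (S \<one> b) y)) \<otimes>\<^bsub>K\<^esub> f c)"
      by (intro trilinearI intros closed one_closed f)
    from coassoc[OF one_closed one_closed one_closed _ this, of x]
    have "sweedler K (?D x) (\<lambda>u c. sweedler K (?D u) (\<lambda>a b. \<mu> \<one> (?m a (?m (S \<one> b) y)) \<otimes>\<^bsub>K\<^esub> f c)) =
      sweedler K (?D x) (\<lambda>a v. sweedler K (?D v) (\<lambda>b c. \<mu> \<one> (?m a (?m (S \<one> b) y)) \<otimes>\<^bsub>K\<^esub> f c))"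
      using x by simp
    moreover have "sweedler K (?D x) (\<lambda>u c. sweedler K (?D u) (\<lambda>a b. \<mu> \<one> (?m a (?m (S \<one> b) y)) \<otimes>\<^bsub>K\<^esub> f c)) =
      \<mu> \<one> y \<otimes>\<^bsub>K\<^esub> f x"
    proof -
      have "sweedler K (?D u) (\<lambda>a b. \<mu> \<one> (?m a (?m (S \<one> b) y)) \<otimes>\<^bsub>K\<^esub> f c) = \<epsilon> u \<otimes>\<^bsub>K\<^esub> (\<mu> \<one> y \<otimes>\<^bsub>K\<^esub> f c)"
        if "(u, c) \<in> set (?D x)" for u c
      proof -
        note uc = mem[OF that x]
        have "functional \<one> (\<lambda>z. \<mu> \<one> (?m z y) \<otimes>\<^bsub>K\<^esub> f c)"
          by (intro intros closed uc one_closed)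
        from antipode_right[OF one_closed uc(1) this]
        have "sweedler K (?D u) (\<lambda>a b. \<mu> \<one> (?m (?m a (S \<one> b)) y) \<otimes>\<^bsub>K\<^esub> f c) = \<epsilon> u \<otimes>\<^bsub>K\<^esub> (\<mu> \<one> y \<otimes>\<^bsub>K\<^esub> f c)"
          using y by (simp add: H_simps)
        moreover have "sweedler K (?D u) (\<lambda>a b. \<mu> \<one> (?m (?m a (S \<one> b)) y) \<otimes>\<^bsub>K\<^esub> f c) =
            sweedler K (?D u) (\<lambda>a b. \<mu> \<one> (?m a (?m (S \<one> b) y)) \<otimes>\<^bsub>K\<^esub> f c)"
          by (rule sweedler_cong) (use mem[OF _ uc(1)] y in \<open>simp add: H_simps S\<close>)
        ultimately show ?thesis by simp
      qed
      then have "sweedler K (?D x) (\<lambda>u c. sweedler K (?D u) (\<lambda>a b. \<mu> \<one> (?m a (?m (S \<one> b) y)) \<otimes>\<^bsub>K\<^esub> f c)) =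
        sweedler K (?D x) (\<lambda>u c. \<epsilon> u \<otimes>\<^bsub>K\<^esub> (\<mu> \<one> y \<otimes>\<^bsub>K\<^esub> f c))" by (rule sweedler_cong)
      also have "\<dots> = \<mu> \<one> y \<otimes>\<^bsub>K\<^esub> f x"
        by (rule counit_left[OF one_closed x]) (intro intros closed f)
      finally show ?thesis .
    qed
    moreover have "sweedler K (?D x) (\<lambda>a v. sweedler K (?D v) (\<lambda>b c. \<mu> \<one> (?m a (?m (S \<one> b) y)) \<otimes>\<^bsub>K\<^esub> f c)) = \<zero>\<^bsub>K\<^esub>"
    proof -
      have Pmem: "fst p \<in> carrier (H \<one>)" "functional \<one> (snd p)" if "p \<in> set P" for p
        using P(1)[of "fst p" "snd p"] that by auto
      have "sweedler K (?D v) (\<lambda>b c. \<mu> \<one> (?m a (?m (S \<one> b) y)) \<otimes>\<^bsub>K\<^esub> f c) =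
        lsum K (\<lambda>p. \<mu> \<one> (?m a (fst p)) \<otimes>\<^bsub>K\<^esub> ?q (snd p) v) P" if "(a, v) \<in> set (?D x)" for a v
      proof -
        note av = mem[OF that x]
        have "sweedler K (?D v) (\<lambda>b c. \<mu> \<one> (?m a (?m (S \<one> b) y)) \<otimes>\<^bsub>K\<^esub> f c) =
          sweedler K (?D v) (\<lambda>b c. lsum K (\<lambda>p. \<mu> \<one> (?m a (fst p)) \<otimes>\<^bsub>K\<^esub> (snd p (?m (S \<one> b) y) \<otimes>\<^bsub>K\<^esub> f c)) P)"
        proof (rule sweedler_cong)
          fix b c assume "(b, c) \<in> set (?D v)"
          note bc = mem[OF this av(2)]
          have z: "?m (S \<one> b) y \<in> carrier (H \<one>)" using bc by (simp add: closed)
          have pc: "snd p (?m (S \<one> b) y) \<in> carrier K" if "p \<in> set P" for p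
            using functional_closed[OF Pmem(2)[OF that] z] .
          have "functional \<one> (\<lambda>z. \<mu> \<one> (?m a z) \<otimes>\<^bsub>K\<^esub> f c)" by (intro intros closed av bc one_closed)
          from functional_expand[OF one_closed this z P(1) P(2)[OF z]]
          have "\<mu> \<one> (?m a (?m (S \<one> b) y)) \<otimes>\<^bsub>K\<^esub> f c =
            lsum K (\<lambda>p. snd p (?m (S \<one> b) y) \<otimes>\<^bsub>K\<^esub> (\<mu> \<one> (?m a (fst p)) \<otimes>\<^bsub>K\<^esub> f c)) P" by simp
          also have "\<dots> = lsum K (\<lambda>p. \<mu> \<one> (?m a (fst p)) \<otimes>\<^bsub>K\<^esub> (snd p (?m (S \<one> b) y) \<otimes>\<^bsub>K\<^esub> f c)) P"
            by (rule lsum_cong) (use pc Pmem av bc in \<open>simp add: closed K.m_lcomm\<close>)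
          finally show "\<mu> \<one> (?m a (?m (S \<one> b) y)) \<otimes>\<^bsub>K\<^esub> f c =
            lsum K (\<lambda>p. \<mu> \<one> (?m a (fst p)) \<otimes>\<^bsub>K\<^esub> (snd p (?m (S \<one> b) y) \<otimes>\<^bsub>K\<^esub> f c)) P" .
        qed
        also have "\<dots> = lsum K (\<lambda>p. sweedler K (?D v) (\<lambda>b c. \<mu> \<one> (?m a (fst p)) \<otimes>\<^bsub>K\<^esub>
            (snd p (?m (S \<one> b) y) \<otimes>\<^bsub>K\<^esub> f c))) P"
          by (rule K.sweedler_lsum) (use mem[OF _ av(2)] Pmem av functional_closed[OF Pmem(2)] in \<open>simp add: closed\<close>)
        also have "\<dots> = lsum K (\<lambda>p. \<mu> \<one> (?m a (fst p)) \<otimes>\<^bsub>K\<^esub> ?q (snd p) v) P"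
          by (intro lsum_cong K.sweedler_scale)
            (use mem[OF _ av(2)] Pmem av functional_closed[OF Pmem(2)] in \<open>simp_all add: closed\<close>)
        finally show ?thesis .
      qed
      then have "sweedler K (?D x) (\<lambda>a v. sweedler K (?D v) (\<lambda>b c. \<mu> \<one> (?m a (?m (S \<one> b) y)) \<otimes>\<^bsub>K\<^esub> f c)) =
          sweedler K (?D x) (\<lambda>a v. lsum K (\<lambda>p. \<mu> \<one> (?m a (fst p)) \<otimes>\<^bsub>K\<^esub> ?q (snd p) v) P)"
        by (rule sweedler_cong)
      also have "\<dots> = lsum K (\<lambda>p. sweedler K (?D x) (\<lambda>a v. \<mu> \<one> (?m a (fst p)) \<otimes>\<^bsub>K\<^esub> ?q (snd p) v)) P"
        by (rule K.sweedler_lsum) (use mem[OF _ x] Pmem functional_closed[OF q[OF Pmem(2)]] in \<open>simp add: closed\<close>)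
      also have "\<dots> = lsum K (\<lambda>p. \<zero>\<^bsub>K\<^esub>) P"
        by (rule lsum_cong) (use vanish q Pmem in auto)
      finally show ?thesis by (simp add: K.lsum_zero)
    qed
    ultimately have "\<mu> \<one> y \<otimes>\<^bsub>K\<^esub> f x = \<zero>\<^bsub>K\<^esub>" by simp
    then show ?thesis using y functional_closed[OF lam y(1)] functional_closed[OF f x]
      by (simp add: K.integral_iff)
  qed
  then show ?thesis by (rule V.functional_eq_zero[OF finite_dimensional[OF one_closed] x])
qed

lemma functional_minus:
  assumes "functional \<alpha> f" "\<alpha> \<in> carrier G" "x \<in> carrier (H \<alpha>)" "y \<in> carrier (H \<alpha>)" "f x = f y"
  shows "f (x \<ominus>\<^bsub>H \<alpha>\<^esub> y) = \<zero>\<^bsub>K\<^esub>"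
proof -
  interpret f: mod_hom K "H \<alpha>" "scalar_space K" f
    using assms H_module scalar_space_module[OF K.field_axioms]
    by (simp add: mod_hom_def mod_hom_axioms_def)
  have "f (x \<ominus>\<^bsub>H \<alpha>\<^esub> y) = f x \<ominus>\<^bsub>scalar_space K\<^esub> f x" using f.f_minus assms(3-5) by simp
  also have "\<dots> = \<zero>\<^bsub>scalar_space K\<^esub>"
    using f.N.M.r_neg[of "f x"] functional_closed[OF assms(1,3)] by (simp add: a_minus_def)
  finally show ?thesis by simp
qed

lemma diff_eq_zero:
  assumes "\<alpha> \<in> carrier G" "x \<in> carrier (H \<alpha>)" "y \<in> carrier (H \<alpha>)" "x \<ominus>\<^bsub>H \<alpha>\<^esub> y = \<zero>\<^bsub>H \<alpha>\<^esub>"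
  shows "x = y"
proof -
  interpret ring "H \<alpha>" by (rule H_ring[OF assms(1)])
  show ?thesis using assms(2-4) by simp
qed

lemma functionals_separate:
  assumes "\<alpha> \<in> carrier G" "x \<in> carrier (H \<alpha>)" "y \<in> carrier (H \<alpha>)"
    and "\<And>f. functional \<alpha> f \<Longrightarrow> f x = f y"
  shows "x = y"
proof (rule diff_eq_zero[OF assms(1-3)])
  interpret V: vectorspace K "H \<alpha>" using H_vectorspace[OF assms(1)] .
  show "x \<ominus>\<^bsub>H \<alpha>\<^esub> y = \<zero>\<^bsub>H \<alpha>\<^esub>"
  proof (rule V.functional_eq_zero[OF finite_dimensional[OF assms(1)]])
    show "x \<ominus>\<^bsub>H \<alpha>\<^esub> y \<in> carrier (H \<alpha>)" using assms by simp
    show "\<phi> (x \<ominus>\<^bsub>H \<alpha>\<^esub> y) = \<zero>\<^bsub>K\<^esub>" if "functional \<alpha> \<phi>" for \<phi>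
      by (rule functional_minus[OF that assms(1-3) assms(4)[OF that]])
  qed
qed

lemma integral_bilinear:
  assumes mu: "right_integral \<mu>" and \<alpha>: "\<alpha> \<in> carrier G"
  shows "bilinear K (H \<alpha>) (H \<alpha>) (scalar_space K) (\<lambda>x y. \<mu> \<alpha> (x \<otimes>\<^bsub>H \<alpha>\<^esub> y))"
  by (intro bilinearI functional_comp[OF right_integral_functional[OF mu \<alpha>]] linear_intros \<alpha>)

text \<open>
  Any \<open>\<Lambda>\<close> with \<open>\<mu>\<^sub>1(\<Lambda> y) = \<epsilon>(y)\<close> works: \<open>\<Lambda> h\<close> and \<open>\<epsilon>(h) \<Lambda>\<close> define the same functional,
  so they agree by the triviality of the kernel.
\<close>

lemma right_cointegral_ex:
  assumes mu: "right_integral \<mu>" and nz: "\<exists>y\<in>carrier (H \<one>). \<mu> \<one> y \<noteq> \<zero>\<^bsub>K\<^esub>"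
  obtains \<Lambda> where "\<Lambda> \<in> right_cointegrals (H \<one>) \<epsilon>" "\<mu> \<one> \<Lambda> = \<one>\<^bsub>K\<^esub>"
proof -
  interpret V: vectorspace K "H \<one>" using H_vectorspace[OF one_closed] .
  note lam = right_integral_functional[OF mu one_closed]
  have "\<exists>z\<in>carrier (H \<one>). \<forall>y\<in>carrier (H \<one>). \<mu> \<one> (z \<otimes>\<^bsub>H \<one>\<^esub> y) = \<epsilon> y"
    using V.functional_represented[OF finite_dimensional[OF one_closed] integral_bilinear[OF mu one_closed]
        integral_kernel_trivial[OF mu nz] counit_linear] by blast
  then obtain \<Lambda> where \<Lambda>: "\<Lambda> \<in> carrier (H \<one>)"
    "\<And>y. y \<in> carrier (H \<one>) \<Longrightarrow> \<mu> \<one> (\<Lambda> \<otimes>\<^bsub>H \<one>\<^esub> y) = \<epsilon> y" by blast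
  have "\<Lambda> \<otimes>\<^bsub>H \<one>\<^esub> h = \<epsilon> h \<odot>\<^bsub>H \<one>\<^esub> \<Lambda>" if h: "h \<in> carrier (H \<one>)" for h
  proof -
    have \<epsilon>h: "\<epsilon> h \<in> carrier K" using functional_closed[OF counit_linear h] .
    then have c: "\<Lambda> \<otimes>\<^bsub>H \<one>\<^esub> h \<in> carrier (H \<one>)" "\<epsilon> h \<odot>\<^bsub>H \<one>\<^esub> \<Lambda> \<in> carrier (H \<one>)"
      using h \<Lambda>(1) by (simp_all add: H_simps)
    have "\<mu> \<one> ((\<Lambda> \<otimes>\<^bsub>H \<one>\<^esub> h \<ominus>\<^bsub>H \<one>\<^esub> \<epsilon> h \<odot>\<^bsub>H \<one>\<^esub> \<Lambda>) \<otimes>\<^bsub>H \<one>\<^esub> y) = \<zero>\<^bsub>K\<^esub>"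
      if y: "y \<in> carrier (H \<one>)" for y
    proof -
      have "functional \<one> (\<lambda>x. \<mu> \<one> (x \<otimes>\<^bsub>H \<one>\<^esub> y))"
        by (intro functional_comp[OF lam] linear_intros y one_closed)
      moreover have "\<mu> \<one> (\<Lambda> \<otimes>\<^bsub>H \<one>\<^esub> h \<otimes>\<^bsub>H \<one>\<^esub> y) = \<epsilon> h \<otimes>\<^bsub>K\<^esub> \<epsilon> y"
        using h y \<Lambda> by (simp add: H_simps counit_mult)
      moreover have "\<mu> \<one> (\<epsilon> h \<odot>\<^bsub>H \<one>\<^esub> \<Lambda> \<otimes>\<^bsub>H \<one>\<^esub> y) = \<epsilon> h \<otimes>\<^bsub>K\<^esub> \<epsilon> y"
        using y \<Lambda> \<epsilon>h unital_algebra.smult_mult_left[OF algebras[OF one_closed] \<epsilon>h \<Lambda>(1) y]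
          module_hom_smult[OF lam \<epsilon>h, of "\<Lambda> \<otimes>\<^bsub>H \<one>\<^esub> y"] by (simp add: H_simps)
      ultimately show ?thesis
        using functional_minus[OF _ one_closed c, of "\<lambda>x. \<mu> \<one> (x \<otimes>\<^bsub>H \<one>\<^esub> y)"] by simp
    qed
    moreover have "\<Lambda> \<otimes>\<^bsub>H \<one>\<^esub> h \<ominus>\<^bsub>H \<one>\<^esub> \<epsilon> h \<odot>\<^bsub>H \<one>\<^esub> \<Lambda> \<in> carrier (H \<one>)" using c by simp
    ultimately have "\<Lambda> \<otimes>\<^bsub>H \<one>\<^esub> h \<ominus>\<^bsub>H \<one>\<^esub> \<epsilon> h \<odot>\<^bsub>H \<one>\<^esub> \<Lambda> = \<zero>\<^bsub>H \<one>\<^esub>"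
      by (intro integral_kernel_trivial[OF mu nz]) auto
    then show ?thesis by (rule diff_eq_zero[OF one_closed c])
  qed
  moreover have "\<mu> \<one> \<Lambda> = \<one>\<^bsub>K\<^esub>"
    using \<Lambda>(2)[OF H_one_closed[OF one_closed]] \<Lambda>(1) by (simp add: H_simps counit_one)
  ultimately show ?thesis using that \<Lambda>(1) by (auto simp: right_cointegrals_def)
qed

text \<open>
  Since \<open>\<epsilon>(h\<^sub>2) \<Lambda> = h\<^sub>2 \<Lambda>\<close>, the tensor \<open>S(h) \<Lambda>\<^sub>1 \<otimes> \<Lambda>\<^sub>2\<close> equals
  \<open>S(h\<^sub>1) h\<^sub>2 \<Lambda>\<^sub>1 \<otimes> h\<^sub>3 \<Lambda>\<^sub>2\<close>; the first two factors collapse to the counit, which leaves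
  \<open>\<Lambda>\<^sub>1 \<otimes> h \<Lambda>\<^sub>2\<close>.  The functionals \<open>p\<close> and \<open>f\<close> test this identity.
\<close>

lemma left_cointegral_translate:
  assumes \<Lambda>: "\<Lambda> \<in> left_cointegrals (H \<one>) \<epsilon>" and \<alpha>: "\<alpha> \<in> carrier G" and h: "h \<in> carrier (H \<alpha>)"
    and p: "functional (inv \<alpha>) p" and f: "functional \<alpha> f"
  shows "sweedler K (D (inv \<alpha>) \<alpha> \<Lambda>) (\<lambda>a b. p a \<otimes>\<^bsub>K\<^esub> f (h \<otimes>\<^bsub>H \<alpha>\<^esub> b)) =
    sweedler K (D (inv \<alpha>) \<alpha> \<Lambda>) (\<lambda>a b. p (S \<alpha> h \<otimes>\<^bsub>H (inv \<alpha>)\<^esub> a) \<otimes>\<^bsub>K\<^esub> f b)"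
proof -
  let ?i = "inv \<alpha>"
  let ?m = "\<lambda>x y. x \<otimes>\<^bsub>H \<alpha>\<^esub> y" and ?n = "\<lambda>x y. x \<otimes>\<^bsub>H (inv \<alpha>)\<^esub> y"
  let ?s = "\<lambda>z. sweedler K (D ?i \<alpha> z)"
  have i: "?i \<in> carrier G" using \<alpha> by simp
  have \<Lambda>c: "\<Lambda> \<in> carrier (H \<one>)" and \<Lambda>l: "x \<in> carrier (H \<one>) \<Longrightarrow> x \<otimes>\<^bsub>H \<one>\<^esub> \<Lambda> = \<epsilon> x \<odot>\<^bsub>H \<one>\<^esub> \<Lambda>" for x
    using \<Lambda> by (auto simp: left_cointegrals_def)
  have mem: "a \<in> carrier (H ?i)" "b \<in> carrier (H \<alpha>)"
    if "(a, b) \<in> set (D ?i \<alpha> z)" "z \<in> carrier (H \<one>)" for a b z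
    using comult_mem[OF that(1) i \<alpha>] that(2) \<alpha> by auto
  note S = antipode_closed[OF \<alpha>]
  note comp = functional_comp[OF p] functional_comp[OF f]
  note intros = linear_intros comp
  note closed = functional_closed[OF p] functional_closed[OF f] S H_mult_closed h i \<alpha>
    functional_closed[OF counit_linear] H_one_closed
  let ?T = "\<lambda>k a b. ?s \<Lambda> (\<lambda>u v. p (?n (S \<alpha> k) (?n a u)) \<otimes>\<^bsub>K\<^esub> f (?m b v))"
  have tri: "trilinear K (H \<alpha>) (H ?i) (H \<alpha>) ?T"
    by (intro trilinearI functional_sweedler_param intros closed; (drule mem[OF _ \<Lambda>c])?; simp add: closed)
  have bil: "bilinear K (H ?i) (H \<alpha>) (scalar_space K) (\<lambda>u v. p (?n (S \<alpha> k) u) \<otimes>\<^bsub>K\<^esub> f v)"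
    if "k \<in> carrier (H \<alpha>)" for k
    by (intro bilinearI intros closed f that)
  have "functional \<alpha> (\<lambda>k. ?s \<Lambda> (\<lambda>u v. p (?n (S \<alpha> k) u) \<otimes>\<^bsub>K\<^esub> f v))"
    by (intro functional_sweedler_param intros closed mem[OF _ \<Lambda>c])
  \<comment> \<open>Split off a factor \<open>\<epsilon>(h\<^sub>2)\<close>, which the cointegral absorbs as \<open>h\<^sub>2 \<Lambda>\<close>.\<close>
  from counit_right[OF \<alpha> h this]
  have "?s \<Lambda> (\<lambda>u v. p (?n (S \<alpha> h) u) \<otimes>\<^bsub>K\<^esub> f v) =
    sweedler K (D \<alpha> \<one> h) (\<lambda>k l. ?s \<Lambda> (\<lambda>u v. p (?n (S \<alpha> k) u) \<otimes>\<^bsub>K\<^esub> f v) \<otimes>\<^bsub>K\<^esub> \<epsilon> l)" by simp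
  also have "\<dots> = sweedler K (D \<alpha> \<one> h) (\<lambda>k l. ?s l (\<lambda>a b. ?T k a b))"
  proof (rule sweedler_cong)
    fix k l assume "(k, l) \<in> set (D \<alpha> \<one> h)"
    then have kl: "k \<in> carrier (H \<alpha>)" "l \<in> carrier (H \<one>)" using comult_mem[of k l \<alpha> \<one> h] \<alpha> h by auto
    let ?B = "\<lambda>u v. p (?n (S \<alpha> k) u) \<otimes>\<^bsub>K\<^esub> f v"
    have lin: "functional \<one> (\<lambda>z. ?s z ?B)"
      using comult_linear[OF i \<alpha> bil[OF kl(1)]] \<alpha> by simp
    have "?s \<Lambda> ?B \<otimes>\<^bsub>K\<^esub> \<epsilon> l = \<epsilon> l \<otimes>\<^bsub>K\<^esub> ?s \<Lambda> ?B"
      using functional_closed[OF lin \<Lambda>c] functional_closed[OF counit_linear kl(2)] by (simp add: K.m_comm)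
    also have "\<dots> = ?s (\<epsilon> l \<odot>\<^bsub>H \<one>\<^esub> \<Lambda>) ?B"
      using module_hom_smult[OF lin functional_closed[OF counit_linear kl(2)] \<Lambda>c] by simp
    also have "\<dots> = ?s (l \<otimes>\<^bsub>H \<one>\<^esub> \<Lambda>) ?B" using \<Lambda>l kl by simp
    also have "\<dots> = ?s l (\<lambda>a b. ?s \<Lambda> (\<lambda>u v. ?B (?n a u) (?m b v)))"
      using comult_mult[OF i \<alpha> _ _ bil[OF kl(1)], of l \<Lambda>] \<alpha> kl \<Lambda>c by simp
    finally show "?s \<Lambda> ?B \<otimes>\<^bsub>K\<^esub> \<epsilon> l = ?s l (\<lambda>a b. ?T k a b)" .
  qed
  \<comment> \<open>Coassociativity brings \<open>S(h\<^sub>1)\<close> and \<open>h\<^sub>2\<close> together.\<close>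
  also have "\<dots> = sweedler K (D \<one> \<alpha> h) (\<lambda>w b. sweedler K (D \<alpha> ?i w) (\<lambda>k a. ?T k a b))"
    using coassoc[OF \<alpha> i \<alpha> _ tri, of h] \<alpha> h by simp
  also have "\<dots> = sweedler K (D \<one> \<alpha> h) (\<lambda>w b. \<epsilon> w \<otimes>\<^bsub>K\<^esub> ?s \<Lambda> (\<lambda>u v. p u \<otimes>\<^bsub>K\<^esub> f (?m b v)))"
  proof (rule sweedler_cong)
    fix w b assume "(w, b) \<in> set (D \<one> \<alpha> h)"
    then have wb: "w \<in> carrier (H \<one>)" "b \<in> carrier (H \<alpha>)" using comult_mem[of w b \<one> \<alpha> h] \<alpha> h by auto
    let ?F = "\<lambda>z. ?s \<Lambda> (\<lambda>u v. p (?n z u) \<otimes>\<^bsub>K\<^esub> f (?m b v))"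
    have "functional ?i ?F"
      by (intro functional_sweedler_param intros closed mem[OF _ \<Lambda>c] wb)
    from antipode_left[OF i wb(1) this]
    have "sweedler K (D \<alpha> ?i w) (\<lambda>k a. ?F (?n (S \<alpha> k) a)) = \<epsilon> w \<otimes>\<^bsub>K\<^esub> ?F \<one>\<^bsub>H ?i\<^esub>"
      using \<alpha> by simp
    moreover have "?F \<one>\<^bsub>H ?i\<^esub> = ?s \<Lambda> (\<lambda>u v. p u \<otimes>\<^bsub>K\<^esub> f (?m b v))"
      by (rule sweedler_cong) (use mem[OF _ \<Lambda>c] i in \<open>simp add: H_one_left\<close>)
    moreover have "sweedler K (D \<alpha> ?i w) (\<lambda>k a. ?F (?n (S \<alpha> k) a)) = sweedler K (D \<alpha> ?i w) (\<lambda>k a. ?T k a b)"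
    proof (intro sweedler_cong)
      fix k a u v assume "(k, a) \<in> set (D \<alpha> ?i w)" "(u, v) \<in> set (D ?i \<alpha> \<Lambda>)"
      then have "k \<in> carrier (H \<alpha>)" "a \<in> carrier (H ?i)" "u \<in> carrier (H ?i)"
        using comult_mem[of k a \<alpha> ?i w] mem[OF _ \<Lambda>c] wb \<alpha> by auto
      then show "p (?n (?n (S \<alpha> k) a) u) \<otimes>\<^bsub>K\<^esub> f (?m b v) = p (?n (S \<alpha> k) (?n a u)) \<otimes>\<^bsub>K\<^esub> f (?m b v)"
        using i by (simp add: H_mult_assoc S)
    qed
    ultimately show "sweedler K (D \<alpha> ?i w) (\<lambda>k a. ?T k a b) = \<epsilon> w \<otimes>\<^bsub>K\<^esub> ?s \<Lambda> (\<lambda>u v. p u \<otimes>\<^bsub>K\<^esub> f (?m b v))"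
      by simp
  qed
  also have "\<dots> = ?s \<Lambda> (\<lambda>u v. p u \<otimes>\<^bsub>K\<^esub> f (?m h v))"
    by (rule counit_left[OF \<alpha> h]) (intro functional_sweedler_param intros closed mem[OF _ \<Lambda>c])
  finally show ?thesis by simp
qed

end

section \<open>The opposite coalgebra\<close>

text \<open>
  Used for the group as well as for the algebras, whose record type extends that of monoids.
\<close>

definition opposite :: "('a, 'm) monoid_scheme \<Rightarrow> ('a, 'm) monoid_scheme" where
  "opposite M = M\<lparr>mult := \<lambda>x y. y \<otimes>\<^bsub>M\<^esub> x\<rparr>"

lemma opposite_simps [simp]:
  "carrier (opposite M) = carrier M" "one (opposite M) = one M"
  "x \<otimes>\<^bsub>opposite M\<^esub> y = y \<otimes>\<^bsub>M\<^esub> x" 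
  by (simp_all add: opposite_def)

lemma opposite_module_simps [simp]:
  fixes A :: "('k, 'a, 'm) module_scheme"
  shows "zero (opposite A) = zero A" "add (opposite A) = add A" "smult (opposite A) = smult A"
    "add_monoid (opposite A) = add_monoid A"
  by (simp_all add: opposite_def)

lemma opposite_m_inv [simp]: "inv\<^bsub>opposite M\<^esub> x = inv\<^bsub>M\<^esub> x"
  unfolding m_inv_def opposite_simps by (metis (no_types, opaque_lifting))

lemma (in group) opposite_group: "group (opposite G)"
  by (rule groupI) (auto simp: m_assoc intro: r_inv_ex)

lemma opposite_vectorspace:
  assumes "vectorspace K A" shows "vectorspace K (opposite A)"
proof -
  interpret vectorspace K A by fact
  have "abelian_group (opposite A)"
    using M.abelian_group_axioms
    by (simp add: abelian_group_def abelian_monoid_def abelian_group_axioms_def)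
  then have "module K (opposite A)"
    by (intro moduleI) (auto simp: smult_l_distr smult_r_distr smult_assoc1 intro: R.is_cring)
  then show ?thesis by (simp add: vectorspace_def field_axioms)
qed

lemma opposite_algebra:
  assumes "unital_algebra K A" shows "unital_algebra K (opposite A)"
proof -
  interpret unital_algebra K A by fact
  have v: "vectorspace K (opposite A)" by (rule opposite_vectorspace) unfold_locales
  then interpret v: vectorspace K "opposite A" .
  have "ring (opposite A)"
    by (rule ringI[OF v.M.abelian_group_axioms monoidI]) (auto simp: m_assoc l_distr r_distr)
  with v show ?thesis
    by (simp add: unital_algebra_def unital_algebra_axioms_def smult_mult_left smult_mult_right)
qed

lemma opposite_fin_dim:
  assumes "vectorspace K A"
  shows "vectorspace.fin_dim K (opposite A) = vectorspace.fin_dim K A"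
proof -
  interpret A: vectorspace K A by fact
  interpret B: vectorspace K "opposite A" by (rule opposite_vectorspace) fact
  have "A.lincomb = B.lincomb"
    by (simp add: fun_eq_iff A.lincomb_def B.lincomb_def finsum_def)
  then have "A.span = B.span"
    by (simp add: fun_eq_iff A.span_def B.span_def)
  then show ?thesis by (simp add: A.fin_dim_def B.fin_dim_def)
qed

lemma opposite_module_hom [simp]:
  "module_hom K (opposite A) M = module_hom K A M" "module_hom K M (opposite A) = module_hom K M A"
  by (simp_all add: module_hom_def)

lemma sweedler_flip: "sweedler K (map prod.swap L) B = sweedler K L (\<lambda>a b. B b a)"
  by (simp add: sweedler_def lsum_map case_prod_unfold)

lemma bilinear_flip: "bilinear K V W M B \<Longrightarrow> bilinear K W V M (\<lambda>a b. B b a)"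
  by (simp add: bilinear_def)

lemma bilinear_opposite [simp]: "bilinear K (opposite V) (opposite W) M B = bilinear K V W M B"
  by (simp add: bilinear_def)

context sweedler_coalgebra
begin

text \<open>
  Reversing the products and the coproducts simultaneously preserves the antipode: the axiom
  \<open>S(x\<^sub>1) x\<^sub>2 = \<epsilon>(x) 1\<close> becomes \<open>x\<^sub>1 S(x\<^sub>2) = \<epsilon>(x) 1\<close> and vice versa.  Right integrals of the opposite are
  left integrals, and left and right cointegrals are exchanged.
\<close>

lemma opposite_coalgebra:
  "sweedler_coalgebra (opposite G) K (\<lambda>\<alpha>. opposite (H \<alpha>)) (\<lambda>\<alpha> \<beta> x. map prod.swap (D \<beta> \<alpha> x)) \<epsilon> S"
proof (intro sweedler_coalgebra.intro sweedler_coalgebra_axioms.intro; (unfold opposite_simps)?)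
  show "group (opposite G)" by (rule opposite_group)
  show "field K" by (rule K.field_axioms)
  show "unital_algebra K (opposite (H \<alpha>))" if "\<alpha> \<in> carrier G" for \<alpha>
    by (rule opposite_algebra[OF algebras[OF that]])
  show "vectorspace.fin_dim K (opposite (H \<alpha>))" if "\<alpha> \<in> carrier G" for \<alpha>
    using finite_dimensional[OF that] opposite_fin_dim[OF H_vectorspace[OF that]] by simp
  show "set (map prod.swap (D \<beta> \<alpha> x)) \<subseteq> carrier (H \<alpha>) \<times> carrier (H \<beta>)"
    if "\<alpha> \<in> carrier G" "\<beta> \<in> carrier G" "x \<in> carrier (H (\<beta> \<otimes> \<alpha>))" for \<alpha> \<beta> x
    using comult_closed[OF that(2,1,3)] by auto
  show "(\<lambda>x. sweedler K (map prod.swap (D \<beta> \<alpha> x)) B) \<in>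
      module_hom K (opposite (H (\<beta> \<otimes> \<alpha>))) (scalar_space K)"
    if "\<alpha> \<in> carrier G" "\<beta> \<in> carrier G"
      "bilinear K (opposite (H \<alpha>)) (opposite (H \<beta>)) (scalar_space K) B" for \<alpha> \<beta> B
    using comult_linear[OF that(2,1) bilinear_flip] that(3) by (simp add: sweedler_flip)
  show "sweedler K (map prod.swap (D \<beta> \<alpha> (y \<otimes>\<^bsub>H (\<beta> \<otimes> \<alpha>)\<^esub> x))) B =
      sweedler K (map prod.swap (D \<beta> \<alpha> x)) (\<lambda>a b. sweedler K (map prod.swap (D \<beta> \<alpha> y))
        (\<lambda>c d. B (c \<otimes>\<^bsub>H \<alpha>\<^esub> a) (d \<otimes>\<^bsub>H \<beta>\<^esub> b)))"
    if "\<alpha> \<in> carrier G" "\<beta> \<in> carrier G" "x \<in> carrier (H (\<beta> \<otimes> \<alpha>))" "y \<in> carrier (H (\<beta> \<otimes> \<alpha>))"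
      "bilinear K (opposite (H \<alpha>)) (opposite (H \<beta>)) (scalar_space K) B" for \<alpha> \<beta> x y B
  proof -
    have B: "bilinear K (H \<beta>) (H \<alpha>) (scalar_space K) (\<lambda>a b. B b a)"
      using that(5) by (simp add: bilinear_flip)
    have "sweedler K (D \<beta> \<alpha> (y \<otimes>\<^bsub>H (\<beta> \<otimes> \<alpha>)\<^esub> x)) (\<lambda>a b. B b a) =
      sweedler K (D \<beta> \<alpha> y) (\<lambda>c d. sweedler K (D \<beta> \<alpha> x) (\<lambda>a b. B (d \<otimes>\<^bsub>H \<alpha>\<^esub> b) (c \<otimes>\<^bsub>H \<beta>\<^esub> a)))"
      using comult_mult[OF that(2,1,4,3) B] .
    also have "\<dots> = sweedler K (D \<beta> \<alpha> x) (\<lambda>a b. sweedler K (D \<beta> \<alpha> y)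
        (\<lambda>c d. B (d \<otimes>\<^bsub>H \<alpha>\<^esub> b) (c \<otimes>\<^bsub>H \<beta>\<^esub> a)))"
    proof (rule K.sweedler_swap)
      fix c d a b assume *: "(c, d) \<in> set (D \<beta> \<alpha> y)" "(a, b) \<in> set (D \<beta> \<alpha> x)"
      have "d \<otimes>\<^bsub>H \<alpha>\<^esub> b \<in> carrier (H \<alpha>)" "c \<otimes>\<^bsub>H \<beta>\<^esub> a \<in> carrier (H \<beta>)"
        using comult_mem[OF *(1) that(2,1,4)] comult_mem[OF *(2) that(2,1,3)] that(1,2)
        by (simp_all add: H_mult_closed)
      from bilinear_closed[OF B this(2,1)]
      show "B (d \<otimes>\<^bsub>H \<alpha>\<^esub> b) (c \<otimes>\<^bsub>H \<beta>\<^esub> a) \<in> carrier K" by simp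
    qed
    finally show ?thesis by (simp add: sweedler_flip)
  qed
  show "sweedler K (map prod.swap (D \<gamma> (\<beta> \<otimes> \<alpha>) x)) (\<lambda>u c. sweedler K (map prod.swap (D \<beta> \<alpha> u)) (\<lambda>a b. T a b c)) =
      sweedler K (map prod.swap (D (\<gamma> \<otimes> \<beta>) \<alpha> x)) (\<lambda>a v. sweedler K (map prod.swap (D \<gamma> \<beta> v)) (\<lambda>b c. T a b c))"
    if "\<alpha> \<in> carrier G" "\<beta> \<in> carrier G" "\<gamma> \<in> carrier G" "x \<in> carrier (H (\<gamma> \<otimes> (\<beta> \<otimes> \<alpha>)))"
      "trilinear K (opposite (H \<alpha>)) (opposite (H \<beta>)) (opposite (H \<gamma>)) T" for \<alpha> \<beta> \<gamma> x T
  proof -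
    have "trilinear K (H \<gamma>) (H \<beta>) (H \<alpha>) (\<lambda>a b c. T c b a)"
      using that(5) by (simp add: trilinear_def bilinear_def)
    from coassoc[OF that(3,2,1) _ this, of x] show ?thesis
      using that(1-4) by (simp add: sweedler_flip m_assoc)
  qed
  show "\<epsilon> \<in> module_hom K (opposite (H \<one>)) (scalar_space K)" using counit_linear by simp
  show "\<epsilon> (y \<otimes>\<^bsub>H \<one>\<^esub> x) = \<epsilon> x \<otimes>\<^bsub>K\<^esub> \<epsilon> y" if "x \<in> carrier (H \<one>)" "y \<in> carrier (H \<one>)" for x y
    using counit_mult[OF that(2,1)] functional_closed[OF counit_linear] that by (simp add: K.m_comm)
  show "\<epsilon> \<one>\<^bsub>H \<one>\<^esub> = \<one>\<^bsub>K\<^esub>" by (rule counit_one)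
  show "sweedler K (map prod.swap (D \<one> \<alpha> x)) (\<lambda>a b. f a \<otimes>\<^bsub>K\<^esub> \<epsilon> b) = f x"
    if "\<alpha> \<in> carrier G" "x \<in> carrier (H \<alpha>)" "f \<in> module_hom K (opposite (H \<alpha>)) (scalar_space K)" for \<alpha> x f
  proof -
    have f: "functional \<alpha> f" using that(3) by simp
    have "sweedler K (D \<one> \<alpha> x) (\<lambda>b a. f a \<otimes>\<^bsub>K\<^esub> \<epsilon> b) = sweedler K (D \<one> \<alpha> x) (\<lambda>b a. \<epsilon> b \<otimes>\<^bsub>K\<^esub> f a)"
      using comult_mem[of _ _ \<one> \<alpha> x] that functional_closed[OF counit_linear] functional_closed[OF f]
      by (intro sweedler_cong K.m_comm) auto
    then show ?thesis using counit_left[OF that(1,2) f] by (simp add: sweedler_flip)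
  qed
  show "sweedler K (map prod.swap (D \<alpha> \<one> x)) (\<lambda>a b. \<epsilon> a \<otimes>\<^bsub>K\<^esub> f b) = f x"
    if "\<alpha> \<in> carrier G" "x \<in> carrier (H \<alpha>)" "f \<in> module_hom K (opposite (H \<alpha>)) (scalar_space K)" for \<alpha> x f
  proof -
    have f: "functional \<alpha> f" using that(3) by simp
    have "sweedler K (D \<alpha> \<one> x) (\<lambda>b a. \<epsilon> a \<otimes>\<^bsub>K\<^esub> f b) = sweedler K (D \<alpha> \<one> x) (\<lambda>b a. f b \<otimes>\<^bsub>K\<^esub> \<epsilon> a)"
      using comult_mem[of _ _ \<alpha> \<one> x] that functional_closed[OF counit_linear] functional_closed[OF f]
      by (intro sweedler_cong K.m_comm) auto
    then show ?thesis using counit_right[OF that(1,2) f] by (simp add: sweedler_flip)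
  qed
  show "S \<alpha> \<in> module_hom K (opposite (H \<alpha>)) (opposite (H (inv\<^bsub>opposite G\<^esub> \<alpha>)))" if "\<alpha> \<in> carrier G" for \<alpha>
    using antipode_linear[OF that] by simp
  show "\<exists>x\<in>carrier (H \<alpha>). S \<alpha> x = y" if "\<alpha> \<in> carrier G" "y \<in> carrier (H (inv\<^bsub>opposite G\<^esub> \<alpha>))" for \<alpha> y
    using antipode_surj that by simp
  show "sweedler K (map prod.swap (D \<alpha> (inv\<^bsub>opposite G\<^esub> \<alpha>) x))
      (\<lambda>a b. f (b \<otimes>\<^bsub>H \<alpha>\<^esub> S (inv\<^bsub>opposite G\<^esub> \<alpha>) a)) = \<epsilon> x \<otimes>\<^bsub>K\<^esub> f \<one>\<^bsub>H \<alpha>\<^esub>"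
    if "\<alpha> \<in> carrier G" "x \<in> carrier (H \<one>)" "f \<in> module_hom K (opposite (H \<alpha>)) (scalar_space K)" for \<alpha> x f
    using antipode_right that by (simp add: sweedler_flip)
  show "sweedler K (map prod.swap (D (inv\<^bsub>opposite G\<^esub> \<alpha>) \<alpha> x))
      (\<lambda>a b. f (S (inv\<^bsub>opposite G\<^esub> \<alpha>) b \<otimes>\<^bsub>H \<alpha>\<^esub> a)) = \<epsilon> x \<otimes>\<^bsub>K\<^esub> f \<one>\<^bsub>H \<alpha>\<^esub>"
    if "\<alpha> \<in> carrier G" "x \<in> carrier (H \<one>)" "f \<in> module_hom K (opposite (H \<alpha>)) (scalar_space K)" for \<alpha> x f
    using antipode_left that by (simp add: sweedler_flip)
qed

end

section \<open>The twisted trace property and non-degeneracy\<close>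

context sweedler_coalgebra
begin

text \<open>
  The formula for left cointegrals, read in the opposite coalgebra.
\<close>

lemma right_cointegral_translate:
  assumes \<Lambda>: "\<Lambda> \<in> right_cointegrals (H \<one>) \<epsilon>" and \<alpha>: "\<alpha> \<in> carrier G" and h: "h \<in> carrier (H \<alpha>)"
    and p: "functional \<alpha> p" and f: "functional (inv \<alpha>) f"
  shows "sweedler K (D \<alpha> (inv \<alpha>) \<Lambda>) (\<lambda>a b. p (a \<otimes>\<^bsub>H \<alpha>\<^esub> h) \<otimes>\<^bsub>K\<^esub> f b) =
    sweedler K (D \<alpha> (inv \<alpha>) \<Lambda>) (\<lambda>a b. p a \<otimes>\<^bsub>K\<^esub> f (b \<otimes>\<^bsub>H (inv \<alpha>)\<^esub> S \<alpha> h))"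
proof -
  interpret op: sweedler_coalgebra "opposite G" K "\<lambda>\<alpha>. opposite (H \<alpha>)"
    "\<lambda>\<alpha> \<beta> x. map prod.swap (D \<beta> \<alpha> x)" \<epsilon> S
    by (rule opposite_coalgebra)
  have i: "inv \<alpha> \<in> carrier G" using \<alpha> by simp
  have \<Lambda>c: "\<Lambda> \<in> carrier (H \<one>)" using \<Lambda> by (simp add: right_cointegrals_def)
  have mem: "a \<in> carrier (H \<alpha>)" "b \<in> carrier (H (inv \<alpha>))" if "(a, b) \<in> set (D \<alpha> (inv \<alpha>) \<Lambda>)" for a b
    using comult_mem[OF that \<alpha> i] \<Lambda>c \<alpha> by auto
  note closed = functional_closed[OF p] functional_closed[OF f] mem h \<alpha> i antipode_closed H_mult_closed
  have "sweedler K (D \<alpha> (inv \<alpha>) \<Lambda>) (\<lambda>a b. f b \<otimes>\<^bsub>K\<^esub> p (a \<otimes>\<^bsub>H \<alpha>\<^esub> h)) =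
    sweedler K (D \<alpha> (inv \<alpha>) \<Lambda>) (\<lambda>a b. f (b \<otimes>\<^bsub>H (inv \<alpha>)\<^esub> S \<alpha> h) \<otimes>\<^bsub>K\<^esub> p a)"
    using op.left_cointegral_translate[of \<Lambda> \<alpha> h f p] assms
    by (simp add: sweedler_flip left_cointegrals_def right_cointegrals_def)
  moreover have "sweedler K (D \<alpha> (inv \<alpha>) \<Lambda>) (\<lambda>a b. p (a \<otimes>\<^bsub>H \<alpha>\<^esub> h) \<otimes>\<^bsub>K\<^esub> f b) =
      sweedler K (D \<alpha> (inv \<alpha>) \<Lambda>) (\<lambda>a b. f b \<otimes>\<^bsub>K\<^esub> p (a \<otimes>\<^bsub>H \<alpha>\<^esub> h))"
    by (intro sweedler_cong K.m_comm) (simp_all add: closed)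
  moreover have "sweedler K (D \<alpha> (inv \<alpha>) \<Lambda>) (\<lambda>a b. f (b \<otimes>\<^bsub>H (inv \<alpha>)\<^esub> S \<alpha> h) \<otimes>\<^bsub>K\<^esub> p a) =
      sweedler K (D \<alpha> (inv \<alpha>) \<Lambda>) (\<lambda>a b. p a \<otimes>\<^bsub>K\<^esub> f (b \<otimes>\<^bsub>H (inv \<alpha>)\<^esub> S \<alpha> h))"
    by (intro sweedler_cong K.m_comm) (simp_all add: closed)
  ultimately show ?thesis by simp
qed

context
  fixes \<mu> \<Lambda>
  assumes mu: "right_integral \<mu>"
    and left: "\<Lambda> \<in> left_cointegrals (H \<one>) \<epsilon>" and right: "\<Lambda> \<in> right_cointegrals (H \<one>) \<epsilon>"
    and norm: "\<mu> \<one> \<Lambda> = \<one>\<^bsub>K\<^esub>"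
begin

text \<open>
  \<open>\<mu>(S(h) \<Lambda>\<^sub>1) \<Lambda>\<^sub>2 = \<mu>(\<Lambda>\<^sub>1) h \<Lambda>\<^sub>2 = \<mu>\<^sub>1(\<Lambda>) h = h\<close>.
\<close>

lemma reconstruct:
  assumes \<alpha>: "\<alpha> \<in> carrier G" and h: "h \<in> carrier (H \<alpha>)" and f: "functional \<alpha> f"
  shows "sweedler K (D (inv \<alpha>) \<alpha> \<Lambda>) (\<lambda>a b. \<mu> (inv \<alpha>) (S \<alpha> h \<otimes>\<^bsub>H (inv \<alpha>)\<^esub> a) \<otimes>\<^bsub>K\<^esub> f b) = f h"
proof -
  have i: "inv \<alpha> \<in> carrier G" using \<alpha> by simp
  have \<Lambda>c: "\<Lambda> \<in> carrier (H (inv \<alpha> \<otimes> \<alpha>))" using left \<alpha> by (simp add: left_cointegrals_def)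
  have "functional \<alpha> (\<lambda>b. f (h \<otimes>\<^bsub>H \<alpha>\<^esub> b))"
    by (intro functional_comp[OF f] linear_intros \<alpha> h)
  from right_integralD[OF mu i \<alpha> \<Lambda>c this]
  show ?thesis
    unfolding left_cointegral_translate[OF left \<alpha> h right_integral_functional[OF mu i] f, symmetric]
    using norm \<alpha> h functional_closed[OF f h] by (simp add: H_one_right)
qed

text \<open>
  \<open>\<mu>(\<Lambda>\<^sub>1 k) \<Lambda>\<^sub>2 = \<mu>(\<Lambda>\<^sub>1) \<Lambda>\<^sub>2 S(k) = \<mu>\<^sub>1(\<Lambda>) S(k) = S(k)\<close>.
\<close>

lemma reconstruct_antipode:
  assumes \<alpha>: "\<alpha> \<in> carrier G" and k: "k \<in> carrier (H \<alpha>)" and f: "functional (inv \<alpha>) f"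
  shows "sweedler K (D \<alpha> (inv \<alpha>) \<Lambda>) (\<lambda>a b. \<mu> \<alpha> (a \<otimes>\<^bsub>H \<alpha>\<^esub> k) \<otimes>\<^bsub>K\<^esub> f b) = f (S \<alpha> k)"
proof -
  have i: "inv \<alpha> \<in> carrier G" using \<alpha> by simp
  have Sk: "S \<alpha> k \<in> carrier (H (inv \<alpha>))" using antipode_closed[OF \<alpha> k] .
  have \<Lambda>c: "\<Lambda> \<in> carrier (H (\<alpha> \<otimes> inv \<alpha>))" using left \<alpha> by (simp add: left_cointegrals_def)
  have "functional (inv \<alpha>) (\<lambda>b. f (b \<otimes>\<^bsub>H (inv \<alpha>)\<^esub> S \<alpha> k))"
    by (intro functional_comp[OF f] linear_intros i Sk)
  from right_integralD[OF mu \<alpha> i \<Lambda>c this]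
  show ?thesis
    unfolding right_cointegral_translate[OF right \<alpha> k right_integral_functional[OF mu \<alpha>] f]
    using norm \<alpha> i functional_closed[OF f Sk] Sk by (simp add: H_one_left)
qed

text \<open>
  Write \<open>z = S(h)\<close>; then \<open>h = \<mu>(z \<Lambda>\<^sub>1) \<Lambda>\<^sub>2 = 0\<close>.
\<close>

lemma integral_kernel:
  assumes \<alpha>: "\<alpha> \<in> carrier G" and z: "z \<in> carrier (H \<alpha>)"
    and ker: "\<And>y. y \<in> carrier (H \<alpha>) \<Longrightarrow> \<mu> \<alpha> (z \<otimes>\<^bsub>H \<alpha>\<^esub> y) = \<zero>\<^bsub>K\<^esub>"
  shows "z = \<zero>\<^bsub>H \<alpha>\<^esub>"
proof -
  have i: "inv \<alpha> \<in> carrier G" using \<alpha> by simp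
  obtain h where h: "h \<in> carrier (H (inv \<alpha>))" "S (inv \<alpha>) h = z"
    using antipode_surj[OF i] z \<alpha> by auto
  have \<Lambda>c: "\<Lambda> \<in> carrier (H (\<alpha> \<otimes> inv \<alpha>))" using left \<alpha> by (simp add: left_cointegrals_def)
  interpret V: vectorspace K "H (inv \<alpha>)" using H_vectorspace[OF i] .
  have "f h = \<zero>\<^bsub>K\<^esub>" if f: "functional (inv \<alpha>) f" for f
  proof -
    have "f h = sweedler K (D \<alpha> (inv \<alpha>) \<Lambda>) (\<lambda>a b. \<mu> \<alpha> (z \<otimes>\<^bsub>H \<alpha>\<^esub> a) \<otimes>\<^bsub>K\<^esub> f b)"
      using reconstruct[OF i h(1) f] h(2) \<alpha> by simp
    also have "\<dots> = \<zero>\<^bsub>K\<^esub>"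
      by (rule K.sweedler_zero) (use ker comult_mem[OF _ \<alpha> i \<Lambda>c] functional_closed[OF f] in simp)
    finally show ?thesis .
  qed
  then have "h = \<zero>\<^bsub>H (inv \<alpha>)\<^esub>" by (rule V.functional_eq_zero[OF finite_dimensional[OF i] h(1)])
  moreover have "S (inv \<alpha>) \<zero>\<^bsub>H (inv \<alpha>)\<^esub> = \<zero>\<^bsub>H \<alpha>\<^esub>"
    using mod_hom.f0_is_0[of K "H (inv \<alpha>)" "H \<alpha>" "S (inv \<alpha>)"] antipode_linear[OF i] H_module \<alpha> i
    by (simp add: mod_hom_def mod_hom_axioms_def)
  ultimately show ?thesis using h(2) by simp
qed

text \<open>
  Represent the functional \<open>\<mu>\<^sub>\<alpha>(_ k)\<close> as \<open>\<mu>\<^sub>\<alpha>(z _)\<close> and write \<open>z = S(h)\<close>; then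
  \<open>h = \<mu>(z \<Lambda>\<^sub>1) \<Lambda>\<^sub>2 = \<mu>(\<Lambda>\<^sub>1 k) \<Lambda>\<^sub>2 = S(k)\<close>.
\<close>

lemma integral_commute:
  assumes \<alpha>: "\<alpha> \<in> carrier G" and k: "k \<in> carrier (H \<alpha>)" and y: "y \<in> carrier (H \<alpha>)"
  shows "\<mu> \<alpha> (S (inv \<alpha>) (S \<alpha> k) \<otimes>\<^bsub>H \<alpha>\<^esub> y) = \<mu> \<alpha> (y \<otimes>\<^bsub>H \<alpha>\<^esub> k)"
proof -
  have i: "inv \<alpha> \<in> carrier G" using \<alpha> by simp
  interpret V: vectorspace K "H \<alpha>" using H_vectorspace[OF \<alpha>] .
  have \<Lambda>c: "\<Lambda> \<in> carrier (H (\<alpha> \<otimes> inv \<alpha>))" using left \<alpha> by (simp add: left_cointegrals_def)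
  have "functional \<alpha> (\<lambda>y. \<mu> \<alpha> (y \<otimes>\<^bsub>H \<alpha>\<^esub> k))"
    by (intro functional_comp[OF right_integral_functional[OF mu \<alpha>]] linear_intros \<alpha> k)
  from V.functional_represented[OF finite_dimensional[OF \<alpha>] integral_bilinear[OF mu \<alpha>] integral_kernel[OF \<alpha>] this]
  obtain z where z: "z \<in> carrier (H \<alpha>)"
    "\<And>y. y \<in> carrier (H \<alpha>) \<Longrightarrow> \<mu> \<alpha> (z \<otimes>\<^bsub>H \<alpha>\<^esub> y) = \<mu> \<alpha> (y \<otimes>\<^bsub>H \<alpha>\<^esub> k)" by blast
  obtain h where h: "h \<in> carrier (H (inv \<alpha>))" "S (inv \<alpha>) h = z"
    using antipode_surj[OF i] z(1) \<alpha> by auto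
  have "h = S \<alpha> k"
  proof (rule functionals_separate[OF i h(1) antipode_closed[OF \<alpha> k]])
    fix f assume f: "functional (inv \<alpha>) f"
    have "f h = sweedler K (D \<alpha> (inv \<alpha>) \<Lambda>) (\<lambda>a b. \<mu> \<alpha> (z \<otimes>\<^bsub>H \<alpha>\<^esub> a) \<otimes>\<^bsub>K\<^esub> f b)"
      using reconstruct[OF i h(1) f] h(2) \<alpha> by simp
    also have "\<dots> = sweedler K (D \<alpha> (inv \<alpha>) \<Lambda>) (\<lambda>a b. \<mu> \<alpha> (a \<otimes>\<^bsub>H \<alpha>\<^esub> k) \<otimes>\<^bsub>K\<^esub> f b)"
      by (rule sweedler_cong) (use z(2) comult_mem[OF _ \<alpha> i \<Lambda>c] in simp)
    finally show "f h = f (S \<alpha> k)" using reconstruct_antipode[OF \<alpha> k f] by simp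
  qed
  then show ?thesis using h(2) z(2)[OF y] by simp
qed

end

text \<open>
  This is where unimodularity enters: the cointegral with value \<open>1\<close> found above is a right one, and both
  properties require that it is also a left one.
\<close>

theorem unimodular_integral:
  assumes mu: "right_integral \<mu>" and nz: "nonzero_family G K H \<mu>"
    and unimod: "left_cointegrals (H \<one>) \<epsilon> = right_cointegrals (H \<one>) \<epsilon>" and \<alpha>: "\<alpha> \<in> carrier G"
  shows "\<And>x y. \<lbrakk>x \<in> carrier (H \<alpha>); y \<in> carrier (H \<alpha>)\<rbrakk> \<Longrightarrow>
      \<mu> \<alpha> (S (inv \<alpha>) (S \<alpha> x) \<otimes>\<^bsub>H \<alpha>\<^esub> y) = \<mu> \<alpha> (y \<otimes>\<^bsub>H \<alpha>\<^esub> x)"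
    and "\<And>x. \<lbrakk>x \<in> carrier (H \<alpha>); \<And>y. y \<in> carrier (H \<alpha>) \<Longrightarrow> \<mu> \<alpha> (x \<otimes>\<^bsub>H \<alpha>\<^esub> y) = \<zero>\<^bsub>K\<^esub>\<rbrakk> \<Longrightarrow>
      x = \<zero>\<^bsub>H \<alpha>\<^esub>"
proof -
  have "\<exists>y\<in>carrier (H \<one>). \<mu> \<one> y \<noteq> \<zero>\<^bsub>K\<^esub>"
    using nz integral_one_nonzero[OF mu] by (auto simp: nonzero_family_def)
  then obtain \<Lambda> where \<Lambda>: "\<Lambda> \<in> right_cointegrals (H \<one>) \<epsilon>" "\<mu> \<one> \<Lambda> = \<one>\<^bsub>K\<^esub>"
    using right_cointegral_ex[OF mu] by blast
  have l: "\<Lambda> \<in> left_cointegrals (H \<one>) \<epsilon>" using \<Lambda>(1) unimod by simp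
  show "\<And>x y. \<lbrakk>x \<in> carrier (H \<alpha>); y \<in> carrier (H \<alpha>)\<rbrakk> \<Longrightarrow>
      \<mu> \<alpha> (S (inv \<alpha>) (S \<alpha> x) \<otimes>\<^bsub>H \<alpha>\<^esub> y) = \<mu> \<alpha> (y \<otimes>\<^bsub>H \<alpha>\<^esub> x)"
    by (rule integral_commute[OF mu l \<Lambda> \<alpha>])
  show "\<And>x. \<lbrakk>x \<in> carrier (H \<alpha>); \<And>y. y \<in> carrier (H \<alpha>) \<Longrightarrow> \<mu> \<alpha> (x \<otimes>\<^bsub>H \<alpha>\<^esub> y) = \<zero>\<^bsub>K\<^esub>\<rbrakk> \<Longrightarrow>
      x = \<zero>\<^bsub>H \<alpha>\<^esub>"
    by (rule integral_kernel[OF mu l \<Lambda> \<alpha>])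
qed

end

section \<open>Terms of the comultiplication\<close>

context hopf_group_coalgebra
begin

abbreviation tens :: "'g \<Rightarrow> 'g \<Rightarrow> ('k, ('a \<times> 'a \<Rightarrow> 'k) set) module" where
  "tens \<alpha> \<beta> \<equiv> tensor_space K (H \<alpha>) (H \<beta>)"

lemma H_vectorspace: "\<alpha> \<in> carrier G \<Longrightarrow> vectorspace K (H \<alpha>)"
  and H_module: "\<alpha> \<in> carrier G \<Longrightarrow> module K (H \<alpha>)"
  and H_ring: "\<alpha> \<in> carrier G \<Longrightarrow> ring (H \<alpha>)"
  using algebras by (simp_all add: unital_algebra_def vectorspace_def)

lemma tensor: "\<lbrakk>\<alpha> \<in> carrier G; \<beta> \<in> carrier G\<rbrakk> \<Longrightarrow> tensor_product K (H \<alpha>) (H \<beta>)"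
  by (simp add: tensor_product_def H_vectorspace)

lemma scalar_module: "module K (scalar_space K)"
  by (rule scalar_space_module) (rule K.field_axioms)

lemma comult_module_hom:
  assumes "\<alpha> \<in> carrier G" "\<beta> \<in> carrier G"
  shows "\<Delta> \<alpha> \<beta> \<in> module_hom K (H (\<alpha> \<otimes> \<beta>)) (tens \<alpha> \<beta>)"
  using comult_hom[OF assms] by (simp add: algebra_hom_def module_hom_def tensor_algebra_def Let_def)

text \<open>
  Any choice of terms will do, as bilinear maps take the same value on all of them.
\<close>

definition comult_terms :: "'g \<Rightarrow> 'g \<Rightarrow> 'a \<Rightarrow> ('a \<times> 'a) list" where
  "comult_terms \<alpha> \<beta> x = (SOME L. set L \<subseteq> carrier (H \<alpha>) \<times> carrier (H \<beta>) \<and>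
     \<Delta> \<alpha> \<beta> x = lsum (tens \<alpha> \<beta>) (\<lambda>(a, b). pure_tensor K (H \<alpha>) (H \<beta>) a b) L)"

lemma comult_terms:
  assumes "\<alpha> \<in> carrier G" "\<beta> \<in> carrier G" "x \<in> carrier (H (\<alpha> \<otimes> \<beta>))"
  shows "set (comult_terms \<alpha> \<beta> x) \<subseteq> carrier (H \<alpha>) \<times> carrier (H \<beta>)"
    and "\<Delta> \<alpha> \<beta> x = lsum (tens \<alpha> \<beta>) (\<lambda>p. pure_tensor K (H \<alpha>) (H \<beta>) (fst p) (snd p)) (comult_terms \<alpha> \<beta> x)"
proof -
  interpret tensor_product K "H \<alpha>" "H \<beta>" using tensor assms by simp
  have "\<Delta> \<alpha> \<beta> x \<in> carrier T" using module_hom_in_carrier[OF comult_module_hom] assms by simp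
  then have "\<exists>L. set L \<subseteq> carrier (H \<alpha>) \<times> carrier (H \<beta>) \<and> \<Delta> \<alpha> \<beta> x = lsum T (\<lambda>(a, b). pure a b) L"
    by (rule tensor_decomp) blast
  from someI_ex[OF this]
  show "set (comult_terms \<alpha> \<beta> x) \<subseteq> carrier (H \<alpha>) \<times> carrier (H \<beta>)"
    and "\<Delta> \<alpha> \<beta> x = lsum (tens \<alpha> \<beta>) (\<lambda>p. pure (fst p) (snd p)) (comult_terms \<alpha> \<beta> x)"
    by (simp_all add: comult_terms_def case_prod_unfold)
qed

lemma comult_terms_mem:
  assumes "p \<in> set (comult_terms \<alpha> \<beta> x)" "\<alpha> \<in> carrier G" "\<beta> \<in> carrier G" "x \<in> carrier (H (\<alpha> \<otimes> \<beta>))"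
  shows "fst p \<in> carrier (H \<alpha>)" "snd p \<in> carrier (H \<beta>)"
  using comult_terms(1)[OF assms(2-4)] assms(1) by auto

lemma lift_comult:
  assumes "\<alpha> \<in> carrier G" "\<beta> \<in> carrier G" "x \<in> carrier (H (\<alpha> \<otimes> \<beta>))"
    and "module K M" "bilinear K (H \<alpha>) (H \<beta>) M B"
  shows "tensor_lift K M B (\<Delta> \<alpha> \<beta> x) = lsum M (\<lambda>p. B (fst p) (snd p)) (comult_terms \<alpha> \<beta> x)"
proof -
  interpret tensor_product K "H \<alpha>" "H \<beta>" using tensor assms by simp
  show ?thesis
    unfolding comult_terms(2)[OF assms(1-3)]
    by (rule tensor_lift_lsum[OF assms(4,5)]) (use comult_terms_mem[OF _ assms(1-3)] in auto)
qed

lemma sweedler_comult: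
  assumes "\<alpha> \<in> carrier G" "\<beta> \<in> carrier G" "x \<in> carrier (H (\<alpha> \<otimes> \<beta>))"
    and "bilinear K (H \<alpha>) (H \<beta>) (scalar_space K) B"
  shows "sweedler K (comult_terms \<alpha> \<beta> x) B = tensor_lift K (scalar_space K) B (\<Delta> \<alpha> \<beta> x)"
  using lift_comult[OF assms(1-3) scalar_module assms(4)]
  by (simp add: sweedler_def lsum_scalar_space case_prod_unfold)

text \<open>
  The structure maps of a Hopf group-coalgebra are all composed from a coproduct, a map \<open>f \<otimes> h\<close> and
  the linear map induced by some bilinear \<open>B\<close>; this evaluates such a composite on the terms of the
  coproduct.
\<close>

lemma lift_map_comult:
  assumes "\<alpha> \<in> carrier G" "\<beta> \<in> carrier G" "x \<in> carrier (H (\<alpha> \<otimes> \<beta>))"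
    and P: "vectorspace K P" and Q: "vectorspace K Q" and M: "module K M"
    and f: "f \<in> module_hom K (H \<alpha>) P" and h: "h \<in> module_hom K (H \<beta>) Q" and B: "bilinear K P Q M B"
  shows "tensor_lift K M B (tensor_map K P Q f h (\<Delta> \<alpha> \<beta> x)) =
    lsum M (\<lambda>p. B (f (fst p)) (h (snd p))) (comult_terms \<alpha> \<beta> x)"
proof -
  interpret PQ: tensor_product K P Q using P Q by (simp add: tensor_product_def)
  note mem = comult_terms_mem[OF _ assms(1-3)]
  have "tensor_map K P Q f h (\<Delta> \<alpha> \<beta> x) =
      lsum PQ.T (\<lambda>p. PQ.pure (f (fst p)) (h (snd p))) (comult_terms \<alpha> \<beta> x)"
    unfolding tensor_map_def
    by (rule lift_comult[OF assms(1-3) PQ.tensor_space_module bilinear_comp[OF PQ.pure_bilinear f h]])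
  also have "tensor_lift K M B \<dots> = lsum M (\<lambda>p. B (f (fst p)) (h (snd p))) (comult_terms \<alpha> \<beta> x)"
    by (rule PQ.tensor_lift_lsum[OF M B])
      (use mem module_hom_in_carrier[OF f] module_hom_in_carrier[OF h] in auto)
  finally show ?thesis .
qed

lemma functional_lsum:
  assumes "f \<in> module_hom K M (scalar_space K)" "module K M" "\<And>i. i \<in> set xs \<Longrightarrow> v i \<in> carrier M"
  shows "f (lsum M v xs) = lsum K (\<lambda>i. f (v i)) xs"
  using module_hom_lsum[OF assms(2) scalar_module assms(1,3)] by (simp add: lsum_scalar_space)

lemma comult_terms_mult:
  assumes \<alpha>: "\<alpha> \<in> carrier G" and \<beta>: "\<beta> \<in> carrier G" and x: "x \<in> carrier (H (\<alpha> \<otimes> \<beta>))"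
    and y: "y \<in> carrier (H (\<alpha> \<otimes> \<beta>))" and B: "bilinear K (H \<alpha>) (H \<beta>) (scalar_space K) B"
  shows "sweedler K (comult_terms \<alpha> \<beta> (x \<otimes>\<^bsub>H (\<alpha> \<otimes> \<beta>)\<^esub> y)) B =
    sweedler K (comult_terms \<alpha> \<beta> x) (\<lambda>a b. sweedler K (comult_terms \<alpha> \<beta> y)
      (\<lambda>c d. B (a \<otimes>\<^bsub>H \<alpha>\<^esub> c) (b \<otimes>\<^bsub>H \<beta>\<^esub> d)))"
proof -
  interpret tensor_product K "H \<alpha>" "H \<beta>" using tensor \<alpha> \<beta> by simp
  interpret A: unital_algebra K "H \<alpha>" by (rule algebras[OF \<alpha>])
  interpret A': unital_algebra K "H \<beta>" by (rule algebras[OF \<beta>])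
  interpret R: ring "H (\<alpha> \<otimes> \<beta>)" using H_ring \<alpha> \<beta> by simp
  let ?D = "comult_terms \<alpha> \<beta>"
  note mem = comult_terms_mem[OF _ \<alpha> \<beta>]
  have left: "(\<lambda>b. a \<otimes>\<^bsub>H \<alpha>\<^esub> b) \<in> module_hom K (H \<alpha>) (H \<alpha>)" if "a \<in> carrier (H \<alpha>)" for a
    using that by (intro module_homI) (auto simp: A.r_distr A.smult_mult_right)
  have right: "(\<lambda>b. b \<otimes>\<^bsub>H \<alpha>\<^esub> a) \<in> module_hom K (H \<alpha>) (H \<alpha>)" if "a \<in> carrier (H \<alpha>)" for a
    using that by (intro module_homI) (auto simp: A.l_distr A.smult_mult_left)
  have left': "(\<lambda>b. a \<otimes>\<^bsub>H \<beta>\<^esub> b) \<in> module_hom K (H \<beta>) (H \<beta>)" if "a \<in> carrier (H \<beta>)" for a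
    using that by (intro module_homI) (auto simp: A'.r_distr A'.smult_mult_right)
  have right': "(\<lambda>b. b \<otimes>\<^bsub>H \<beta>\<^esub> a) \<in> module_hom K (H \<beta>) (H \<beta>)" if "a \<in> carrier (H \<beta>)" for a
    using that by (intro module_homI) (auto simp: A'.l_distr A'.smult_mult_left)
  \<comment> \<open>The product of \<open>a \<otimes> b\<close> with the coproduct of \<open>y\<close>.\<close>
  let ?P = "\<lambda>a b. lsum T (\<lambda>q. pure (a \<otimes>\<^bsub>H \<alpha>\<^esub> fst q) (b \<otimes>\<^bsub>H \<beta>\<^esub> snd q)) (?D y)"
  have inner: "tensor_lift K T (\<lambda>c d. pure (a \<otimes>\<^bsub>H \<alpha>\<^esub> c) (b \<otimes>\<^bsub>H \<beta>\<^esub> d)) (\<Delta> \<alpha> \<beta> y) = ?P a b"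
    if "a \<in> carrier (H \<alpha>)" "b \<in> carrier (H \<beta>)" for a b
    by (rule lift_comult[OF \<alpha> \<beta> y tensor_space_module])
      (rule bilinear_comp[OF pure_bilinear left[OF that(1)] left'[OF that(2)]])
  have bil: "bilinear K (H \<alpha>) (H \<beta>) T (\<lambda>a b. pure (a \<otimes>\<^bsub>H \<alpha>\<^esub> c) (b \<otimes>\<^bsub>H \<beta>\<^esub> d))"
    if "c \<in> carrier (H \<alpha>)" "d \<in> carrier (H \<beta>)" for c d
    by (rule bilinear_comp[OF pure_bilinear right[OF that(1)] right'[OF that(2)]])
  have bilP: "bilinear K (H \<alpha>) (H \<beta>) T (\<lambda>a b. tensor_lift K T
      (\<lambda>c d. pure (a \<otimes>\<^bsub>H \<alpha>\<^esub> c) (b \<otimes>\<^bsub>H \<beta>\<^esub> d)) (\<Delta> \<alpha> \<beta> y))"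
    unfolding bilinear_def
  proof (intro conjI ballI)
    fix a assume a: "a \<in> carrier (H \<alpha>)"
    have "(\<lambda>b. ?P a b) \<in> module_hom K (H \<beta>) T"
    proof (rule module_hom_lsum_param[OF H_module[OF \<beta>] tensor_space_module])
      fix q assume "q \<in> set (?D y)"
      from bil[OF mem[OF this y]] a
      show "(\<lambda>b. pure (a \<otimes>\<^bsub>H \<alpha>\<^esub> fst q) (b \<otimes>\<^bsub>H \<beta>\<^esub> snd q)) \<in> module_hom K (H \<beta>) T"
        by (simp add: bilinear_def)
    qed
    then show "(\<lambda>b. tensor_lift K T (\<lambda>c d. pure (a \<otimes>\<^bsub>H \<alpha>\<^esub> c) (b \<otimes>\<^bsub>H \<beta>\<^esub> d)) (\<Delta> \<alpha> \<beta> y)) \<in> module_hom K (H \<beta>) T"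
      by (rule module_hom_cong[OF _ H_module[OF \<beta>]]) (simp add: inner a)
  next
    fix b assume b: "b \<in> carrier (H \<beta>)"
    have "(\<lambda>a. ?P a b) \<in> module_hom K (H \<alpha>) T"
    proof (rule module_hom_lsum_param[OF H_module[OF \<alpha>] tensor_space_module])
      fix q assume "q \<in> set (?D y)"
      from bil[OF mem[OF this y]] b
      show "(\<lambda>a. pure (a \<otimes>\<^bsub>H \<alpha>\<^esub> fst q) (b \<otimes>\<^bsub>H \<beta>\<^esub> snd q)) \<in> module_hom K (H \<alpha>) T"
        by (simp add: bilinear_def)
    qed
    then show "(\<lambda>a. tensor_lift K T (\<lambda>c d. pure (a \<otimes>\<^bsub>H \<alpha>\<^esub> c) (b \<otimes>\<^bsub>H \<beta>\<^esub> d)) (\<Delta> \<alpha> \<beta> y)) \<in> module_hom K (H \<alpha>) T"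
      by (rule module_hom_cong[OF _ H_module[OF \<alpha>]]) (simp add: inner b)
  qed
  have "\<Delta> \<alpha> \<beta> (x \<otimes>\<^bsub>H (\<alpha> \<otimes> \<beta>)\<^esub> y) = \<Delta> \<alpha> \<beta> x \<otimes>\<^bsub>tensor_algebra K (H \<alpha>) (H \<beta>)\<^esub> \<Delta> \<alpha> \<beta> y"
    using comult_hom[OF \<alpha> \<beta>] x y by (simp add: algebra_hom_def ring_hom_mult)
  also have "\<dots> = tensor_lift K T (\<lambda>a b. tensor_lift K T
      (\<lambda>c d. pure (a \<otimes>\<^bsub>H \<alpha>\<^esub> c) (b \<otimes>\<^bsub>H \<beta>\<^esub> d)) (\<Delta> \<alpha> \<beta> y)) (\<Delta> \<alpha> \<beta> x)"
    by (simp add: tensor_algebra_def Let_def)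
  also have "\<dots> = lsum T (\<lambda>p. ?P (fst p) (snd p)) (?D x)"
    unfolding lift_comult[OF \<alpha> \<beta> x tensor_space_module bilP]
    by (rule lsum_cong) (simp add: inner mem[OF _ x])
  finally have prod: "\<Delta> \<alpha> \<beta> (x \<otimes>\<^bsub>H (\<alpha> \<otimes> \<beta>)\<^esub> y) = lsum T (\<lambda>p. ?P (fst p) (snd p)) (?D x)" .
  have pc: "pure (fst p \<otimes>\<^bsub>H \<alpha>\<^esub> fst q) (snd p \<otimes>\<^bsub>H \<beta>\<^esub> snd q) \<in> carrier T"
    if "p \<in> set (?D x)" "q \<in> set (?D y)" for p q
    using mem[OF that(1) x] mem[OF that(2) y] by (intro pure_closed A.m_closed A'.m_closed)
  note hom = tensor_lift_hom[OF scalar_module B]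
  have "tensor_lift K (scalar_space K) B (lsum T (\<lambda>p. ?P (fst p) (snd p)) (?D x)) =
      lsum K (\<lambda>p. tensor_lift K (scalar_space K) B (?P (fst p) (snd p))) (?D x)"
    by (rule functional_lsum[OF hom tensor_space_module]) (rule module_lsum_closed[OF tensor_space_module], rule pc)
  also have "\<dots> = lsum K (\<lambda>p. lsum K (\<lambda>q. B (fst p \<otimes>\<^bsub>H \<alpha>\<^esub> fst q) (snd p \<otimes>\<^bsub>H \<beta>\<^esub> snd q)) (?D y)) (?D x)"
  proof (rule lsum_cong)
    fix p assume p: "p \<in> set (?D x)"
    have "tensor_lift K (scalar_space K) B (?P (fst p) (snd p)) =
        lsum (scalar_space K) (\<lambda>q. B (fst p \<otimes>\<^bsub>H \<alpha>\<^esub> fst q) (snd p \<otimes>\<^bsub>H \<beta>\<^esub> snd q)) (?D y)"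
      by (rule tensor_lift_lsum[OF scalar_module B])
        (intro A.m_closed A'.m_closed mem[OF p x] mem[OF _ y]; assumption)+
    then show "tensor_lift K (scalar_space K) B (?P (fst p) (snd p)) =
        lsum K (\<lambda>q. B (fst p \<otimes>\<^bsub>H \<alpha>\<^esub> fst q) (snd p \<otimes>\<^bsub>H \<beta>\<^esub> snd q)) (?D y)"
      by (simp add: lsum_scalar_space)
  qed
  finally show ?thesis
    using sweedler_comult[OF \<alpha> \<beta> _ B, of "x \<otimes>\<^bsub>H (\<alpha> \<otimes> \<beta>)\<^esub> y"] x y prod
    by (simp add: sweedler_def case_prod_unfold)
qed

lemma comult_terms_coassoc:
  assumes \<alpha>: "\<alpha> \<in> carrier G" and \<beta>: "\<beta> \<in> carrier G" and \<gamma>: "\<gamma> \<in> carrier G"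
    and x: "x \<in> carrier (H (\<alpha> \<otimes> \<beta> \<otimes> \<gamma>))" and C: "trilinear K (H \<alpha>) (H \<beta>) (H \<gamma>) C"
  shows "sweedler K (comult_terms (\<alpha> \<otimes> \<beta>) \<gamma> x) (\<lambda>u c. sweedler K (comult_terms \<alpha> \<beta> u) (\<lambda>a b. C a b c)) =
    sweedler K (comult_terms \<alpha> (\<beta> \<otimes> \<gamma>) x) (\<lambda>a v. sweedler K (comult_terms \<beta> \<gamma> v) (\<lambda>b c. C a b c))"
proof -
  have \<alpha>\<beta>: "\<alpha> \<otimes> \<beta> \<in> carrier G" and \<beta>\<gamma>: "\<beta> \<otimes> \<gamma> \<in> carrier G" using \<alpha> \<beta> \<gamma> by auto
  have x': "x \<in> carrier (H (\<alpha> \<otimes> (\<beta> \<otimes> \<gamma>)))" using x \<alpha> \<beta> \<gamma> by (simp add: m_assoc)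
  interpret UV: tensor_product K "H \<alpha>" "H \<beta>" using tensor \<alpha> \<beta> by simp
  interpret VW: tensor_product K "H \<beta>" "H \<gamma>" using tensor \<beta> \<gamma> by simp
  interpret R: tensor_product K "H \<alpha>" VW.T
    by (simp add: tensor_product_def H_vectorspace \<alpha> VW.tensor_space_vectorspace)
  let ?k = "scalar_space K"
  \<comment> \<open>The form on \<open>H\<^sub>\<alpha> \<otimes> (H\<^sub>\<beta> \<otimes> H\<^sub>\<gamma>)\<close> induced by \<open>C\<close>; both sides of the coassociativity law are evaluated under it.\<close>
  let ?\<Theta> = "tensor_lift K ?k (\<lambda>u s. tensor_lift K ?k (C u) s)"
  let ?A = "\<lambda>t w. tensor_lift K R.T (\<lambda>u v. R.pure u (VW.pure v w)) t"
  have C2: "bilinear K (H \<beta>) (H \<gamma>) ?k (C u)" if "u \<in> carrier (H \<alpha>)" for u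
    using C that by (simp add: trilinear_def)
  have C1: "bilinear K (H \<alpha>) VW.T ?k (\<lambda>u s. tensor_lift K ?k (C u) s)"
    using C by (intro VW.tensor_lift_param[OF scalar_module H_module[OF \<alpha>]]) (auto simp: trilinear_def)
  have pw: "(\<lambda>v. VW.pure v w) \<in> module_hom K (H \<beta>) VW.T" if "w \<in> carrier (H \<gamma>)" for w
    using VW.pure_bilinear that by (simp add: bilinear_def)
  have pv: "VW.pure v \<in> module_hom K (H \<gamma>) VW.T" if "v \<in> carrier (H \<beta>)" for v
    using VW.pure_bilinear that by (simp add: bilinear_def)
  have A2: "bilinear K (H \<alpha>) (H \<beta>) R.T (\<lambda>u v. R.pure u (VW.pure v w))" if "w \<in> carrier (H \<gamma>)" for w
    using bilinear_comp[OF R.pure_bilinear module_hom_id pw[OF that]] by simp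
  have A1: "bilinear K UV.T (H \<gamma>) R.T ?A"
  proof (rule bilinear_flip, rule UV.tensor_lift_param[OF R.tensor_space_module H_module[OF \<gamma>] A2])
    fix v w assume "v \<in> carrier (H \<alpha>)" "w \<in> carrier (H \<beta>)"
    then show "(\<lambda>p. R.pure v (VW.pure w p)) \<in> module_hom K (H \<gamma>) R.T"
      using module_hom_comp[OF pv, of w "R.pure v" R.T] R.pure_bilinear by (simp add: bilinear_def)
  qed assumption
  note mem = comult_terms_mem
  have pc: "R.pure (fst q) (VW.pure (snd q) c) \<in> carrier R.T"
    if "q \<in> set (comult_terms \<alpha> \<beta> u)" "u \<in> carrier (H (\<alpha> \<otimes> \<beta>))" "c \<in> carrier (H \<gamma>)" for q u c
    using mem[OF that(1) \<alpha> \<beta> that(2)] that(3) by (intro R.pure_closed VW.pure_closed)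
  have AD: "?A (\<Delta> \<alpha> \<beta> u) c = lsum R.T (\<lambda>q. R.pure (fst q) (VW.pure (snd q) c)) (comult_terms \<alpha> \<beta> u)"
    if "u \<in> carrier (H (\<alpha> \<otimes> \<beta>))" "c \<in> carrier (H \<gamma>)" for u c
    by (rule lift_comult[OF \<alpha> \<beta> that(1) R.tensor_space_module A2[OF that(2)]])
  have "?\<Theta> (tensor_assoc K (H \<alpha>) (H \<beta>) (H \<gamma>)
      (tensor_map K UV.T (H \<gamma>) (\<Delta> \<alpha> \<beta>) id (\<Delta> (\<alpha> \<otimes> \<beta>) \<gamma> x))) =
    ?\<Theta> (lsum R.T (\<lambda>p. ?A (\<Delta> \<alpha> \<beta> (fst p)) (snd p)) (comult_terms (\<alpha> \<otimes> \<beta>) \<gamma> x))"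
    using lift_map_comult[OF \<alpha>\<beta> \<gamma> x UV.tensor_space_vectorspace H_vectorspace[OF \<gamma>] R.tensor_space_module
        comult_module_hom[OF \<alpha> \<beta>] module_hom_id A1]
    by (simp add: tensor_assoc_def Let_def)
  also have "\<dots> = lsum K (\<lambda>p. ?\<Theta> (?A (\<Delta> \<alpha> \<beta> (fst p)) (snd p))) (comult_terms (\<alpha> \<otimes> \<beta>) \<gamma> x)"
    by (rule functional_lsum[OF R.tensor_lift_hom[OF scalar_module C1] R.tensor_space_module])
      (intro bilinear_closed[OF A1] module_hom_in_carrier[OF comult_module_hom[OF \<alpha> \<beta>]] mem[OF _ \<alpha>\<beta> \<gamma> x])
  also have "\<dots> = lsum K (\<lambda>p. lsum K (\<lambda>q. C (fst q) (snd q) (snd p)) (comult_terms \<alpha> \<beta> (fst p)))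
      (comult_terms (\<alpha> \<otimes> \<beta>) \<gamma> x)"
  proof (rule lsum_cong)
    fix p assume p: "p \<in> set (comult_terms (\<alpha> \<otimes> \<beta>) \<gamma> x)"
    note pm = mem[OF p \<alpha>\<beta> \<gamma> x]
    have "?\<Theta> (?A (\<Delta> \<alpha> \<beta> (fst p)) (snd p)) =
        lsum ?k (\<lambda>q. tensor_lift K ?k (C (fst q)) (VW.pure (snd q) (snd p))) (comult_terms \<alpha> \<beta> (fst p))"
      unfolding AD[OF pm]
      by (rule R.tensor_lift_lsum[OF scalar_module C1]) (intro VW.pure_closed mem[OF _ \<alpha> \<beta> pm(1)] pm; assumption)+
    also have "\<dots> = lsum K (\<lambda>q. C (fst q) (snd q) (snd p)) (comult_terms \<alpha> \<beta> (fst p))"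
      unfolding lsum_scalar_space
      by (rule lsum_cong) (rule VW.tensor_lift_pure[OF scalar_module C2]; intro mem[OF _ \<alpha> \<beta> pm(1)] pm)
    finally show "?\<Theta> (?A (\<Delta> \<alpha> \<beta> (fst p)) (snd p)) =
        lsum K (\<lambda>q. C (fst q) (snd q) (snd p)) (comult_terms \<alpha> \<beta> (fst p))" .
  qed
  finally have left: "?\<Theta> (tensor_assoc K (H \<alpha>) (H \<beta>) (H \<gamma>)
      (tensor_map K UV.T (H \<gamma>) (\<Delta> \<alpha> \<beta>) id (\<Delta> (\<alpha> \<otimes> \<beta>) \<gamma> x))) =
    lsum K (\<lambda>p. lsum K (\<lambda>q. C (fst q) (snd q) (snd p)) (comult_terms \<alpha> \<beta> (fst p)))
      (comult_terms (\<alpha> \<otimes> \<beta>) \<gamma> x)" .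
  have "?\<Theta> (tensor_map K (H \<alpha>) VW.T id (\<Delta> \<beta> \<gamma>) (\<Delta> \<alpha> (\<beta> \<otimes> \<gamma>) x)) =
      lsum ?k (\<lambda>p. tensor_lift K ?k (C (id (fst p))) (\<Delta> \<beta> \<gamma> (snd p))) (comult_terms \<alpha> (\<beta> \<otimes> \<gamma>) x)"
    by (rule lift_map_comult[OF \<alpha> \<beta>\<gamma> x' H_vectorspace[OF \<alpha>] VW.tensor_space_vectorspace scalar_module
          module_hom_id comult_module_hom[OF \<beta> \<gamma>] C1])
  also have "\<dots> = lsum K (\<lambda>p. lsum K (\<lambda>q. C (fst p) (fst q) (snd q)) (comult_terms \<beta> \<gamma> (snd p)))
      (comult_terms \<alpha> (\<beta> \<otimes> \<gamma>) x)"
    unfolding lsum_scalar_space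
  proof (rule lsum_cong)
    fix p assume p: "p \<in> set (comult_terms \<alpha> (\<beta> \<otimes> \<gamma>) x)"
    note pm = mem[OF p \<alpha> \<beta>\<gamma> x']
    show "tensor_lift K ?k (C (id (fst p))) (\<Delta> \<beta> \<gamma> (snd p)) =
        lsum K (\<lambda>q. C (fst p) (fst q) (snd q)) (comult_terms \<beta> \<gamma> (snd p))"
      using lift_comult[OF \<beta> \<gamma> pm(2) scalar_module C2[OF pm(1)]] by (simp add: lsum_scalar_space)
  qed
  finally show ?thesis
    using left coassoc[OF \<alpha> \<beta> \<gamma> x] by (simp add: sweedler_def case_prod_unfold)
qed

lemma counit_module_hom: "\<epsilon> \<in> module_hom K (H \<one>) (scalar_space K)"
  using counit_hom by (simp add: algebra_hom_def)

lemma comult_terms_right_unitor: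
  assumes \<alpha>: "\<alpha> \<in> carrier G" and \<beta>: "\<beta> \<in> carrier G" and x: "x \<in> carrier (H (\<alpha> \<otimes> \<beta>))"
    and h: "h \<in> module_hom K (H \<beta>) (scalar_space K)" and f: "f \<in> module_hom K (H \<alpha>) (scalar_space K)"
  shows "sweedler K (comult_terms \<alpha> \<beta> x) (\<lambda>a b. f a \<otimes>\<^bsub>K\<^esub> h b) =
    f (right_unitor K (H \<alpha>) (tensor_map K (H \<alpha>) (scalar_space K) id h (\<Delta> \<alpha> \<beta> x)))"
proof -
  note mem = comult_terms_mem[OF _ \<alpha> \<beta> x]
  note hm = H_module[OF \<alpha>]
  interpret A: module K "H \<alpha>" by (rule hm)
  have "right_unitor K (H \<alpha>) (tensor_map K (H \<alpha>) (scalar_space K) id h (\<Delta> \<alpha> \<beta> x)) =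
      lsum (H \<alpha>) (\<lambda>p. h (snd p) \<odot>\<^bsub>H \<alpha>\<^esub> id (fst p)) (comult_terms \<alpha> \<beta> x)"
    unfolding right_unitor_def
    by (rule lift_map_comult[OF \<alpha> \<beta> x H_vectorspace[OF \<alpha>] scalar_space_vectorspace[OF K.field_axioms]
          hm module_hom_id h smult_bilinear[OF hm]])
  also have "f \<dots> = lsum K (\<lambda>p. f (h (snd p) \<odot>\<^bsub>H \<alpha>\<^esub> id (fst p))) (comult_terms \<alpha> \<beta> x)"
    by (rule functional_lsum[OF f hm]) (use mem module_hom_in_carrier[OF h] in simp)
  also have "\<dots> = lsum K (\<lambda>p. f (fst p) \<otimes>\<^bsub>K\<^esub> h (snd p)) (comult_terms \<alpha> \<beta> x)"
    by (rule lsum_cong)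
      (use mem module_hom_in_carrier[OF h] module_hom_in_carrier[OF f] module_hom_smult[OF f] in \<open>simp add: K.m_comm\<close>)
  finally show ?thesis by (simp add: sweedler_def case_prod_unfold)
qed

lemma comult_terms_left_unitor:
  assumes \<alpha>: "\<alpha> \<in> carrier G" and \<beta>: "\<beta> \<in> carrier G" and x: "x \<in> carrier (H (\<alpha> \<otimes> \<beta>))"
    and h: "h \<in> module_hom K (H \<alpha>) (scalar_space K)" and f: "f \<in> module_hom K (H \<beta>) (scalar_space K)"
  shows "sweedler K (comult_terms \<alpha> \<beta> x) (\<lambda>a b. h a \<otimes>\<^bsub>K\<^esub> f b) =
    f (left_unitor K (H \<beta>) (tensor_map K (scalar_space K) (H \<beta>) h id (\<Delta> \<alpha> \<beta> x)))"
proof -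
  note mem = comult_terms_mem[OF _ \<alpha> \<beta> x]
  note hm = H_module[OF \<beta>]
  interpret A: module K "H \<beta>" by (rule hm)
  have "left_unitor K (H \<beta>) (tensor_map K (scalar_space K) (H \<beta>) h id (\<Delta> \<alpha> \<beta> x)) =
      lsum (H \<beta>) (\<lambda>p. h (fst p) \<odot>\<^bsub>H \<beta>\<^esub> id (snd p)) (comult_terms \<alpha> \<beta> x)"
    unfolding left_unitor_def
    by (rule lift_map_comult[OF \<alpha> \<beta> x scalar_space_vectorspace[OF K.field_axioms] H_vectorspace[OF \<beta>]
          hm h module_hom_id bilinear_flip[OF smult_bilinear[OF hm]]])
  also have "f \<dots> = lsum K (\<lambda>p. f (h (fst p) \<odot>\<^bsub>H \<beta>\<^esub> id (snd p))) (comult_terms \<alpha> \<beta> x)"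
    by (rule functional_lsum[OF f hm]) (use mem module_hom_in_carrier[OF h] in simp)
  also have "\<dots> = lsum K (\<lambda>p. h (fst p) \<otimes>\<^bsub>K\<^esub> f (snd p)) (comult_terms \<alpha> \<beta> x)"
    by (rule lsum_cong)
      (use mem module_hom_in_carrier[OF h] module_hom_smult[OF f] in simp)
  finally show ?thesis by (simp add: sweedler_def case_prod_unfold)
qed

lemma comult_terms_mult_map:
  assumes \<alpha>: "\<alpha> \<in> carrier G" and \<beta>: "\<beta> \<in> carrier G" and \<gamma>: "\<gamma> \<in> carrier G" and x: "x \<in> carrier (H (\<alpha> \<otimes> \<beta>))"
    and h: "h \<in> module_hom K (H \<alpha>) (H \<gamma>)" and k: "k \<in> module_hom K (H \<beta>) (H \<gamma>)"
    and f: "f \<in> module_hom K (H \<gamma>) (scalar_space K)"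
  shows "sweedler K (comult_terms \<alpha> \<beta> x) (\<lambda>a b. f (h a \<otimes>\<^bsub>H \<gamma>\<^esub> k b)) =
    f (mult_map K (H \<gamma>) (tensor_map K (H \<gamma>) (H \<gamma>) h k (\<Delta> \<alpha> \<beta> x)))"
proof -
  note mem = comult_terms_mem[OF _ \<alpha> \<beta> x]
  note hm = H_module[OF \<gamma>]
  interpret A: unital_algebra K "H \<gamma>" by (rule algebras[OF \<gamma>])
  have "mult_map K (H \<gamma>) (tensor_map K (H \<gamma>) (H \<gamma>) h k (\<Delta> \<alpha> \<beta> x)) =
      lsum (H \<gamma>) (\<lambda>p. h (fst p) \<otimes>\<^bsub>H \<gamma>\<^esub> k (snd p)) (comult_terms \<alpha> \<beta> x)"
    unfolding mult_map_def
    by (rule lift_map_comult[OF \<alpha> \<beta> x H_vectorspace[OF \<gamma>] H_vectorspace[OF \<gamma>]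
          hm h k mult_bilinear[OF algebras[OF \<gamma>]]])
  also have "f \<dots> = lsum K (\<lambda>p. f (h (fst p) \<otimes>\<^bsub>H \<gamma>\<^esub> k (snd p))) (comult_terms \<alpha> \<beta> x)"
    by (rule functional_lsum[OF f hm]) (use mem module_hom_in_carrier[OF h] module_hom_in_carrier[OF k] in simp)
  finally show ?thesis by (simp add: sweedler_def case_prod_unfold)
qed

lemma comult_terms_linear:
  assumes \<alpha>: "\<alpha> \<in> carrier G" and \<beta>: "\<beta> \<in> carrier G" and B: "bilinear K (H \<alpha>) (H \<beta>) (scalar_space K) B"
  shows "(\<lambda>x. sweedler K (comult_terms \<alpha> \<beta> x) B) \<in> module_hom K (H (\<alpha> \<otimes> \<beta>)) (scalar_space K)"
proof -
  interpret tensor_product K "H \<alpha>" "H \<beta>" using tensor \<alpha> \<beta> by simp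
  have "(\<lambda>x. tensor_lift K (scalar_space K) B (\<Delta> \<alpha> \<beta> x)) \<in> module_hom K (H (\<alpha> \<otimes> \<beta>)) (scalar_space K)"
    by (rule module_hom_comp[OF comult_module_hom[OF \<alpha> \<beta>] tensor_lift_hom[OF scalar_module B]])
  then show ?thesis
    by (rule module_hom_cong) (use \<alpha> \<beta> H_module sweedler_comult[OF \<alpha> \<beta> _ B] in simp_all)
qed

lemma antipode_module_hom: "\<alpha> \<in> carrier G \<Longrightarrow> S (inv \<alpha>) \<in> module_hom K (H (inv \<alpha>)) (H \<alpha>)"
  using antipode_hom[of "inv \<alpha>"] by simp

lemma sweedler_coalgebra:
  assumes fin: "finite_type G K H"
    and surj: "\<And>\<alpha> y. \<lbrakk>\<alpha> \<in> carrier G; y \<in> carrier (H (inv \<alpha>))\<rbrakk> \<Longrightarrow> \<exists>x\<in>carrier (H \<alpha>). S \<alpha> x = y"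
  shows "sweedler_coalgebra G K H comult_terms \<epsilon> S"
proof (intro sweedler_coalgebra.intro sweedler_coalgebra_axioms.intro)
  show "group G" by (rule group_axioms)
  show "field K" by (rule K.field_axioms)
next
  fix \<alpha> assume \<alpha>: "\<alpha> \<in> carrier G"
  then have i: "inv \<alpha> \<in> carrier G" by simp
  show "unital_algebra K (H \<alpha>)" by (rule algebras[OF \<alpha>])
  show "vectorspace.fin_dim K (H \<alpha>)" using fin \<alpha> by (simp add: finite_type_def)
  show "S \<alpha> \<in> module_hom K (H \<alpha>) (H (inv \<alpha>))" by (rule antipode_hom[OF \<alpha>])
  show "\<exists>x\<in>carrier (H \<alpha>). S \<alpha> x = y" if "y \<in> carrier (H (inv \<alpha>))" for y by (rule surj[OF \<alpha> that])
  fix f assume f: "f \<in> module_hom K (H \<alpha>) (scalar_space K)"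
  show "sweedler K (comult_terms \<alpha> \<one> x) (\<lambda>a b. f a \<otimes>\<^bsub>K\<^esub> \<epsilon> b) = f x" if "x \<in> carrier (H \<alpha>)" for x
    using comult_terms_right_unitor[OF \<alpha> one_closed _ counit_module_hom f, of x] counit_right[OF \<alpha> that] that \<alpha> by simp
  show "sweedler K (comult_terms \<one> \<alpha> x) (\<lambda>a b. \<epsilon> a \<otimes>\<^bsub>K\<^esub> f b) = f x" if "x \<in> carrier (H \<alpha>)" for x
    using comult_terms_left_unitor[OF one_closed \<alpha> _ counit_module_hom f, of x] counit_left[OF \<alpha> that] that \<alpha> by simp
  fix x assume x: "x \<in> carrier (H \<one>)"
  have e: "f (\<epsilon> x \<odot>\<^bsub>H \<alpha>\<^esub> \<one>\<^bsub>H \<alpha>\<^esub>) = \<epsilon> x \<otimes>\<^bsub>K\<^esub> f \<one>\<^bsub>H \<alpha>\<^esub>"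
    using module_hom_smult[OF f] module_hom_in_carrier[OF counit_module_hom x] ring.ring_simprules(6)[OF H_ring[OF \<alpha>]]
    by simp
  show "sweedler K (comult_terms (inv \<alpha>) \<alpha> x) (\<lambda>a b. f (S (inv \<alpha>) a \<otimes>\<^bsub>H \<alpha>\<^esub> b)) = \<epsilon> x \<otimes>\<^bsub>K\<^esub> f \<one>\<^bsub>H \<alpha>\<^esub>"
    using comult_terms_mult_map[OF i \<alpha> \<alpha> _ antipode_module_hom[OF \<alpha>] module_hom_id f, of x]
      antipode_left[OF \<alpha> x] x \<alpha> by (simp add: e)
  show "sweedler K (comult_terms \<alpha> (inv \<alpha>) x) (\<lambda>a b. f (a \<otimes>\<^bsub>H \<alpha>\<^esub> S (inv \<alpha>) b)) = \<epsilon> x \<otimes>\<^bsub>K\<^esub> f \<one>\<^bsub>H \<alpha>\<^esub>"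
    using comult_terms_mult_map[OF \<alpha> i \<alpha> _ module_hom_id antipode_module_hom[OF \<alpha>] f, of x]
      antipode_right[OF \<alpha> x] x \<alpha> by (simp add: e)
next
  show "\<epsilon> \<in> module_hom K (H \<one>) (scalar_space K)" by (rule counit_module_hom)
  show "\<epsilon> (x \<otimes>\<^bsub>H \<one>\<^esub> y) = \<epsilon> x \<otimes>\<^bsub>K\<^esub> \<epsilon> y" if "x \<in> carrier (H \<one>)" "y \<in> carrier (H \<one>)" for x y
    using counit_hom ring_hom_mult[of \<epsilon> "H \<one>" "scalar_space K" x y] that
    by (simp add: algebra_hom_def scalar_space_def)
  show "\<epsilon> \<one>\<^bsub>H \<one>\<^esub> = \<one>\<^bsub>K\<^esub>"
    using counit_hom ring_hom_one[of \<epsilon> "H \<one>" "scalar_space K"]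
    by (simp add: algebra_hom_def scalar_space_def)
qed (fact comult_terms(1) comult_terms_linear comult_terms_mult comult_terms_coassoc)+

lemma right_G_integral_sweedler:
  assumes sw: "sweedler_coalgebra G K H comult_terms \<epsilon> S" and mu: "right_G_integral G K H \<Delta> \<mu>"
  shows "sweedler_coalgebra.right_integral G K H comult_terms \<mu>"
proof -
  interpret sw: sweedler_coalgebra G K H comult_terms \<epsilon> S by (rule sw)
  have hom: "\<mu> \<alpha> \<in> module_hom K (H \<alpha>) (scalar_space K)" if "\<alpha> \<in> carrier G" for \<alpha>
    using mu that by (simp add: right_G_integral_def)
  show ?thesis
    unfolding sw.right_integral_def
  proof (intro conjI ballI allI impI)
    fix \<alpha> \<beta> x q
    assume *: "\<alpha> \<in> carrier G" "\<beta> \<in> carrier G" "x \<in> carrier (H (\<alpha> \<otimes> \<beta>))"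
      and q: "q \<in> module_hom K (H \<beta>) (scalar_space K)"
    have "left_unitor K (H \<beta>) (tensor_map K (scalar_space K) (H \<beta>) (\<mu> \<alpha>) id (\<Delta> \<alpha> \<beta> x)) =
        \<mu> (\<alpha> \<otimes> \<beta>) x \<odot>\<^bsub>H \<beta>\<^esub> \<one>\<^bsub>H \<beta>\<^esub>"
      using mu * by (simp add: right_G_integral_def)
    moreover have "\<mu> (\<alpha> \<otimes> \<beta>) x \<in> carrier K"
      using module_hom_in_carrier[OF hom *(3)] * by simp
    ultimately show "sweedler K (comult_terms \<alpha> \<beta> x) (\<lambda>a b. \<mu> \<alpha> a \<otimes>\<^bsub>K\<^esub> q b) =
        \<mu> (\<alpha> \<otimes> \<beta>) x \<otimes>\<^bsub>K\<^esub> q \<one>\<^bsub>H \<beta>\<^esub>"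
      using comult_terms_left_unitor[OF * hom[OF *(1)] q] module_hom_smult[OF q]
        sw.H_one_closed[OF *(2)] by simp
  qed (rule hom)
qed

text \<open>
  In the opposite coalgebra the second tensor factor of a coproduct comes first, which turns the
  axiom for left integrals into the one for right integrals.
\<close>

lemma left_G_integral_sweedler:
  assumes sw: "sweedler_coalgebra G K H comult_terms \<epsilon> S" and mu: "left_G_integral G K H \<Delta> \<mu>"
  shows "sweedler_coalgebra.right_integral (opposite G) K (\<lambda>\<alpha>. opposite (H \<alpha>))
    (\<lambda>\<alpha> \<beta> x. map prod.swap (comult_terms \<beta> \<alpha> x)) \<mu>"
proof -
  interpret sw: sweedler_coalgebra G K H comult_terms \<epsilon> S by (rule sw)
  interpret op: sweedler_coalgebra "opposite G" K "\<lambda>\<alpha>. opposite (H \<alpha>)"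
    "\<lambda>\<alpha> \<beta> x. map prod.swap (comult_terms \<beta> \<alpha> x)" \<epsilon> S
    by (rule sw.opposite_coalgebra)
  have hom: "\<mu> \<alpha> \<in> module_hom K (H \<alpha>) (scalar_space K)" if "\<alpha> \<in> carrier G" for \<alpha>
    using mu that by (simp add: left_G_integral_def)
  show ?thesis
    unfolding op.right_integral_def opposite_simps opposite_module_hom
  proof (intro conjI ballI allI impI)
    fix \<beta> \<alpha> x q
    assume *: "\<beta> \<in> carrier G" "\<alpha> \<in> carrier G" "x \<in> carrier (H (\<alpha> \<otimes> \<beta>))"
      and q: "q \<in> module_hom K (H \<alpha>) (scalar_space K)"
    have "right_unitor K (H \<alpha>) (tensor_map K (H \<alpha>) (scalar_space K) id (\<mu> \<beta>) (\<Delta> \<alpha> \<beta> x)) =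
        \<mu> (\<alpha> \<otimes> \<beta>) x \<odot>\<^bsub>H \<alpha>\<^esub> \<one>\<^bsub>H \<alpha>\<^esub>"
      using mu * by (simp add: left_G_integral_def)
    moreover have "\<mu> (\<alpha> \<otimes> \<beta>) x \<in> carrier K"
      using module_hom_in_carrier[OF hom *(3)] * by simp
    moreover have "sweedler K (comult_terms \<alpha> \<beta> x) (\<lambda>a b. \<mu> \<beta> b \<otimes>\<^bsub>K\<^esub> q a) =
        sweedler K (comult_terms \<alpha> \<beta> x) (\<lambda>a b. q a \<otimes>\<^bsub>K\<^esub> \<mu> \<beta> b)"
      using sw.comult_mem[OF _ *(2,1,3)] module_hom_in_carrier[OF hom[OF *(1)]] module_hom_in_carrier[OF q]
      by (intro sweedler_cong K.m_comm) auto
    ultimately show "sweedler K (map prod.swap (comult_terms \<alpha> \<beta> x)) (\<lambda>a b. \<mu> \<beta> a \<otimes>\<^bsub>K\<^esub> q b) =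
        \<mu> (\<alpha> \<otimes> \<beta>) x \<otimes>\<^bsub>K\<^esub> q \<one>\<^bsub>H \<alpha>\<^esub>"
      using comult_terms_right_unitor[OF *(2,1,3) hom[OF *(1)] q] module_hom_smult[OF q]
        sw.H_one_closed[OF *(2)] by (simp add: sweedler_flip)
  qed (rule hom)
qed

end

section \<open>Pivots\<close>

context pivotal_hopf_group_coalgebra
begin

text \<open>
  The antipode axioms at \<open>g\<^sub>1\<close>, whose coproducts are the pure tensors \<open>g \<otimes> g\<close> and whose counit is
  \<open>1\<close>.
\<close>

lemma pivot_inverse:
  assumes \<alpha>: "\<alpha> \<in> carrier G"
  shows "S (inv \<alpha>) (g (inv \<alpha>)) \<in> carrier (H \<alpha>)"
    and "S (inv \<alpha>) (g (inv \<alpha>)) \<otimes>\<^bsub>H \<alpha>\<^esub> g \<alpha> = \<one>\<^bsub>H \<alpha>\<^esub>"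
    and "g \<alpha> \<otimes>\<^bsub>H \<alpha>\<^esub> S (inv \<alpha>) (g (inv \<alpha>)) = \<one>\<^bsub>H \<alpha>\<^esub>"
proof -
  have i: "inv \<alpha> \<in> carrier G" using \<alpha> by simp
  interpret A: unital_algebra K "H \<alpha>" by (rule algebras[OF \<alpha>])
  interpret AA: tensor_product K "H \<alpha>" "H \<alpha>" using tensor \<alpha> by simp
  note S = antipode_module_hom[OF \<alpha>]
  have g: "g \<alpha> \<in> carrier (H \<alpha>)" "g (inv \<alpha>) \<in> carrier (H (inv \<alpha>))" "g \<one> \<in> carrier (H \<one>)"
    using pivot_closed \<alpha> i by auto
  show Sg: "S (inv \<alpha>) (g (inv \<alpha>)) \<in> carrier (H \<alpha>)" by (rule module_hom_in_carrier[OF S g(2)])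
  note mm = AA.tensor_lift_pure[OF H_module[OF \<alpha>] mult_bilinear[OF algebras[OF \<alpha>]]]
  interpret L: tensor_product K "H (inv \<alpha>)" "H \<alpha>" using tensor \<alpha> i by simp
  have "tensor_map K (H \<alpha>) (H \<alpha>) (S (inv \<alpha>)) id (\<Delta> (inv \<alpha>) \<alpha> (g \<one>)) = AA.pure (S (inv \<alpha>) (g (inv \<alpha>))) (id (g \<alpha>))"
    using pivot_comult[OF i \<alpha>] \<alpha> g
      L.tensor_lift_pure[OF AA.tensor_space_module bilinear_comp[OF AA.pure_bilinear S module_hom_id]]
    by (simp add: tensor_map_def)
  then show "S (inv \<alpha>) (g (inv \<alpha>)) \<otimes>\<^bsub>H \<alpha>\<^esub> g \<alpha> = \<one>\<^bsub>H \<alpha>\<^esub>"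
    using antipode_left[OF \<alpha> g(3)] mm[OF Sg g(1)] pivot_counit by (simp add: mult_map_def)
  interpret R: tensor_product K "H \<alpha>" "H (inv \<alpha>)" using tensor \<alpha> i by simp
  have "tensor_map K (H \<alpha>) (H \<alpha>) id (S (inv \<alpha>)) (\<Delta> \<alpha> (inv \<alpha>) (g \<one>)) = AA.pure (id (g \<alpha>)) (S (inv \<alpha>) (g (inv \<alpha>)))"
    using pivot_comult[OF \<alpha> i] \<alpha> g
      R.tensor_lift_pure[OF AA.tensor_space_module bilinear_comp[OF AA.pure_bilinear module_hom_id S]]
    by (simp add: tensor_map_def)
  then show "g \<alpha> \<otimes>\<^bsub>H \<alpha>\<^esub> S (inv \<alpha>) (g (inv \<alpha>)) = \<one>\<^bsub>H \<alpha>\<^esub>"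
    using antipode_right[OF \<alpha> g(3)] mm[OF g(1) Sg] pivot_counit by (simp add: mult_map_def)
qed

lemma pivot_unit: "\<alpha> \<in> carrier G \<Longrightarrow> g \<alpha> \<in> Units (H \<alpha>)"
  using pivot_inverse pivot_closed by (auto simp: Units_def)

text \<open>
  The square of the antipode is a conjugation, hence surjective.
\<close>

lemma antipode_surj:
  assumes \<alpha>: "\<alpha> \<in> carrier G" and y: "y \<in> carrier (H (inv \<alpha>))"
  shows "\<exists>x\<in>carrier (H \<alpha>). S \<alpha> x = y"
proof -
  let ?A = "H (inv \<alpha>)" and ?g = "g (inv \<alpha>)"
  have i: "inv \<alpha> \<in> carrier G" using \<alpha> by simp
  interpret A: ring ?A by (rule H_ring[OF i])
  note u = pivot_unit[OF i]
  let ?w = "inv\<^bsub>?A\<^esub> ?g \<otimes>\<^bsub>?A\<^esub> y \<otimes>\<^bsub>?A\<^esub> ?g"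
  note g = A.Units_closed[OF u] A.Units_inv_closed[OF u]
  have w: "?w \<in> carrier ?A" using g y by (intro A.m_closed)
  have "S \<alpha> (S (inv \<alpha>) ?w) = ?g \<otimes>\<^bsub>?A\<^esub> ?w \<otimes>\<^bsub>?A\<^esub> inv\<^bsub>?A\<^esub> ?g"
    using pivot_conj[OF i w] \<alpha> by simp
  also have "\<dots> = (?g \<otimes>\<^bsub>?A\<^esub> inv\<^bsub>?A\<^esub> ?g) \<otimes>\<^bsub>?A\<^esub> y \<otimes>\<^bsub>?A\<^esub> (?g \<otimes>\<^bsub>?A\<^esub> inv\<^bsub>?A\<^esub> ?g)"
    using g y by (simp only: A.m_assoc A.m_closed)
  also have "\<dots> = y" using y by (simp add: A.Units_r_inv[OF u])
  finally show ?thesis using module_hom_in_carrier[OF antipode_module_hom[OF \<alpha>] w] by blast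
qed

end

theorem proposition2p6:
  fixes G :: "('g, 'm) monoid_scheme"
    and K :: "('k, 'n) ring_scheme"
    and H :: "'g \<Rightarrow> ('k, 'a) module"
    and \<Delta> :: "'g \<Rightarrow> 'g \<Rightarrow> 'a \<Rightarrow> ('a \<times> 'a \<Rightarrow> 'k) set"
    and \<epsilon> :: "'a \<Rightarrow> 'k"
    and S :: "'g \<Rightarrow> 'a \<Rightarrow> 'a"
    and g :: "'g \<Rightarrow> 'a"
  assumes "pivotal_hopf_group_coalgebra G K H \<Delta> \<epsilon> S g"
    and "finite_type G K H"
    and "unimodular G H \<epsilon>"
  shows "(\<forall>\<mu>. right_G_integral G K H \<Delta> \<mu> \<and> nonzero_family G K H \<mu> \<longrightarrow>
            (\<forall>\<alpha>\<in>carrier G.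
              symmetric_form (H \<alpha>) (\<lambda>x y. symmetrised_right H g \<mu> \<alpha> (x \<otimes>\<^bsub>H \<alpha>\<^esub> y)) \<and>
              nondegenerate_form K (H \<alpha>) (\<lambda>x y. symmetrised_right H g \<mu> \<alpha> (x \<otimes>\<^bsub>H \<alpha>\<^esub> y)))) \<and>
         (\<forall>\<mu>l. left_G_integral G K H \<Delta> \<mu>l \<and> nonzero_family G K H \<mu>l \<longrightarrow>
            (\<forall>\<alpha>\<in>carrier G.
              symmetric_form (H \<alpha>) (\<lambda>x y. symmetrised_left H g \<mu>l \<alpha> (x \<otimes>\<^bsub>H \<alpha>\<^esub> y)) \<and>
              nondegenerate_form K (H \<alpha>) (\<lambda>x y. symmetrised_left H g \<mu>l \<alpha> (x \<otimes>\<^bsub>H \<alpha>\<^esub> y))))"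
proof (intro conjI allI impI ballI)
  interpret pivotal_hopf_group_coalgebra G K H \<Delta> \<epsilon> S g by fact
  have sw: "sweedler_coalgebra G K H comult_terms \<epsilon> S"
    by (rule sweedler_coalgebra[OF assms(2) antipode_surj])
  interpret sw: sweedler_coalgebra G K H comult_terms \<epsilon> S by (rule sw)
  interpret op: sweedler_coalgebra "opposite G" K "\<lambda>\<alpha>. opposite (H \<alpha>)"
    "\<lambda>\<alpha> \<beta> x. map prod.swap (comult_terms \<beta> \<alpha> x)" \<epsilon> S
    by (rule sw.opposite_coalgebra)
  have unimod: "left_cointegrals (H \<one>\<^bsub>G\<^esub>) \<epsilon> = right_cointegrals (H \<one>\<^bsub>G\<^esub>) \<epsilon>"
    using assms(3) by (simp add: unimodular_def)
  fix \<alpha> assume \<alpha>: "\<alpha> \<in> carrier G"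
  interpret A: unital_algebra K "H \<alpha>" by (rule algebras[OF \<alpha>])
  let ?m = "\<lambda>x y. x \<otimes>\<^bsub>H \<alpha>\<^esub> y" and ?g = "g \<alpha>" and ?i = "inv\<^bsub>H \<alpha>\<^esub> (g \<alpha>)"
  note u = pivot_unit[OF \<alpha>]
  note c = A.Units_closed[OF u] A.Units_inv_closed[OF u]
  note gi = A.Units_r_inv[OF u] and ig = A.Units_l_inv[OF u]
  have gig: "?m ?g (?m ?i x) = x" and igg: "?m ?i (?m ?g x) = x" if "x \<in> carrier (H \<alpha>)" for x
    using that c by (simp_all add: A.m_assoc[symmetric] gi ig)
  {
    fix \<mu> assume mu: "right_G_integral G K H \<Delta> \<mu> \<and> nonzero_family G K H \<mu>"
    then have "sw.right_integral \<mu>" using right_G_integral_sweedler[OF sw] by blast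
    note main = sw.unimodular_integral[OF this conjunct2[OF mu] unimod \<alpha>]
    have sym: "\<mu> \<alpha> (?m ?g (?m x y)) = \<mu> \<alpha> (?m ?g (?m y x))"
      if x: "x \<in> carrier (H \<alpha>)" and y: "y \<in> carrier (H \<alpha>)" for x y
    proof -
      have "\<mu> \<alpha> (?m ?g (?m x y)) = \<mu> \<alpha> (?m (?m ?g x) y)" using x y c by (simp add: A.m_assoc)
      also have "\<dots> = \<mu> \<alpha> (?m (S (inv\<^bsub>G\<^esub> \<alpha>) (S \<alpha> y)) (?m ?g x))"
        using main(1)[OF y, of "?m ?g x"] x c by simp
      also have "\<dots> = \<mu> \<alpha> (?m ?g (?m y x))"
        using x y c by (simp add: pivot_conj[OF \<alpha> y] A.m_assoc igg)
      finally show ?thesis .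
    qed
    have nondeg: "x = \<zero>\<^bsub>H \<alpha>\<^esub>"
      if x: "x \<in> carrier (H \<alpha>)" and 0: "\<forall>y\<in>carrier (H \<alpha>). \<mu> \<alpha> (?m ?g (?m x y)) = \<zero>\<^bsub>K\<^esub>" for x
    proof -
      have "?m ?g x = \<zero>\<^bsub>H \<alpha>\<^esub>"
        using x 0 c by (intro main(2)) (simp_all add: A.m_assoc)
      then show ?thesis using igg[OF x] c by simp
    qed
    show "symmetric_form (H \<alpha>) (\<lambda>x y. symmetrised_right H g \<mu> \<alpha> (x \<otimes>\<^bsub>H \<alpha>\<^esub> y))"
      using sym by (simp add: symmetric_form_def symmetrised_right_def)
    show "nondegenerate_form K (H \<alpha>) (\<lambda>x y. symmetrised_right H g \<mu> \<alpha> (x \<otimes>\<^bsub>H \<alpha>\<^esub> y))"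
      using nondeg sym by (auto simp: nondegenerate_form_def symmetrised_right_def)
  next
    fix \<mu> assume mu: "left_G_integral G K H \<Delta> \<mu> \<and> nonzero_family G K H \<mu>"
    then have i: "op.right_integral \<mu>" using left_G_integral_sweedler[OF sw] by blast
    have nz: "nonzero_family (opposite G) K (\<lambda>\<alpha>. opposite (H \<alpha>)) \<mu>"
      using mu by (simp add: nonzero_family_def)
    have unimod': "left_cointegrals (opposite (H \<one>\<^bsub>opposite G\<^esub>)) \<epsilon> =
        right_cointegrals (opposite (H \<one>\<^bsub>opposite G\<^esub>)) \<epsilon>"
      using unimod by (simp add: left_cointegrals_def right_cointegrals_def)
    note main = op.unimodular_integral[OF i nz unimod', of \<alpha>, unfolded opposite_simps opposite_m_inv opposite_module_simps, OF \<alpha>]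
    \<comment> \<open>The twisted trace property of a left integral is \<open>\<mu>(y S\<^sup>2(x)) = \<mu>(x y)\<close>; it moves \<open>g\<inverse>\<close>
      to the other end.\<close>
    have to_right: "\<mu> \<alpha> (?m ?i (?m x y)) = \<mu> \<alpha> (?m (?m y x) ?i)"
      if x: "x \<in> carrier (H \<alpha>)" and y: "y \<in> carrier (H \<alpha>)" for x y
    proof -
      have "\<mu> \<alpha> (?m ?i (?m x y)) = \<mu> \<alpha> (?m (?m ?i x) y)" using x y c by (simp add: A.m_assoc)
      also have "\<dots> = \<mu> \<alpha> (?m y (S (inv\<^bsub>G\<^esub> \<alpha>) (S \<alpha> (?m ?i x))))"
        using main(1)[of "?m ?i x" y] x y c by simp
      also have "\<dots> = \<mu> \<alpha> (?m (?m y x) ?i)"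
        using x y c by (simp add: pivot_conj[OF \<alpha>] gig A.m_assoc)
      finally show ?thesis .
    qed
    have sym: "\<mu> \<alpha> (?m ?i (?m x y)) = \<mu> \<alpha> (?m ?i (?m y x))"
      if x: "x \<in> carrier (H \<alpha>)" and y: "y \<in> carrier (H \<alpha>)" for x y
    proof -
      have "\<mu> \<alpha> (?m ?i (?m y x)) = \<mu> \<alpha> (?m (?m y x) (S (inv\<^bsub>G\<^esub> \<alpha>) (S \<alpha> ?i)))"
        using main(1)[of ?i "?m y x"] x y c by simp
      also have "\<dots> = \<mu> \<alpha> (?m (?m y x) ?i)"
        using c by (simp add: pivot_conj[OF \<alpha>] gi)
      finally show ?thesis using to_right[OF x y] by simp
    qed
    have nondeg: "y = \<zero>\<^bsub>H \<alpha>\<^esub>"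
      if y: "y \<in> carrier (H \<alpha>)" and 0: "\<forall>x\<in>carrier (H \<alpha>). \<mu> \<alpha> (?m ?i (?m x y)) = \<zero>\<^bsub>K\<^esub>" for y
    proof (rule main(2)[OF y])
      fix z assume z: "z \<in> carrier (H \<alpha>)"
      then show "\<mu> \<alpha> (?m z y) = \<zero>\<^bsub>K\<^esub>"
        using bspec[OF 0, of "?m ?g z"] y c igg[of "?m z y"] by (simp add: A.m_assoc)
    qed
    show "symmetric_form (H \<alpha>) (\<lambda>x y. symmetrised_left H g \<mu> \<alpha> (x \<otimes>\<^bsub>H \<alpha>\<^esub> y))"
      using sym by (simp add: symmetric_form_def symmetrised_left_def)
    show "nondegenerate_form K (H \<alpha>) (\<lambda>x y. symmetrised_left H g \<mu> \<alpha> (x \<otimes>\<^bsub>H \<alpha>\<^esub> y))"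
      using nondeg sym by (auto simp: nondegenerate_form_def symmetrised_left_def)
  }
qed

end
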